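(* Let $N\ge 1$ and let $\{u_j\}_{j=1}^N\subset H^1(T\mathbb{S}^2)$ be a family of tangent vector fields on $\mathbb{S}^2$ that is orthonormal in $L^2(T\mathbb{S}^2)$. Set $\rho(s)=\sum_{j=1}^N|u_j(s)|^2$. Then $$ \int_{\mathbb{S}^2}\rho(s)^2\,dS\le\frac{9}{2\pi}\sum_{j=1}^N\bigl(\|\operatorname{rot}u_j\|^2+\|\operatorname{div}u_j\|^2\bigr). $$ If, in addition, $\operatorname{div}u_j=0$ for all $j=1,\dots,N$, then $$ \int_{\mathbb{S}^2}\rho(s)^2\,dS\le\frac{9}{4\pi}\sum_{j=1}^N\|\operatorname{rot}u_j\|^2 , $$ and if, in addition, $\operatorname{rot}u_j=0$ for all $j=1,\dots,N$, then $$ \int_{\mathbb{S}^2}\rho(s)^2\,dS\le\frac{9}{4\pi}\sum_{j=1}^N\|\operatorname{div}u_j\|^2 . $$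
   Context: $\mathbb{S}^2$ is the unit two-dimensional sphere with its standard round metric and surface measure $dS$ (total area $4\pi$). $L^2(T\mathbb{S}^2)$ is the space of square-integrable real tangent vector fields with inner product $(u,v)=\int_{\mathbb{S}^2}u(s)\cdot v(s)\,dS$, and $H^1(T\mathbb{S}^2)$ is the corresponding Sobolev space of tangent vector fields. $\|\cdot\|$ is the $L_2$ norm over $\mathbb{S}^2$. $\operatorname{div}$ is the Riemannian divergence of a tangent vector field. For a tangent vector field $u$, $\operatorname{rot}u$ is the scalar function $\operatorname{rot}u:=-\operatorname{div}(n\times u)$, where $n$ is the unit outward normal vector to $\mathbb{S}^2$ (in a local orthonormal frame, $n\times u=(-u_2,u_1)$). *)

theory Defs
  imports "HOL-Analysis.Analysis"
begin

abbreviation S2 :: "(real^3) set" where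
  "S2 \<equiv> sphere 0 1"

(* Surface measure of the round sphere, given by integration in polar coordinates:
   a Borel set A of S2 has area 3 times the volume of the cone {r x | x \<in> A, 0 < r \<le> 1}. *)
definition dS :: "(real^3) measure" where
  "dS = scale_measure 3
     (distr (restrict_space lborel (cball 0 1 - {0})) (restrict_space borel S2) sgn)"

lemma emeasure_dS_S2: "emeasure dS S2 = ennreal (4 * pi)"
proof -
  let ?R = "restrict_space lborel (cball 0 1 - {0} :: (real^3) set)"
  have sg: "sgn x \<in> S2" if "x \<noteq> 0" for x :: "real^3"
    using that by (simp add: norm_sgn)
  have B: "cball 0 1 - {0} \<in> sets (lborel :: (real^3) measure)"
    by simp
  have "sgn \<in> ?R \<rightarrow>\<^sub>M (borel :: (real^3) measure)"
    unfolding sgn_div_norm by (rule measurable_restrict_space1) measurable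
  hence m: "sgn \<in> ?R \<rightarrow>\<^sub>M restrict_space borel S2"
    by (rule measurable_restrict_space2[rotated]) (use sg in \<open>auto simp: space_restrict_space\<close>)
  have "S2 \<in> sets (restrict_space borel S2)"
    by (auto simp: sets_restrict_space_iff)
  moreover have "sgn -` S2 \<inter> space ?R = cball 0 1 - {0}"
    using sg by (auto simp: space_restrict_space)
  ultimately have "emeasure dS S2 = 3 * emeasure ?R (cball 0 1 - {0})"
    by (simp add: dS_def emeasure_distr[OF m])
  also have "emeasure ?R (cball 0 1 - {0}) = emeasure lborel (cball (0::real^3) 1 - {0})"
    using B by (subst emeasure_restrict_space) auto
  also have "\<dots> = emeasure lborel (cball (0::real^3) 1)"
    by (subst emeasure_Diff) auto
  also have "\<dots> = ennreal (4 / 3 * pi)"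
    by (simp add: emeasure_cball unit_ball_vol_3)
  also have "3 * ennreal (4 / 3 * pi) = ennreal (3 * (4 / 3 * pi))"
    by (subst ennreal_mult) auto
  finally show ?thesis by simp
qed

definition tangent_field :: "(real^3 \<Rightarrow> real^3) \<Rightarrow> bool" where
  "tangent_field u \<longleftrightarrow> (\<forall>x\<in>S2. u x \<bullet> x = 0)"

definition L2_on_S2 :: "(real^3 \<Rightarrow> 'b::euclidean_space) \<Rightarrow> bool" where
  "L2_on_S2 f \<longleftrightarrow> f \<in> borel_measurable dS \<and> integrable dS (\<lambda>s. (norm (f s))\<^sup>2)"

definition L2T :: "(real^3 \<Rightarrow> real^3) set" where
  "L2T = {u. tangent_field u \<and> L2_on_S2 u}"

definition L2_norm :: "(real^3 \<Rightarrow> 'b::euclidean_space) \<Rightarrow> real" where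
  "L2_norm f = sqrt (\<integral>s. (norm (f s))\<^sup>2 \<partial>dS)"

definition L2_inner :: "(real^3 \<Rightarrow> real^3) \<Rightarrow> (real^3 \<Rightarrow> real^3) \<Rightarrow> real" where
  "L2_inner u v = (\<integral>s. u s \<bullet> v s \<partial>dS)"

primrec C_k :: "nat \<Rightarrow> (real^3 \<Rightarrow> real^3) \<Rightarrow> bool" where
  "C_k 0 f \<longleftrightarrow> continuous_on UNIV f"
| "C_k (Suc k) f \<longleftrightarrow> (\<forall>x. f differentiable (at x)) \<and>
      (\<forall>v. C_k k (\<lambda>x. frechet_derivative f (at x) v))"

(* Every smooth tangent field on the closed submanifold S2 extends to a smooth vector field
   on the ambient space, so smooth tangent fields are represented by such extensions. *)
definition smooth_tangent_field :: "(real^3 \<Rightarrow> real^3) \<Rightarrow> bool" where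
  "smooth_tangent_field w \<longleftrightarrow> (\<forall>k. C_k k w) \<and> tangent_field w"

(* Orthogonal projection of the ambient space onto the tangent plane at x, for x \<in> S2. *)
definition tan_proj :: "real^3 \<Rightarrow> real^3^3" where
  "tan_proj x = mat 1 - (\<chi> i j. x $ i * x $ j)"

(* Levi-Civita covariant derivative of a smooth tangent field: the tangential part of the
   ambient derivative in tangential directions, extended by 0 to the normal direction.
   On S2 it depends only on the values of w on S2.  The norm of real^3^3 is the
   Frobenius norm, i.e. the Hilbert-Schmidt norm of the covariant derivative. *)
definition smooth_cov :: "(real^3 \<Rightarrow> real^3) \<Rightarrow> real^3 \<Rightarrow> real^3^3" where
  "smooth_cov w x = tan_proj x ** jacobian w (at x) ** tan_proj x"

(* G is the Sobolev covariant derivative of u: (u, G) lies in the L2-closure of the graph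
   of the covariant derivative on smooth fields.  G is unique up to null sets. *)
definition has_cov :: "(real^3 \<Rightarrow> real^3) \<Rightarrow> (real^3 \<Rightarrow> real^3^3) \<Rightarrow> bool" where
  "has_cov u G \<longleftrightarrow> u \<in> L2T \<and> L2_on_S2 G \<and>
     (\<exists>w. (\<forall>n. smooth_tangent_field (w n)) \<and>
          (\<lambda>n. L2_norm (\<lambda>s. w n s - u s)) \<longlonglongrightarrow> 0 \<and>
          (\<lambda>n. L2_norm (\<lambda>s. smooth_cov (w n) s - G s)) \<longlonglongrightarrow> 0)"

definition H1T :: "(real^3 \<Rightarrow> real^3) set" where
  "H1T = {u. \<exists>G. has_cov u G}"

definition cov :: "(real^3 \<Rightarrow> real^3) \<Rightarrow> real^3 \<Rightarrow> real^3^3" where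
  "cov u = (SOME G. has_cov u G)"

definition div_S2 :: "(real^3 \<Rightarrow> real^3) \<Rightarrow> real^3 \<Rightarrow> real" where
  "div_S2 u x = trace (cov u x)"

(* The outward unit normal at x \<in> S2 is x itself. *)
definition rot_S2 :: "(real^3 \<Rightarrow> real^3) \<Rightarrow> real^3 \<Rightarrow> real" where
  "rot_S2 u x = - div_S2 (\<lambda>y. cross3 y (u y)) x"

end

theory Submission
  imports Defs "HOL-Library.Discrete_Functions"
begin

text \<open>The inequality is a Lieb--Thirring bound for the vector Laplacian of the sphere, proved by Rumin's method.
  For every spherical harmonic \<open>f\<close> of degree \<open>n \<ge> 1\<close> the surface gradient of \<open>f\<close> and its rotation by a right
  angle are eigenfields with eigenvalue \<open>\<lambda>\<^sub>n = n (n + 1)\<close>, and together these fields (the modes) span all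
  tangent fields. Let \<open>P\<^sub>n\<close> be the orthogonal projection onto the modes of degree at most \<open>n\<close>. Because
  \<open>u\<^sub>1, \<dots>, u\<^sub>N\<close> is orthonormal, Bessel's inequality bounds \<open>\<Sum>\<^sub>j \<bar>P\<^sub>n u\<^sub>j(s)\<bar>\<^sup>2\<close> at each point \<open>s\<close> by the sum of
  \<open>\<bar>\<phi>(s)\<bar>\<^sup>2\<close> over the modes \<open>\<phi>\<close> of degree at most \<open>n\<close> (lemma \<open>sum_norm_L2_proj_le\<close>). By rotation symmetry
  this sum is the number of modes divided by the area, and there are at most \<open>2 n (n + 2) \<le> 3 \<lambda>\<^sub>n\<close> of them
  (lemma \<open>sum_mode_square\<close>). Hence, with \<open>c = 3 / (4 \<pi>)\<close> and \<open>r\<^sub>n(s) = \<Sum>\<^sub>j \<bar>u\<^sub>j(s) - P\<^sub>n u\<^sub>j(s)\<bar>\<^sup>2\<close>, the triangle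
  inequality gives \<open>sqrt (\<rho>(s)) \<le> sqrt (c \<lambda>\<^sub>n) + sqrt (r\<^sub>n(s))\<close> for every \<open>n\<close>.

  Multiply the resulting lower bound for \<open>r\<^sub>n(s)\<close> by \<open>\<lambda>\<^sub>n\<^sub>+\<^sub>1 - \<lambda>\<^sub>n\<close> and sum over \<open>n\<close>. The lower bounds add up to at
  least the integral of \<open>(sqrt \<rho> - sqrt (c E))\<^sup>2\<close> over \<open>0 \<le> E \<le> \<rho> / c\<close>, which is \<open>\<rho>\<^sup>2 / (6 c)\<close>
  (lemma \<open>layer_cake_bound\<close>). After integration over the sphere the weighted \<open>r\<^sub>n\<close> add up, by summation by
  parts, to the sum of \<open>\<lambda>\<close> times the squared mode coefficients of the \<open>u\<^sub>j\<close>, hence to at most the sum of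
  \<open>\<parallel>rot u\<^sub>j\<parallel>\<^sup>2 + \<parallel>div u\<^sub>j\<parallel>\<^sup>2\<close> (lemma \<open>sum_mode_residual_le_energy\<close>). This proves the first bound, as
  \<open>6 c = 9 / (2 \<pi>)\<close>. A divergence-free field has no coefficients on the gradients, and a rotation-free field has
  none on the rotated gradients; only half of the modes then take part, so that \<open>c\<close> is halved.

  The analysis on the sphere rests on the operators \<open>L\<^sub>i f = (e\<^sub>i \<times> x) \<bullet> \<nabla>f\<close> that generate the rotations.
  Rotation invariance of the surface measure says that \<open>L\<^sub>i f\<close> has integral zero, so \<open>L\<^sub>i\<close> is antisymmetric and
  \<open>\<Delta> = L\<^sub>1\<^sup>2 + L\<^sub>2\<^sup>2 + L\<^sub>3\<^sup>2\<close> is symmetric. On the sphere \<open>\<Delta> + n (n + 1)\<close> lowers the degree of a polynomial of degree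
  \<open>n\<close>; therefore Gram--Schmidt orthogonalisation of monomials, taken in order of degree, yields eigenfunctions of
  \<open>\<Delta>\<close>, and the reduction \<open>z\<^sup>2 = 1 - x\<^sup>2 - y\<^sup>2\<close> leaves only \<open>2 n + 1\<close> monomials of degree \<open>n\<close>. Completeness of the
  modes follows from the Weierstrass theorem and a pointwise identity that writes the field \<open>\<Delta>f (x \<times> e\<^sub>k)\<close> as a
  gradient plus a rotated gradient. Finally, the Sobolev divergence and rotation enter only through their
  integrals against polynomials, which are computed for smooth fields from the antisymmetry of the \<open>L\<^sub>i\<close> and
  then pass to the limit.\<close>

section \<open>Surface measure and rotations\<close>

lemma space_dS [simp]: "space dS = S2"
  by (auto simp: dS_def space_scale_measure space_restrict_space)

lemma sets_dS: "sets dS = sets (restrict_space borel S2)"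
  by (simp add: dS_def)

lemma measurable_dS_cong: "borel_measurable dS = borel_measurable (restrict_space borel S2)"
  by (rule measurable_cong_sets) (simp_all add: sets_dS)

lemma sgn_measurable_cone:
  "sgn \<in> restrict_space lborel (cball 0 1 - {0 :: real^3}) \<rightarrow>\<^sub>M restrict_space borel S2"
proof -
  have "sgn \<in> restrict_space lborel (cball 0 1 - {0 :: real^3}) \<rightarrow>\<^sub>M borel"
    unfolding sgn_div_norm by (rule measurable_restrict_space1) measurable
  thus ?thesis
    by (rule measurable_restrict_space2[rotated]) (auto simp: space_restrict_space norm_sgn)
qed

text \<open>Up to the factor 3, the area of a set on the sphere is the volume of this cone over it.\<close>
definition solid_cone :: "(real^3) set \<Rightarrow> (real^3) set" where
  "solid_cone A = {x \<in> cball 0 1 - {0}. sgn x \<in> A}"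

lemma solid_cone_borel:
  assumes "A \<in> sets dS" shows "solid_cone A \<in> sets borel"
proof -
  have "solid_cone A = sgn -` A \<inter> space (restrict_space lborel (cball 0 1 - {0 :: real^3}))"
    by (auto simp: solid_cone_def space_restrict_space)
  moreover have "\<dots> \<in> sets (restrict_space lborel (cball 0 1 - {0 :: real^3}))"
    using measurable_sets[OF sgn_measurable_cone] assms by (simp add: sets_dS)
  ultimately show ?thesis
    by (auto simp: sets_restrict_space_iff)
qed

lemma emeasure_dS:
  assumes "A \<in> sets dS" shows "emeasure dS A = 3 * emeasure lborel (solid_cone A)"
proof -
  have "emeasure dS A = 3 * emeasure (restrict_space lborel (cball 0 1 - {0 :: real^3})) (solid_cone A)"
    using assms sgn_measurable_cone
    by (simp add: dS_def emeasure_distr solid_cone_def space_restrict_space vimage_def Int_def conj_commute)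
  also have "emeasure (restrict_space lborel (cball 0 1 - {0 :: real^3})) (solid_cone A) = emeasure lborel (solid_cone A)"
    by (subst emeasure_restrict_space) (auto simp: solid_cone_def)
  finally show ?thesis .
qed

interpretation dS: finite_measure dS
  by (rule finite_measureI) (simp add: emeasure_dS_S2)

lemma measure_dS_S2: "measure dS S2 = 4 * pi"
  by (simp add: measure_def emeasure_dS_S2)

lemma borel_measurable_dS_continuous:
  fixes f :: "real^3 \<Rightarrow> 'b::topological_space"
  assumes "continuous_on S2 f" shows "f \<in> borel_measurable dS"
  using borel_measurable_continuous_on_restrict[OF assms] by (simp add: measurable_dS_cong)

lemma integrable_dS_continuous:
  fixes f :: "real^3 \<Rightarrow> 'b::euclidean_space"
  assumes "continuous_on S2 f" shows "integrable dS f"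
proof -
  have "bounded (f ` S2)"
    using compact_continuous_image[OF assms compact_sphere] compact_imp_bounded by blast
  then obtain B where "\<And>x. x \<in> S2 \<Longrightarrow> norm (f x) \<le> B" unfolding bounded_iff by blast
  thus ?thesis
    by (intro dS.integrable_const_bound[where B=B] AE_I2 borel_measurable_dS_continuous assms) auto
qed

text \<open>An orthogonal map carries the cone over a set to the cone over its image, and it preserves volumes.\<close>
lemma distr_dS_orthogonal:
  assumes T: "orthogonal_transformation (T :: real^3 \<Rightarrow> real^3)"
  shows "T \<in> dS \<rightarrow>\<^sub>M dS" and "distr dS dS T = dS"
proof -
  have lin: "linear T" and nT: "\<And>x. norm (T x) = norm x"
    using T by (auto simp: orthogonal_transformation)
  have "T \<in> dS \<rightarrow>\<^sub>M restrict_space borel S2"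
    by (rule measurable_restrict_space2)
       (auto simp: nT intro!: borel_measurable_dS_continuous linear_continuous_on
             simp: linear_conv_bounded_linear[symmetric] lin)
  thus m: "T \<in> dS \<rightarrow>\<^sub>M dS"
    by (subst measurable_cong_sets[OF refl sets_dS])
  show "distr dS dS T = dS"
  proof (rule measure_eqI)
    fix A assume "A \<in> sets (distr dS dS T)"
    hence A: "A \<in> sets dS" by simp
    have B: "T -` A \<inter> space dS \<in> sets dS" using measurable_sets[OF m A] .
    have surj: "surj T" using T by (simp add: orthogonal_transformation_surj)
    have sgT: "sgn (T x) = T (sgn x)" for x
      by (simp add: sgn_div_norm nT linear_cmul[OF lin])
    have T0: "T x = 0 \<longleftrightarrow> x = 0" for x using nT[of x] norm_eq_zero by metis
    have im: "T ` solid_cone (T -` A \<inter> space dS) = solid_cone A"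
    proof (intro equalityI subsetI)
      fix y assume "y \<in> T ` solid_cone (T -` A \<inter> space dS)"
      thus "y \<in> solid_cone A" by (auto simp: solid_cone_def nT T0 sgT)
    next
      fix y assume y: "y \<in> solid_cone A"
      obtain x where "y = T x" using surj by (metis surj_def)
      thus "y \<in> T ` solid_cone (T -` A \<inter> space dS)"
        using y by (intro image_eqI[of _ _ x]) (auto simp: solid_cone_def nT T0 sgT norm_sgn)
    qed
    have fin: "C \<in> lmeasurable \<and> emeasure lborel C = ennreal (measure lebesgue C)" if "C = solid_cone E" "E \<in> sets dS" for C E
    proof -
      have C: "C \<in> sets borel" using solid_cone_borel that by simp
      have "bounded C" by (rule bounded_subset[OF bounded_cball[of 0 1]]) (auto simp: that solid_cone_def)
      hence l: "C \<in> lmeasurable" using C by (intro bounded_set_imp_lmeasurable) auto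
      have "emeasure lborel C = emeasure lebesgue C" using C by simp
      also have "\<dots> = ennreal (measure lebesgue C)"
        using l by (intro emeasure_eq_measure2) simp
      finally show ?thesis using l by simp
    qed
    have "emeasure lborel (solid_cone (T -` A \<inter> space dS)) = emeasure lborel (solid_cone A)"
      using fin[OF refl A] fin[OF refl B] measure_orthogonal_image[OF T, of "solid_cone (T -` A \<inter> space dS)"] im
      by simp
    thus "emeasure (distr dS dS T) A = emeasure dS A"
      using A B m by (simp add: emeasure_distr emeasure_dS)
  qed simp
qed

lemma integral_dS_orthogonal:
  fixes f :: "real^3 \<Rightarrow> real"
  assumes "orthogonal_transformation T" "f \<in> borel_measurable dS"
  shows "(\<integral>x. f (T x) \<partial>dS) = (\<integral>x. f x \<partial>dS)"
  using integral_distr[OF distr_dS_orthogonal(1)[OF assms(1)] assms(2)] distr_dS_orthogonal(2)[OF assms(1)]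
  by simp

text \<open>The surface measure has full support: a point with \<open>f \<noteq> 0\<close> would give a nonempty open null set in space.\<close>
lemma dS_null_continuous_imp_zero:
  fixes f :: "real^3 \<Rightarrow> real"
  assumes f: "continuous_on UNIV f" and z: "(\<integral>x. (f x)\<^sup>2 \<partial>dS) = 0" and x: "x \<in> S2"
  shows "f x = 0"
proof (rule ccontr)
  assume nz: "f x \<noteq> 0"
  have c2: "continuous_on S2 f" using f continuous_on_subset by blast
  have "AE x in dS. (f x)\<^sup>2 = 0"
    using z by (subst (asm) integral_nonneg_eq_0_iff_AE)
       (auto intro!: integrable_dS_continuous continuous_intros c2)
  then obtain Z where Z: "Z \<in> sets dS" "{x \<in> space dS. \<not> (f x)\<^sup>2 = 0} \<subseteq> Z" "emeasure dS Z = 0"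
    by (auto elim!: AE_E)
  \<comment> \<open>The open set of directions with \<open>f \<noteq> 0\<close>, thickened radially.\<close>
  let ?U = "(ball 0 1 - {0}) \<inter> (\<lambda>y. f (sgn y)) -` (- {0})"
  have "?U \<subseteq> solid_cone Z" using Z(2) by (auto simp: solid_cone_def norm_sgn)
  moreover have "emeasure lborel (solid_cone Z) = 0" using Z emeasure_dS[OF Z(1)] by simp
  ultimately have neg: "negligible ?U"
    using solid_cone_borel[OF Z(1)]
    by (metis negligible_subset negligible_iff_null_sets null_sets_completionI null_setsI sets_lborel)
  have cs: "continuous_on (ball 0 1 - {0}) (\<lambda>y. f (sgn y))"
    by (rule continuous_on_compose2[OF f]) (auto intro!: continuous_intros)
  have op: "open ?U"
    by (rule continuous_open_preimage[OF cs]) auto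
  have "(1/2) *\<^sub>R x \<in> ?U" using x nz by (auto simp: sgn_div_norm)
  thus False using op neg open_not_negligible by blast
qed

definition plane_rotation :: "3 \<Rightarrow> 3 \<Rightarrow> real \<Rightarrow> real^3 \<Rightarrow> real^3" where
  "plane_rotation p q t x = (\<chi> k. if k = p then cos t * x$p - sin t * x$q
                      else if k = q then sin t * x$p + cos t * x$q else x$k)"

lemma orthogonal_plane_rotation:
  assumes "p \<noteq> q" shows "orthogonal_transformation (plane_rotation p q t)"
proof -
  have "linear (plane_rotation p q t)"
    by (rule linearI) (auto simp: plane_rotation_def vec_eq_iff algebra_simps)
  moreover have "plane_rotation p q t x \<bullet> plane_rotation p q t x = x \<bullet> x" for x
  proof -
    have U: "UNIV = insert p (insert q (UNIV - {p,q}))" by auto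
    have s: "(cos t * a - sin t * b) * (cos t * a - sin t * b) + (sin t * a + cos t * b) * (sin t * a + cos t * b)
        = a * a + b * b" for a b
      using sin_cos_squared_add[of t] by algebra
    show ?thesis unfolding inner_vec_def
      by (subst (1 2) U) (use assms s[of "x$p" "x$q"] in \<open>simp add: plane_rotation_def\<close>)
  qed
  hence "norm (plane_rotation p q t x) = norm x" for x by (simp add: norm_eq_sqrt_inner)
  ultimately show ?thesis by (simp add: orthogonal_transformation)
qed

lemma plane_rotation_in_S2: "p \<noteq> q \<Longrightarrow> x \<in> S2 \<Longrightarrow> plane_rotation p q t x \<in> S2"
  using orthogonal_plane_rotation[of p q t] by (simp add: orthogonal_transformation)

lemma plane_rotation_has_vector_derivative:
  assumes "p \<noteq> q"
  shows "((\<lambda>t. plane_rotation p q t x) has_vector_derivative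
    (plane_rotation p q t x $ p *\<^sub>R axis q 1 - plane_rotation p q t x $ q *\<^sub>R axis p 1)) (at t)"
proof -
  have "((\<lambda>t. plane_rotation p q t x $ k) has_real_derivative
     (plane_rotation p q t x $ p *\<^sub>R axis q 1 - plane_rotation p q t x $ q *\<^sub>R axis p (1::real)) $ k) (at t)" for k
  proof (cases "k = p")
    case True
    then show ?thesis using assms
      by (auto simp: plane_rotation_def axis_def intro!: derivative_eq_intros)
  next
    case False
    then show ?thesis using assms
      by (cases "k = q") (auto simp: plane_rotation_def axis_def intro!: derivative_eq_intros)
  qed
  thus ?thesis
    unfolding has_vector_derivative_def has_field_derivative_def
    by (subst has_derivative_componentwise_within)
       (simp add: Basis_vec_def inner_axis cart_eq_inner_axis[symmetric] mult_commute_abs)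
qed

text \<open>Differentiate the constant function \<open>t \<mapsto> \<integral>f(R\<^sub>t x)\<close> at \<open>t = 0\<close>. The difference quotients are bounded by the
  mean value theorem, so dominated convergence applies.\<close>
lemma integral_dS_rotation_derivative:
  fixes f :: "real^3 \<Rightarrow> real"
  assumes pq: "p \<noteq> q"
    and f: "\<And>x. (f has_derivative (\<lambda>v. g x \<bullet> v)) (at x)"
    and g: "continuous_on UNIV g"
  shows "(\<integral>x. (x$p * g x $ q - x$q * g x $ p) \<partial>dS) = 0"
proof -
  define h where "h = (\<lambda>x. x$p * g x $ q - x$q * g x $ p)"
  have ch: "continuous_on S2 h" unfolding h_def
    by (intro continuous_intros continuous_on_subset[OF g]) auto
  have cf: "continuous_on S2 f"
    using f has_derivative_continuous continuous_at_imp_continuous_on by blast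
  have dv: "((\<lambda>t. f (plane_rotation p q t x)) has_real_derivative h (plane_rotation p q t x)) (at t)" for x t
  proof -
    have "((\<lambda>t. f (plane_rotation p q t x)) has_derivative
       (\<lambda>s. g (plane_rotation p q t x) \<bullet> (s *\<^sub>R (plane_rotation p q t x $ p *\<^sub>R axis q 1 - plane_rotation p q t x $ q *\<^sub>R axis p 1)))) (at t)"
      using has_derivative_compose[OF plane_rotation_has_vector_derivative[OF pq, unfolded has_vector_derivative_def] f] .
    thus ?thesis unfolding has_field_derivative_def
      by (rule has_derivative_eq_rhs) (auto simp: h_def inner_diff_right inner_axis algebra_simps)
  qed
  obtain B where B: "\<And>x. x \<in> S2 \<Longrightarrow> norm (h x) \<le> B"
    using compact_imp_bounded[OF compact_continuous_image[OF ch compact_sphere]] unfolding bounded_iff by blast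
  define d where "d = (\<lambda>n x. (f (plane_rotation p q (1 / real (Suc n)) x) - f x) * real (Suc n))"
  have p0: "plane_rotation p q 0 x = x" for x by (auto simp: plane_rotation_def vec_eq_iff)
  \<comment> \<open>\<open>d n\<close> is the difference quotient of step \<open>1 / (n + 1)\<close>; its integrals are all zero.\<close>
  have "(\<lambda>n. \<integral>x. d n x \<partial>dS) \<longlonglongrightarrow> (\<integral>x. h x \<partial>dS)"
  proof (rule integral_dominated_convergence[where w="\<lambda>_. B"])
    show "h \<in> borel_measurable dS" using ch by (rule borel_measurable_dS_continuous)
    have m: "f \<in> borel_measurable dS" using cf by (rule borel_measurable_dS_continuous)
    show "d n \<in> borel_measurable dS" for n unfolding d_def
      using measurable_compose[OF distr_dS_orthogonal(1)[OF orthogonal_plane_rotation[OF pq]] m] m by measurable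
    show "integrable dS (\<lambda>_. B)" by simp
    show "AE x in dS. (\<lambda>n. d n x) \<longlonglongrightarrow> h x"
    proof (rule AE_I2)
      fix x assume "x \<in> space dS"
      have "((\<lambda>y. (f (plane_rotation p q y x) - f (plane_rotation p q 0 x)) / (y - 0)) \<longlongrightarrow> h x) (at 0)"
        using dv[of x 0] by (simp add: has_field_derivative_iff p0)
      moreover have "filterlim (\<lambda>n. 1 / real (Suc n)) (at 0) sequentially"
        using LIMSEQ_inverse_real_of_nat by (intro filterlim_atI) (auto simp: inverse_eq_divide)
      ultimately have "(\<lambda>n. (f (plane_rotation p q (1 / real (Suc n)) x) - f (plane_rotation p q 0 x)) / (1 / real (Suc n) - 0)) \<longlonglongrightarrow> h x"
        by (rule filterlim_compose)
      thus "(\<lambda>n. d n x) \<longlonglongrightarrow> h x" by (simp add: d_def p0)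
    qed
    show "AE x in dS. norm (d n x) \<le> B" for n
    proof (rule AE_I2)
      fix x assume x: "x \<in> space dS"
      have "\<exists>z. 0 < z \<and> z < 1 / real (Suc n) \<and> f (plane_rotation p q (1 / real (Suc n)) x) - f (plane_rotation p q 0 x) = (1 / real (Suc n) - 0) * h (plane_rotation p q z x)"
        by (rule MVT2) (use dv in auto)
      then obtain z where "d n x = h (plane_rotation p q z x)" by (auto simp: d_def p0 field_simps)
      thus "norm (d n x) \<le> B" using B plane_rotation_in_S2[OF pq] x by simp
    qed
  qed
  moreover have "(\<integral>x. d n x \<partial>dS) = 0" for n
  proof -
    have "integrable dS f" using cf by (rule integrable_dS_continuous)
    moreover have "integrable dS (\<lambda>x. f (plane_rotation p q t x))" for t
      using calculation integrable_distr_eq[OF distr_dS_orthogonal(1)[OF orthogonal_plane_rotation[OF pq]], of f t]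
        distr_dS_orthogonal(2)[OF orthogonal_plane_rotation[OF pq]] by (auto simp: measurable_dS_cong borel_measurable_dS_continuous[OF cf, unfolded measurable_dS_cong])
    ultimately show ?thesis
      using integral_dS_orthogonal[OF orthogonal_plane_rotation[OF pq] borel_measurable_dS_continuous[OF cf]]
      by (simp add: d_def)
  qed
  ultimately have "(\<integral>x. h x \<partial>dS) = 0" using LIMSEQ_unique[OF tendsto_const] by fastforce
  thus ?thesis by (simp add: h_def)
qed

section \<open>Polynomials and angular momentum operators\<close>

text \<open>The derivative of \<open>f\<close> along the rotation about the \<open>i\<close>-th axis. At a point of the sphere these three numbers
  are the components of \<open>x \<times> \<nabla>f\<close>, the surface gradient turned by a right angle.\<close>
definition ang :: "3 \<Rightarrow> (real^3 \<Rightarrow> real) \<Rightarrow> real^3 \<Rightarrow> real" where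
  "ang i f x = frechet_derivative f (at x) (cross3 (axis i 1) x)"

text \<open>Polynomial functions of degree at most \<open>n\<close>. The rules build them one coordinate at a time, so
  that the leading behaviour of \<open>\<Delta>\<close> can be read off by induction.\<close>
inductive poly_upto :: "nat \<Rightarrow> (real^3 \<Rightarrow> real) \<Rightarrow> bool" where
  const: "poly_upto n (\<lambda>x. c)"
| mult: "poly_upto n f \<Longrightarrow> poly_upto (Suc n) (\<lambda>x. x$j * f x)"
| add: "poly_upto n f \<Longrightarrow> poly_upto n g \<Longrightarrow> poly_upto n (\<lambda>x. f x + g x)"

lemma poly_upto_C1:
  assumes "poly_upto n f"
  shows "\<exists>g. (\<forall>x. (f has_derivative (\<lambda>v. g x \<bullet> v)) (at x)) \<and> continuous_on UNIV g"
  using assms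
proof induction
  case (const n c)
  show ?case by (intro exI[of _ "\<lambda>_. 0"]) (auto intro!: derivative_eq_intros)
next
  case (mult n f j)
  then obtain g where g: "\<And>x. (f has_derivative (\<lambda>v. g x \<bullet> v)) (at x)" "continuous_on UNIV g" by blast
  have cf: "continuous_on UNIV f"
    using g(1) has_derivative_continuous continuous_at_imp_continuous_on by blast
  have "((\<lambda>x. x$j * f x) has_derivative (\<lambda>v. (f x *\<^sub>R axis j 1 + x$j *\<^sub>R g x) \<bullet> v)) (at x)" for x
    by (rule has_derivative_eq_rhs[OF has_derivative_mult[OF bounded_linear_imp_has_derivative[OF bounded_linear_vec_nth] g(1)]])
       (auto simp: inner_add_left inner_axis' algebra_simps)
  moreover have "continuous_on UNIV (\<lambda>x. f x *\<^sub>R axis j 1 + x$j *\<^sub>R g x)"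
    by (intro continuous_intros g cf)
  ultimately show ?case by (intro exI[of _ "\<lambda>x. f x *\<^sub>R axis j 1 + x$j *\<^sub>R g x"]) blast
next
  case (add n f f')
  then obtain g g' where g: "\<And>x. (f has_derivative (\<lambda>v. g x \<bullet> v)) (at x)" "continuous_on UNIV g"
    and g': "\<And>x. (f' has_derivative (\<lambda>v. g' x \<bullet> v)) (at x)" "continuous_on UNIV g'" by blast
  have "((\<lambda>x. f x + f' x) has_derivative (\<lambda>v. (g x + g' x) \<bullet> v)) (at x)" for x
    by (rule has_derivative_eq_rhs[OF has_derivative_add[OF g(1) g'(1)]]) (simp add: inner_add_left)
  thus ?case using continuous_on_add[OF g(2) g'(2)] by (intro exI[of _ "\<lambda>x. g x + g' x"]) blast
qed

lemma poly_upto_differentiable: "poly_upto n f \<Longrightarrow> f differentiable (at x)"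
  using poly_upto_C1 differentiableI by blast

lemma poly_upto_continuous_on: "poly_upto n f \<Longrightarrow> continuous_on A f"
  using poly_upto_differentiable differentiable_imp_continuous_within continuous_at_imp_continuous_on by blast

lemma poly_upto_mono: "poly_upto n f \<Longrightarrow> n \<le> m \<Longrightarrow> poly_upto m f"
proof (induction arbitrary: m rule: poly_upto.induct)
  case (mult n f j)
  then obtain m' where "m = Suc m'" "n \<le> m'" by (cases m) auto
  then show ?case using mult poly_upto.mult by auto
qed (auto intro: poly_upto.intros)

lemma poly_upto_cmult: "poly_upto n f \<Longrightarrow> poly_upto n (\<lambda>x. c * f x)"
proof (induction rule: poly_upto.induct)
  case (mult n f j)
  have "(\<lambda>x. c * (x$j * f x)) = (\<lambda>x. x$j * (c * f x))" by (auto simp: algebra_simps)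
  then show ?case using poly_upto.mult[OF mult.IH] by simp
qed (auto intro: poly_upto.intros simp: distrib_left)

lemma poly_upto_diff: "poly_upto n f \<Longrightarrow> poly_upto n g \<Longrightarrow> poly_upto n (\<lambda>x. f x - g x)"
  using poly_upto.add[of n f "\<lambda>x. (-1) * g x"] poly_upto_cmult[of n g "-1"] by simp

lemma poly_upto_sum: "(\<And>i. i \<in> A \<Longrightarrow> poly_upto n (f i)) \<Longrightarrow> poly_upto n (\<lambda>x. \<Sum>i\<in>A. f i x)"
  by (induction A rule: infinite_finite_induct) (auto intro: poly_upto.const poly_upto.add)

lemma poly_upto_mult: "poly_upto n f \<Longrightarrow> poly_upto m g \<Longrightarrow> poly_upto (n + m) (\<lambda>x. f x * g x)"
proof (induction rule: poly_upto.induct)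
  case (const n c)
  then show ?case using poly_upto_mono[OF poly_upto_cmult] by simp
next
  case (mult n f j)
  then show ?case using poly_upto.mult[OF mult.IH, of j] by (simp add: mult.assoc)
next
  case (add n f f')
  then show ?case using poly_upto.add[OF add.IH] by (simp add: distrib_right)
qed

lemma poly_upto_coord: "poly_upto (Suc n) (\<lambda>x. x$j)"
  using poly_upto.mult[OF poly_upto.const[of n 1], of j] by simp

lemma poly_upto_0:
  assumes "poly_upto 0 f" obtains c where "f = (\<lambda>x. c)"
proof -
  have "poly_upto n f \<Longrightarrow> n = 0 \<Longrightarrow> \<exists>c. f = (\<lambda>x. c)" for n
    by (induction rule: poly_upto.induct) auto
  thus ?thesis using assms that by blast
qed

text \<open>Forgetting the degree makes the side conditions of the calculus rules solvable by rewriting.\<close>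
definition polyfn :: "(real^3 \<Rightarrow> real) \<Rightarrow> bool" where
  "polyfn f \<longleftrightarrow> (\<exists>n. poly_upto n f)"

lemma polyfnI: "poly_upto n f \<Longrightarrow> polyfn f"
  by (auto simp: polyfn_def)

lemma polyfn_differentiable: "polyfn f \<Longrightarrow> f differentiable (at x)"
  using poly_upto_differentiable by (auto simp: polyfn_def)

lemma polyfn_continuous_on: "polyfn f \<Longrightarrow> continuous_on A f"
  using poly_upto_continuous_on by (auto simp: polyfn_def)

lemma polyfn_coord [simp]: "polyfn (\<lambda>x. x$j)" using polyfnI[OF poly_upto_coord[of 0 j]] .
lemma polyfn_const [simp]: "polyfn (\<lambda>x. c)" using polyfnI[OF poly_upto.const[of 0 c]] .
lemma polyfn_mult [simp]: "polyfn f \<Longrightarrow> polyfn g \<Longrightarrow> polyfn (\<lambda>x. f x * g x)"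
  unfolding polyfn_def using poly_upto_mult by blast
lemma polyfn_add [simp]: "polyfn f \<Longrightarrow> polyfn g \<Longrightarrow> polyfn (\<lambda>x. f x + g x)"
  unfolding polyfn_def using poly_upto.add poly_upto_mono max.cobounded1 max.cobounded2 by metis
lemma polyfn_minus [simp]: "polyfn f \<Longrightarrow> polyfn (\<lambda>x. - f x)"
  using polyfn_mult[of "\<lambda>x. -1" f] by simp
lemma polyfn_diff [simp]: "polyfn f \<Longrightarrow> polyfn g \<Longrightarrow> polyfn (\<lambda>x. f x - g x)"
  using polyfn_add[of f "\<lambda>x. - g x"] by simp
lemma polyfn_sum [simp]: "(\<And>i. i \<in> A \<Longrightarrow> polyfn (f i)) \<Longrightarrow> polyfn (\<lambda>x. \<Sum>i\<in>A. f i x)"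
  by (induction A rule: infinite_finite_induct) auto

lemma ang_eq: "(f has_derivative f') (at x) \<Longrightarrow> ang i f x = f' (cross3 (axis i 1) x)"
  unfolding ang_def using frechet_derivative_at by metis

lemma ang_const [simp]: "ang i (\<lambda>x. c) = (\<lambda>x. 0)"
  by (rule ext, subst ang_eq[OF has_derivative_const]) simp

lemma ang_add [simp]: "polyfn f \<Longrightarrow> polyfn g \<Longrightarrow> ang i (\<lambda>x. f x + g x) = (\<lambda>x. ang i f x + ang i g x)"
  by (rule ext, subst ang_eq[OF has_derivative_add[OF frechet_derivative_works[THEN iffD1] frechet_derivative_works[THEN iffD1]]])
     (auto simp: polyfn_differentiable ang_def)

lemma ang_mult [simp]: "polyfn f \<Longrightarrow> polyfn g \<Longrightarrow> ang i (\<lambda>x. f x * g x) = (\<lambda>x. ang i f x * g x + f x * ang i g x)"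
  by (rule ext, subst ang_eq[OF has_derivative_mult[OF frechet_derivative_works[THEN iffD1] frechet_derivative_works[THEN iffD1]]])
     (auto simp: polyfn_differentiable ang_def)

lemma ang_minus [simp]: "polyfn f \<Longrightarrow> ang i (\<lambda>x. - f x) = (\<lambda>x. - ang i f x)"
  using ang_mult[of "\<lambda>x. -1" f i] by simp

lemma ang_diff [simp]: "polyfn f \<Longrightarrow> polyfn g \<Longrightarrow> ang i (\<lambda>x. f x - g x) = (\<lambda>x. ang i f x - ang i g x)"
  using ang_add[of f "\<lambda>x. - g x" i] by simp

lemma ang_sum [simp]: "(\<And>k. k \<in> A \<Longrightarrow> polyfn (f k)) \<Longrightarrow> ang i (\<lambda>x. \<Sum>k\<in>A. f k x) = (\<lambda>x. \<Sum>k\<in>A. ang i (f k) x)"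
  by (induction A rule: infinite_finite_induct) simp_all

lemma ang_coord: "ang i (\<lambda>x. x$j) = (\<lambda>x. cross3 (axis i 1) x $ j)"
  by (rule ext, subst ang_eq[OF bounded_linear_imp_has_derivative[OF bounded_linear_vec_nth]]) simp

lemma axis_3 [simp]:
  "axis (1::3) (c::real) $ 1 = c" "axis (1::3) c $ 2 = 0" "axis (1::3) c $ 3 = 0"
  "axis (2::3) c $ 1 = 0" "axis (2::3) c $ 2 = c" "axis (2::3) c $ 3 = 0"
  "axis (3::3) c $ 1 = 0" "axis (3::3) c $ 2 = 0" "axis (3::3) c $ 3 = c"
  by (auto simp: axis_def)

lemma ang_coords [simp]:
  "ang 1 (\<lambda>x. x$1) = (\<lambda>x. 0)" "ang 1 (\<lambda>x. x$2) = (\<lambda>x. - x$3)" "ang 1 (\<lambda>x. x$3) = (\<lambda>x. x$2)"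
  "ang 2 (\<lambda>x. x$1) = (\<lambda>x. x$3)" "ang 2 (\<lambda>x. x$2) = (\<lambda>x. 0)" "ang 2 (\<lambda>x. x$3) = (\<lambda>x. - x$1)"
  "ang 3 (\<lambda>x. x$1) = (\<lambda>x. - x$2)" "ang 3 (\<lambda>x. x$2) = (\<lambda>x. x$1)" "ang 3 (\<lambda>x. x$3) = (\<lambda>x. 0)"
  by (simp_all add: ang_coord cross3_def)

lemma poly_upto_ang_coord: "poly_upto (Suc 0) (ang i (\<lambda>x. x$j))"
proof -
  have m: "poly_upto (Suc 0) (\<lambda>x. - x$k)" for k using poly_upto_cmult[OF poly_upto_coord[of 0 k], of "-1"] by simp
  show ?thesis using exhaust_3[of i] exhaust_3[of j] by (auto simp: poly_upto.const m poly_upto_coord)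
qed

lemma poly_upto_ang: "poly_upto n f \<Longrightarrow> poly_upto n (ang i f)"
proof (induction rule: poly_upto.induct)
  case (const n c)
  then show ?case by (simp add: poly_upto.const)
next
  case (mult n f j)
  then show ?case
    using poly_upto.add[OF poly_upto_mult[OF poly_upto_ang_coord[of i j] mult.hyps, simplified] poly_upto.mult[OF mult.IH, of j]]
    by (simp add: polyfnI[OF mult.hyps])
next
  case (add n f g)
  then show ?case by (simp add: polyfnI[OF add.hyps(1)] polyfnI[OF add.hyps(2)] poly_upto.add)
qed

lemma polyfn_ang [simp]: "polyfn f \<Longrightarrow> polyfn (ang i f)"
  using poly_upto_ang by (auto simp: polyfn_def)

text \<open>The commutation relations of the Lie algebra of the rotation group.\<close>
lemma ang_commutator:
  assumes "poly_upto n f"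
  shows "ang 1 (ang 2 f) x - ang 2 (ang 1 f) x = - ang 3 f x"
    and "ang 2 (ang 3 f) x - ang 3 (ang 2 f) x = - ang 1 f x"
    and "ang 3 (ang 1 f) x - ang 1 (ang 3 f) x = - ang 2 f x"
proof -
  have "ang 1 (ang 2 f) x - ang 2 (ang 1 f) x = - ang 3 f x \<and>
    ang 2 (ang 3 f) x - ang 3 (ang 2 f) x = - ang 1 f x \<and>
    ang 3 (ang 1 f) x - ang 1 (ang 3 f) x = - ang 2 f x"
    using assms
  proof (induction rule: poly_upto.induct)
    case (const n c)
    then show ?case by simp
  next
    case (mult n f j)
    note [simp] = polyfnI[OF mult.hyps]
    have IH: "ang 1 (ang 2 f) x = ang 2 (ang 1 f) x - ang 3 f x"
      "ang 2 (ang 3 f) x = ang 3 (ang 2 f) x - ang 1 f x"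
      "ang 3 (ang 1 f) x = ang 1 (ang 3 f) x - ang 2 f x"
      using mult.IH by auto
    show ?case
      using exhaust_3[of j]
      by (elim disjE) (simp_all add: IH algebra_simps)
  next
    case (add n f g)
    then show ?case by (simp add: polyfnI[OF add.hyps(1)] polyfnI[OF add.hyps(2)])
  qed
  thus "ang 1 (ang 2 f) x - ang 2 (ang 1 f) x = - ang 3 f x"
    and "ang 2 (ang 3 f) x - ang 3 (ang 2 f) x = - ang 1 f x"
    and "ang 3 (ang 1 f) x - ang 1 (ang 3 f) x = - ang 2 f x" by auto
qed

text \<open>The field \<open>x \<times> \<nabla>f\<close> is tangent to the sphere.\<close>
lemma ang_radial:
  assumes "poly_upto n f" shows "x$1 * ang 1 f x + x$2 * ang 2 f x + x$3 * ang 3 f x = 0"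
proof -
  obtain g where g: "(f has_derivative (\<lambda>v. g x \<bullet> v)) (at x)" using poly_upto_C1[OF assms] by blast
  show ?thesis unfolding ang_eq[OF g]
    by (simp add: cross3_def inner_vec_def sum_3 algebra_simps)
qed

lemma integral_ang:
  assumes "poly_upto n f" shows "(\<integral>x. ang i f x \<partial>dS) = 0"
proof -
  obtain g where g: "\<And>x. (f has_derivative (\<lambda>v. g x \<bullet> v)) (at x)" "continuous_on UNIV g"
    using poly_upto_C1[OF assms] by blast
  have L: "ang i f = (\<lambda>x. g x \<bullet> cross3 (axis i 1) x)" using ang_eq[OF g(1)] by auto
  note * = integral_dS_rotation_derivative[OF _ g]
  show ?thesis using exhaust_3[of i] *[of 2 3] *[of 3 1] *[of 1 2]
    by (auto simp: L cross3_def inner_vec_def sum_3 algebra_simps)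
qed

lemma integrable_polyfn [simp]: "polyfn f \<Longrightarrow> integrable dS f"
  by (rule integrable_dS_continuous) (rule polyfn_continuous_on)

lemma integral_ang_by_parts:
  assumes [simp]: "polyfn f" "polyfn g"
  shows "(\<integral>x. ang i f x * g x \<partial>dS) = - (\<integral>x. f x * ang i g x \<partial>dS)"
proof -
  obtain n where "poly_upto n (\<lambda>x. f x * g x)" using polyfn_mult[OF assms] unfolding polyfn_def by blast
  hence "0 = (\<integral>x. ang i f x * g x + f x * ang i g x \<partial>dS)"
    using integral_ang[of n "\<lambda>x. f x * g x" i] by simp
  also have "\<dots> = (\<integral>x. ang i f x * g x \<partial>dS) + (\<integral>x. f x * ang i g x \<partial>dS)"
    by (rule Bochner_Integration.integral_add) simp_all
  finally show ?thesis by simp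
qed

text \<open>On the sphere, the Laplace--Beltrami operator.\<close>
definition Lap :: "(real^3 \<Rightarrow> real) \<Rightarrow> real^3 \<Rightarrow> real" where
  "Lap f x = (\<Sum>i\<in>UNIV. ang i (ang i f) x)"

lemma poly_upto_Lap: "poly_upto n f \<Longrightarrow> poly_upto n (Lap f)"
  unfolding Lap_def[abs_def] by (intro poly_upto_sum poly_upto_ang)

lemma polyfn_Lap [simp]: "polyfn f \<Longrightarrow> polyfn (Lap f)"
  using poly_upto_Lap by (auto simp: polyfn_def)

lemma integral_Lap:
  assumes [simp]: "polyfn f" "polyfn g"
  shows "(\<integral>x. Lap f x * g x \<partial>dS) = - (\<Sum>i\<in>UNIV. \<integral>x. ang i f x * ang i g x \<partial>dS)"
proof -
  have "(\<integral>x. Lap f x * g x \<partial>dS) = (\<integral>x. (\<Sum>i\<in>UNIV. ang i (ang i f) x * g x) \<partial>dS)"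
    by (simp add: Lap_def sum_distrib_right)
  also have "\<dots> = (\<Sum>i\<in>UNIV. (\<integral>x. ang i (ang i f) x * g x \<partial>dS))"
    by (intro Bochner_Integration.integral_sum) simp
  also have "\<dots> = (\<Sum>i\<in>UNIV. - (\<integral>x. ang i f x * ang i g x \<partial>dS))"
    by (intro sum.cong refl integral_ang_by_parts) simp_all
  finally show ?thesis by (simp add: sum_negf)
qed

lemma integral_Lap_symmetric:
  assumes [simp]: "polyfn f" "polyfn g"
  shows "(\<integral>x. Lap f x * g x \<partial>dS) = (\<integral>x. f x * Lap g x \<partial>dS)"
  using integral_Lap[OF assms] integral_Lap[OF assms(2,1)] by (simp add: mult.commute)

text \<open>On the sphere, the inner product of the surface gradients of \<open>x\<^sub>k\<close> and \<open>f\<close>; it is the cross term when \<open>\<Delta>\<close> is applied to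
  \<open>x\<^sub>k f\<close>.\<close>
definition coord_grad :: "3 \<Rightarrow> (real^3 \<Rightarrow> real) \<Rightarrow> real^3 \<Rightarrow> real" where
  "coord_grad k f x = (\<Sum>i\<in>UNIV. ang i (\<lambda>x. x$k) x * ang i f x)"

lemma S2_sq: "x \<in> S2 \<Longrightarrow> x$3 * x$3 = 1 - x$1 * x$1 - x$2 * x$2" for x :: "real^3"
proof -
  assume "x \<in> S2"
  hence "x \<bullet> x = 1" by (simp add: dot_square_norm)
  thus ?thesis by (simp add: inner_vec_def sum_3)
qed

lemma coord_grad_coord:
  assumes "x \<in> S2"
  shows "coord_grad k (\<lambda>x. x$j) x = (if k = j then 1 else 0) - x$k * x$j"
proof -
  have s: "x$3 * x$3 = 1 - x$1 * x$1 - x$2 * x$2" using S2_sq[OF assms] .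
  show ?thesis using exhaust_3[of k] exhaust_3[of j]
    by (elim disjE) (simp_all add: coord_grad_def sum_3 s)
qed

lemma coord_grad_X:
  assumes "poly_upto n f" "x \<in> S2"
  shows "coord_grad k (\<lambda>x. x$j * f x) x = x$j * coord_grad k f x + ((if k = j then 1 else 0) - x$k * x$j) * f x"
  unfolding coord_grad_coord[OF assms(2), symmetric]
  by (simp add: coord_grad_def sum_3 polyfnI[OF assms(1)] algebra_simps)

lemma Lap_X:
  assumes "poly_upto n f"
  shows "Lap (\<lambda>x. x$j * f x) x = x$j * Lap f x - 2 * (x$j * f x) + 2 * coord_grad j f x"
proof -
  note [simp] = polyfnI[OF assms]
  show ?thesis using exhaust_3[of j]
    by (elim disjE) (simp_all add: Lap_def coord_grad_def sum_3 algebra_simps)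
qed

text \<open>On homogeneous polynomials of degree \<open>n\<close> the surface gradient is \<open>\<nabla>f - n f x\<close>, and \<open>\<nabla>f\<close> has lower degree.\<close>
lemma coord_grad_leading:
  assumes "poly_upto n f"
  shows "\<exists>q. poly_upto n q \<and> (\<forall>x\<in>S2. coord_grad k f x = - real n * (x$k * f x) + q x)"
  using assms
proof (induction rule: poly_upto.induct)
  case (const n c)
  have "poly_upto n (\<lambda>x. (real n * c) * x$k)"
    by (cases n) (auto intro: poly_upto.const poly_upto_cmult[OF poly_upto_coord])
  then show ?case by (intro exI[of _ "\<lambda>x. (real n * c) * x$k"]) (simp add: coord_grad_def)
next
  case (mult n f j)
  then obtain q where q: "poly_upto n q" "\<And>x. x \<in> S2 \<Longrightarrow> coord_grad k f x = - real n * (x$k * f x) + q x" by blast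
  have "poly_upto (Suc n) (\<lambda>x. x$j * q x + (if k = j then 1 else 0) * f x)"
    using poly_upto.add[OF poly_upto.mult[OF q(1)] poly_upto_mono[OF poly_upto_cmult[OF mult.hyps]]] by simp
  thus ?case
    by (intro exI[of _ "\<lambda>x. x$j * q x + (if k = j then 1 else 0) * f x"])
       (auto simp: coord_grad_X[OF mult.hyps] q(2), auto simp: algebra_simps)
next
  case (add n f g)
  obtain q where q: "poly_upto n q" "\<And>x. x \<in> S2 \<Longrightarrow> coord_grad k f x = - real n * (x$k * f x) + q x" using add by blast
  obtain r where r: "poly_upto n r" "\<And>x. x \<in> S2 \<Longrightarrow> coord_grad k g x = - real n * (x$k * g x) + r x" using add by blast
  have "coord_grad k (\<lambda>x. f x + g x) x = coord_grad k f x + coord_grad k g x" for x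
    by (simp add: polyfnI[OF add.hyps(1)] polyfnI[OF add.hyps(2)] coord_grad_def sum.distrib distrib_left)
  thus ?case using poly_upto.add[OF q(1) r(1)]
    by (intro exI[of _ "\<lambda>x. q x + r x"]) (simp add: q(2) r(2) algebra_simps)
qed

lemma Lap_add: "poly_upto n f \<Longrightarrow> poly_upto n g \<Longrightarrow> Lap (\<lambda>x. f x + g x) x = Lap f x + Lap g x"
  by (simp add: Lap_def polyfnI sum.distrib)

text \<open>This triangularity of \<open>\<Delta>\<close> with respect to the degree, with \<open>- n (n + 1)\<close> on the diagonal, is what makes the
  Gram--Schmidt functions below eigenfunctions. For \<open>n = 0\<close> the truncated degree \<open>n - 1\<close> would allow a constant
  remainder, which the extra conclusion excludes.\<close>
lemma Lap_leading:
  assumes "poly_upto n f"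
  shows "\<exists>q. poly_upto (n - 1) q \<and> (n = 0 \<longrightarrow> q = (\<lambda>x. 0)) \<and>
    (\<forall>x\<in>S2. Lap f x = - (real n * (real n + 1)) * f x + q x)"
  using assms
proof (induction rule: poly_upto.induct)
  case (const n c)
  show ?case by (intro exI[of _ "\<lambda>x. real n * (real n + 1) * c"]) (auto simp: poly_upto.const Lap_def)
next
  case (mult n f j)
  obtain q where q: "poly_upto n q" "\<And>x. x \<in> S2 \<Longrightarrow> coord_grad j f x = - real n * (x$j * f x) + q x"
    using coord_grad_leading[OF mult.hyps] by blast
  obtain r where r: "poly_upto (n - 1) r" "n = 0 \<longrightarrow> r = (\<lambda>x. 0)"
    "\<And>x. x \<in> S2 \<Longrightarrow> Lap f x = - (real n * (real n + 1)) * f x + r x" using mult.IH by blast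
  have "poly_upto n (\<lambda>x. x$j * r x)"
    using r poly_upto.mult[OF r(1)] by (cases n) (auto intro: poly_upto.const)
  hence "poly_upto n (\<lambda>x. x$j * r x + 2 * q x)" using poly_upto.add poly_upto_cmult[OF q(1)] by blast
  thus ?case
    by (intro exI[of _ "\<lambda>x. x$j * r x + 2 * q x"]) (auto simp: Lap_X[OF mult.hyps] q(2) r(3), auto simp: algebra_simps)
next
  case (add n f g)
  obtain q where q: "poly_upto (n-1) q" "n = 0 \<longrightarrow> q = (\<lambda>x. 0)"
    "\<And>x. x \<in> S2 \<Longrightarrow> Lap f x = - (real n * (real n + 1)) * f x + q x" using add by blast
  obtain r where r: "poly_upto (n-1) r" "n = 0 \<longrightarrow> r = (\<lambda>x. 0)"
    "\<And>x. x \<in> S2 \<Longrightarrow> Lap g x = - (real n * (real n + 1)) * g x + r x" using add by blast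
  show ?case using poly_upto.add[OF q(1) r(1)] q(2) r(2)
    by (intro exI[of _ "\<lambda>x. q x + r x"]) (simp add: Lap_add[OF add.hyps] q(3) r(3) algebra_simps)
qed

section \<open>Spherical harmonics by Gram-Schmidt\<close>

lemma L2_continuous: "continuous_on S2 f \<Longrightarrow> L2_on_S2 f" for f :: "real^3 \<Rightarrow> 'b::euclidean_space"
  unfolding L2_on_S2_def
  by (auto intro!: borel_measurable_dS_continuous integrable_dS_continuous continuous_intros)

lemma L2_polyfn [simp]: "polyfn f \<Longrightarrow> L2_on_S2 f"
  by (rule L2_continuous[OF polyfn_continuous_on])

definition ip :: "(real^3 \<Rightarrow> 'b::euclidean_space) \<Rightarrow> (real^3 \<Rightarrow> 'b) \<Rightarrow> real" where
  "ip f g = (\<integral>x. f x \<bullet> g x \<partial>dS)"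

lemma integrable_inner_L2:
  assumes "L2_on_S2 f" "L2_on_S2 g" shows "integrable dS (\<lambda>x. f x \<bullet> g x)"
proof (rule Bochner_Integration.integrable_bound)
  show "integrable dS (\<lambda>x. (norm (f x))\<^sup>2 + (norm (g x))\<^sup>2)"
    using assms by (auto simp: L2_on_S2_def)
  show "(\<lambda>x. f x \<bullet> g x) \<in> borel_measurable dS"
    using assms by (auto simp: L2_on_S2_def)
  show "AE x in dS. norm (f x \<bullet> g x) \<le> norm ((norm (f x))\<^sup>2 + (norm (g x))\<^sup>2)"
  proof (rule AE_I2)
    fix x
    have "\<bar>f x \<bullet> g x\<bar> \<le> norm (f x) * norm (g x)" by (rule Cauchy_Schwarz_ineq2)
    also have "\<dots> \<le> (norm (f x))\<^sup>2 + (norm (g x))\<^sup>2"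
      using sum_squares_bound[of "norm (f x)" "norm (g x)"] mult_nonneg_nonneg[OF norm_ge_zero norm_ge_zero, of "f x" "g x"] by linarith
    finally show "norm (f x \<bullet> g x) \<le> norm ((norm (f x))\<^sup>2 + (norm (g x))\<^sup>2)" by simp
  qed
qed

lemma L2_scaleR [simp]: "L2_on_S2 f \<Longrightarrow> L2_on_S2 (\<lambda>x. c *\<^sub>R f x)"
  by (auto simp: L2_on_S2_def power_mult_distrib)

lemma L2_add [simp]: 
  assumes "L2_on_S2 f" "L2_on_S2 g" shows "L2_on_S2 (\<lambda>x. f x + g x)"
proof -
  have "(norm (f x + g x))\<^sup>2 = (norm (f x))\<^sup>2 + 2 * (f x \<bullet> g x) + (norm (g x))\<^sup>2" for x
    by (simp add: power2_norm_eq_inner inner_add inner_commute)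
  thus ?thesis using assms integrable_inner_L2[OF assms] by (auto simp: L2_on_S2_def)
qed

lemma L2_zero [simp]: "L2_on_S2 (\<lambda>x. 0)"
  by (auto simp: L2_on_S2_def)

lemma L2_diff [simp]: "L2_on_S2 f \<Longrightarrow> L2_on_S2 g \<Longrightarrow> L2_on_S2 (\<lambda>x. f x - g x)"
  using L2_add[of f "\<lambda>x. (-1) *\<^sub>R g x"] L2_scaleR[of g "-1"] by simp

lemma L2_sum [simp]: "(\<And>i. i \<in> A \<Longrightarrow> L2_on_S2 (f i)) \<Longrightarrow> L2_on_S2 (\<lambda>x. \<Sum>i\<in>A. f i x)"
  by (induction A rule: infinite_finite_induct) auto

lemma ip_commute: "ip f g = ip g f"
  by (simp add: ip_def inner_commute)

lemma ip_nonneg: "ip f f \<ge> 0"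
  by (simp add: ip_def)

lemma ip_L2_norm: "ip f f = (L2_norm f)\<^sup>2"
  by (simp add: ip_def L2_norm_def power2_norm_eq_inner)

lemma ip_add_left: "L2_on_S2 f \<Longrightarrow> L2_on_S2 g \<Longrightarrow> L2_on_S2 h \<Longrightarrow> ip (\<lambda>x. f x + g x) h = ip f h + ip g h"
  by (simp add: ip_def inner_add_left integrable_inner_L2)

lemma ip_diff_left: "L2_on_S2 f \<Longrightarrow> L2_on_S2 g \<Longrightarrow> L2_on_S2 h \<Longrightarrow> ip (\<lambda>x. f x - g x) h = ip f h - ip g h"
  by (simp add: ip_def inner_diff_left integrable_inner_L2)

lemma ip_scale_left: "ip (\<lambda>x. c *\<^sub>R f x) h = c * ip f h"
  by (simp add: ip_def)

lemma ip_add_right: "L2_on_S2 f \<Longrightarrow> L2_on_S2 g \<Longrightarrow> L2_on_S2 h \<Longrightarrow> ip h (\<lambda>x. f x + g x) = ip h f + ip h g"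
  by (simp add: ip_def inner_add_right integrable_inner_L2)

lemma ip_diff_right: "L2_on_S2 f \<Longrightarrow> L2_on_S2 g \<Longrightarrow> L2_on_S2 h \<Longrightarrow> ip h (\<lambda>x. f x - g x) = ip h f - ip h g"
  by (simp add: ip_def inner_diff_right integrable_inner_L2)

lemma ip_scale_right: "ip h (\<lambda>x. c *\<^sub>R f x) = c * ip h f"
  by (simp add: ip_def)

lemma ip_cmult_left: "ip (\<lambda>x. c * f x) h = c * ip f h"
  by (simp add: ip_def mult.assoc)

lemma ip_sum_left:
  "(\<And>i. i \<in> A \<Longrightarrow> L2_on_S2 (f i)) \<Longrightarrow> L2_on_S2 h \<Longrightarrow> ip (\<lambda>x. \<Sum>i\<in>A. f i x) h = (\<Sum>i\<in>A. ip (f i) h)"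
  by (simp add: ip_def inner_sum_left integrable_inner_L2)

lemma ip_cong: "(\<And>x. x \<in> S2 \<Longrightarrow> f x = f' x) \<Longrightarrow> (\<And>x. x \<in> S2 \<Longrightarrow> g x = g' x) \<Longrightarrow> ip f g = ip f' g'"
  unfolding ip_def by (rule Bochner_Integration.integral_cong) auto

lemma ip_zero [simp]: "ip (\<lambda>x. 0) g = 0" "ip g (\<lambda>x. 0) = 0"
  by (auto simp: ip_def)

definition L2_proj :: "('i \<Rightarrow> real^3 \<Rightarrow> 'b::euclidean_space) \<Rightarrow> 'i set \<Rightarrow> (real^3 \<Rightarrow> 'b) \<Rightarrow> real^3 \<Rightarrow> 'b" where
  "L2_proj e A f x = (\<Sum>i\<in>A. ip f (e i) *\<^sub>R e i x)"

definition orthonormal_on :: "('i \<Rightarrow> real^3 \<Rightarrow> 'b::euclidean_space) \<Rightarrow> 'i set \<Rightarrow> bool" where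
  "orthonormal_on e A \<longleftrightarrow> finite A \<and> (\<forall>i\<in>A. L2_on_S2 (e i)) \<and>
     (\<forall>i\<in>A. \<forall>j\<in>A. ip (e i) (e j) = (if i = j then 1 else 0))"

lemma ip_lincomb:
  assumes "orthonormal_on e A"
  shows "ip (\<lambda>x. \<Sum>i\<in>A. c i *\<^sub>R e i x) (\<lambda>x. \<Sum>i\<in>A. d i *\<^sub>R e i x) = (\<Sum>i\<in>A. c i * d i)"
proof -
  have L: "\<And>i. i \<in> A \<Longrightarrow> L2_on_S2 (e i)" and fin: "finite A"
    and o: "\<And>i j. i \<in> A \<Longrightarrow> j \<in> A \<Longrightarrow> ip (e i) (e j) = (if i = j then 1 else 0)"
    using assms by (auto simp: orthonormal_on_def)
  have "ip (\<lambda>x. \<Sum>i\<in>A. c i *\<^sub>R e i x) (\<lambda>x. \<Sum>i\<in>A. d i *\<^sub>R e i x)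
      = (\<Sum>i\<in>A. c i * ip (e i) (\<lambda>x. \<Sum>i\<in>A. d i *\<^sub>R e i x))"
    by (subst ip_sum_left) (auto simp: L ip_scale_left)
  also have "\<dots> = (\<Sum>i\<in>A. c i * (\<Sum>j\<in>A. d j * ip (e j) (e i)))"
    by (intro sum.cong refl, subst ip_commute, subst ip_sum_left) (auto simp: L ip_scale_left)
  also have "\<dots> = (\<Sum>i\<in>A. c i * d i)"
    by (intro sum.cong refl) (simp add: o fin if_distrib[of "\<lambda>z. _ * z"] cong: if_cong)
  finally show ?thesis .
qed

text \<open>Pythagoras for the orthogonal projection onto a finite orthonormal family.\<close>
lemma ip_L2_proj:
  assumes "orthonormal_on e A" "L2_on_S2 f"
  shows "L2_on_S2 (L2_proj e A f)"
    and "ip (\<lambda>x. f x - L2_proj e A f x) (\<lambda>x. f x - L2_proj e A f x) = ip f f - (\<Sum>i\<in>A. (ip f (e i))\<^sup>2)"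
proof -
  have L: "\<And>i. i \<in> A \<Longrightarrow> L2_on_S2 (e i)" using assms by (auto simp: orthonormal_on_def)
  show P: "L2_on_S2 (L2_proj e A f)" unfolding L2_proj_def[abs_def] by (simp add: L)
  have 1: "ip (L2_proj e A f) (L2_proj e A f) = (\<Sum>i\<in>A. (ip f (e i))\<^sup>2)"
    unfolding L2_proj_def[abs_def] ip_lincomb[OF assms(1)] by (simp add: power2_eq_square)
  have 2: "ip (L2_proj e A f) f = (\<Sum>i\<in>A. (ip f (e i))\<^sup>2)"
    unfolding L2_proj_def[abs_def]
    by (subst ip_sum_left) (auto simp: L assms ip_scale_left power2_eq_square ip_commute[of f])
  have "ip (\<lambda>x. f x - L2_proj e A f x) (\<lambda>x. f x - L2_proj e A f x)
     = ip f (\<lambda>x. f x - L2_proj e A f x) - ip (L2_proj e A f) (\<lambda>x. f x - L2_proj e A f x)"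
    using P assms by (simp add: ip_diff_left)
  also have "\<dots> = ip f f - ip (L2_proj e A f) f - (ip f (L2_proj e A f) - ip (L2_proj e A f) (L2_proj e A f))"
    using P assms by (simp add: ip_diff_left ip_commute[of _ "\<lambda>x. f x - L2_proj e A f x"])
  finally show "ip (\<lambda>x. f x - L2_proj e A f x) (\<lambda>x. f x - L2_proj e A f x) = ip f f - (\<Sum>i\<in>A. (ip f (e i))\<^sup>2)"
    by (simp add: 1 2 ip_commute[of f "L2_proj e A f"])
qed

lemma bessel:
  assumes "orthonormal_on e A" "L2_on_S2 f"
  shows "(\<Sum>i\<in>A. (ip f (e i))\<^sup>2) \<le> ip f f"
  using ip_L2_proj(2)[OF assms] ip_nonneg[of "\<lambda>x. f x - L2_proj e A f x"] by simp

lemma ip_Cauchy_Schwarz: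
  assumes "L2_on_S2 f" "L2_on_S2 g"
  shows "\<bar>ip f g\<bar> \<le> L2_norm f * L2_norm g"
proof -
  have q: "0 \<le> ip f f + 2 * t * ip f g + t\<^sup>2 * ip g g" for t
  proof -
    have "0 \<le> ip (\<lambda>x. f x + t *\<^sub>R g x) (\<lambda>x. f x + t *\<^sub>R g x)" by (rule ip_nonneg)
    also have "\<dots> = ip f (\<lambda>x. f x + t *\<^sub>R g x) + t * ip g (\<lambda>x. f x + t *\<^sub>R g x)"
      using assms by (simp add: ip_add_left ip_scale_left)
    also have "\<dots> = (ip f f + t * ip f g) + t * (ip f g + t * ip g g)"
      using assms by (simp add: ip_commute[of _ "\<lambda>x. f x + t *\<^sub>R g x"] ip_add_left ip_scale_left ip_commute[of g f])
    finally show ?thesis by (simp add: power2_eq_square algebra_simps)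
  qed
  have "(ip f g)\<^sup>2 \<le> ip f f * ip g g"
  proof (cases "ip g g = 0")
    case True
    have "ip f g = 0"
    proof (rule ccontr)
      assume "ip f g \<noteq> 0"
      thus False using q[of "- (ip f f + 1) / ip f g"] True ip_nonneg[of f] by simp
    qed
    thus ?thesis using True by simp
  next
    case False
    hence "ip g g > 0" using ip_nonneg[of g] by simp
    thus ?thesis using q[of "- ip f g / ip g g"] by (simp add: field_simps power2_eq_square)
  qed
  also have "\<dots> = (L2_norm f * L2_norm g)\<^sup>2" by (simp add: ip_L2_norm power_mult_distrib)
  finally show ?thesis
    by (rule abs_le_square_iff[THEN iffD2, THEN order_trans]) (simp add: L2_norm_def)
qed

definition monomial3 :: "nat \<Rightarrow> nat \<Rightarrow> nat \<Rightarrow> real^3 \<Rightarrow> real" where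
  "monomial3 a b c x = x$1 ^ a * (x$2 ^ b * x$3 ^ c)"

lemma poly_upto_monomial3: "poly_upto (a + b + c) (monomial3 a b c)"
proof -
  have p: "poly_upto k (\<lambda>x. x$j ^ k)" for k j
    by (induction k) (auto intro: poly_upto.const poly_upto.mult)
  show ?thesis
    using poly_upto_mult[OF p[of a 1] poly_upto_mult[OF p[of b 2] p[of c 3]]] by (simp add: monomial3_def[abs_def] add.assoc)
qed

text \<open>The basis functions are numbered so that those of degree \<open>n\<close> occupy the \<open>2 n + 1\<close> places from \<open>n\<^sup>2\<close> to
  \<open>n\<^sup>2 + 2 n\<close>.\<close>
definition level :: "nat \<Rightarrow> nat" where "level i = floor_sqrt i"

lemma level_le_iff: "level i \<le> n \<longleftrightarrow> i < (n + 1)\<^sup>2"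
proof -
  have "i < (n + 1)\<^sup>2 \<longleftrightarrow> \<not> (n + 1)\<^sup>2 \<le> i" by (rule linorder_not_le[symmetric])
  also have "(n+1)\<^sup>2 \<le> i \<longleftrightarrow> n + 1 \<le> level i"
    using le_floor_sqrt_iff[of "n+1" i] by (simp add: level_def)
  finally show ?thesis by auto
qed

lemma level_mono: "i \<le> j \<Longrightarrow> level i \<le> level j"
  by (meson level_le_iff le_less_trans order_refl)

text \<open>Modulo \<open>z\<^sup>2 = 1 - x\<^sup>2 - y\<^sup>2\<close> the monomials \<open>x\<^sup>a y\<^sup>b\<close> and \<open>x\<^sup>a y\<^sup>b z\<close> suffice. Those of degree \<open>n\<close> are listed with
  the \<open>n + 1\<close> ones without \<open>z\<close> first and the \<open>n\<close> ones with \<open>z\<close> after them.\<close>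
definition basis_monomial :: "nat \<Rightarrow> real^3 \<Rightarrow> real" where
  "basis_monomial i = (let n = level i; k = i - n\<^sup>2 in
     if k \<le> n then monomial3 k (n - k) 0 else monomial3 (k - n - 1) (2 * n - k) 1)"

lemma poly_upto_basis_monomial: "poly_upto (level i) (basis_monomial i)"
proof -
  have "i < (level i + 1)\<^sup>2" using level_le_iff by blast
  hence k: "i - (level i)\<^sup>2 \<le> 2 * level i" by (simp add: power2_eq_square)
  show ?thesis
  proof (cases "i - (level i)\<^sup>2 \<le> level i")
    case True
    then show ?thesis using poly_upto_monomial3[of "i - (level i)\<^sup>2" "level i - (i - (level i)\<^sup>2)" 0]
      by (simp add: basis_monomial_def Let_def)
  next
    case False
    hence "i - (level i)\<^sup>2 - level i - 1 + (2 * level i - (i - (level i)\<^sup>2)) + 1 = level i" using k by simp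
    then show ?thesis using False poly_upto_monomial3[of "i - (level i)\<^sup>2 - level i - 1" "2 * level i - (i - (level i)\<^sup>2)" 1]
      by (simp add: basis_monomial_def Let_def)
  qed
qed

lemma basis_monomial_surj:
  assumes "c \<le> 1" shows "\<exists>i. level i = a + b + c \<and> basis_monomial i = monomial3 a b c"
proof -
  define n where "n = a + b + c"
  \<comment> \<open>The position of the monomial within its degree.\<close>
  define k where "k = (if c = 0 then a else n + 1 + a)"
  have k: "k \<le> 2 * n" using assms by (auto simp: k_def n_def)
  have l: "level (n\<^sup>2 + k) = n"
    unfolding level_def by (rule floor_sqrt_unique) (use k in \<open>auto simp: power2_eq_square\<close>)
  have "basis_monomial (n\<^sup>2 + k) = (if k \<le> n then monomial3 k (n - k) 0 else monomial3 (k - n - 1) (2 * n - k) 1)"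
    by (simp only: basis_monomial_def Let_def l diff_add_inverse)
  also have "\<dots> = monomial3 a b c" using assms by (cases "c = 0") (auto simp: k_def n_def le_Suc_eq)
  finally have "basis_monomial (n\<^sup>2 + k) = monomial3 a b c" .
  thus ?thesis using l n_def by blast
qed

text \<open>Gram--Schmidt orthonormalisation of the monomials. Should a remainder \<open>h\<close> vanish on the sphere, then division
  by zero makes the result the zero function; such indices are left out of the basis later.\<close>
function harmonic :: "nat \<Rightarrow> real^3 \<Rightarrow> real" where
  "harmonic i = (let h = (\<lambda>x. basis_monomial i x - (\<Sum>j<i. ip (basis_monomial i) (harmonic j) * harmonic j x)) in (\<lambda>x. h x / sqrt (ip h h)))"
  by pat_completeness auto
termination by (relation "Wellfounded.measure id") auto

declare harmonic.simps [simp del]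

definition harmonic_rest :: "nat \<Rightarrow> real^3 \<Rightarrow> real" where
  "harmonic_rest i = (\<lambda>x. basis_monomial i x - (\<Sum>j<i. ip (basis_monomial i) (harmonic j) * harmonic j x))"

lemma harmonic_eq: "harmonic i = (\<lambda>x. harmonic_rest i x / sqrt (ip (harmonic_rest i) (harmonic_rest i)))"
  by (subst harmonic.simps) (simp add: Let_def harmonic_rest_def)

lemma poly_upto_harmonic_level: "poly_upto (level i) (harmonic i)"
proof (induction i rule: less_induct)
  case (less i)
  have "poly_upto (level i) (harmonic_rest i)" unfolding harmonic_rest_def
    by (intro poly_upto_diff poly_upto_basis_monomial poly_upto_sum poly_upto_cmult) (auto intro!: poly_upto_mono[OF less] level_mono)
  from poly_upto_cmult[OF this, of "1 / sqrt (ip (harmonic_rest i) (harmonic_rest i))"] show ?case by (simp add: harmonic_eq)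
qed

lemma poly_upto_harmonic: "level i \<le> n \<Longrightarrow> poly_upto n (harmonic i)"
  using poly_upto_mono poly_upto_harmonic_level by blast

lemma polyfn_harmonic [simp]: "polyfn (harmonic i)" by (rule polyfnI[OF poly_upto_harmonic_level])

lemma polyfn_basis_monomial [simp]: "polyfn (basis_monomial i)" by (rule polyfnI[OF poly_upto_basis_monomial])

lemma polyfn_harmonic_rest [simp]: "polyfn (harmonic_rest i)" unfolding harmonic_rest_def by simp

lemma harmonic_norm: "harmonic i = (\<lambda>x. 0) \<or> ip (harmonic i) (harmonic i) = 1"
proof (cases "ip (harmonic_rest i) (harmonic_rest i) = 0")
  case True
  then show ?thesis by (simp add: harmonic_eq)
next
  case False
  define c where "c = 1 / sqrt (ip (harmonic_rest i) (harmonic_rest i))"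
  have g: "harmonic i = (\<lambda>x. c * harmonic_rest i x)" by (simp add: harmonic_eq c_def)
  have "ip (harmonic i) (harmonic i) = c * (c * ip (harmonic_rest i) (harmonic_rest i))"
    unfolding g ip_cmult_left ip_commute[of "harmonic_rest i" "\<lambda>x. c * harmonic_rest i x"] ..
  thus ?thesis using False ip_nonneg[of "harmonic_rest i"] by (simp add: c_def)
qed

lemma harmonic_orthogonal_less: "j < i \<Longrightarrow> ip (harmonic i) (harmonic j) = 0"
proof (induction i arbitrary: j rule: less_induct)
  case (less i)
  have o: "ip (harmonic l) (harmonic j) = (if l = j then ip (harmonic j) (harmonic j) else 0)" if "l < i" for l
    using that less.prems less.IH[of l j] less.IH[of j l] ip_commute[of "harmonic l" "harmonic j"]
    by (cases l j rule: linorder_cases) auto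
  have "ip (harmonic_rest i) (harmonic j) = ip (basis_monomial i) (harmonic j) - (\<Sum>l<i. ip (basis_monomial i) (harmonic l) * ip (harmonic l) (harmonic j))"
    unfolding harmonic_rest_def by (simp add: ip_diff_left ip_sum_left ip_cmult_left)
  also have "(\<Sum>l<i. ip (basis_monomial i) (harmonic l) * ip (harmonic l) (harmonic j)) = (\<Sum>l<i. if l = j then ip (basis_monomial i) (harmonic j) * ip (harmonic j) (harmonic j) else 0)"
    by (rule sum.cong, simp, subst o) auto
  also have "\<dots> = ip (basis_monomial i) (harmonic j) * ip (harmonic j) (harmonic j)" using less.prems by simp
  also have "ip (basis_monomial i) (harmonic j) - \<dots> = 0" using harmonic_norm[of j] by auto
  finally have "ip (harmonic_rest i) (harmonic j) = 0" .
  thus ?case unfolding harmonic_eq[of i] using ip_cmult_left[of "1 / sqrt (ip (harmonic_rest i) (harmonic_rest i))" "harmonic_rest i" "harmonic j"] by simp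
qed

lemma harmonic_orthogonal: "i \<noteq> j \<Longrightarrow> ip (harmonic i) (harmonic j) = 0"
  using harmonic_orthogonal_less ip_commute by (metis linorder_neqE_nat)

definition harmonic_span :: "nat \<Rightarrow> (real^3 \<Rightarrow> real) \<Rightarrow> bool" where
  "harmonic_span n f \<longleftrightarrow> (\<exists>c. \<forall>x\<in>S2. f x = (\<Sum>i<(n+1)\<^sup>2. c i * harmonic i x))"

lemma harmonic_span_cmult: "harmonic_span n f \<Longrightarrow> harmonic_span n (\<lambda>x. a * f x)"
proof -
  assume "harmonic_span n f"
  then obtain c where "\<And>x. x \<in> S2 \<Longrightarrow> f x = (\<Sum>i<(n+1)\<^sup>2. c i * harmonic i x)" by (auto simp: harmonic_span_def)
  thus ?thesis unfolding harmonic_span_def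
    by (intro exI[of _ "\<lambda>i. a * c i"]) (auto simp: sum_distrib_left mult.assoc)
qed

lemma harmonic_span_add: "harmonic_span n f \<Longrightarrow> harmonic_span n g \<Longrightarrow> harmonic_span n (\<lambda>x. f x + g x)"
proof -
  assume "harmonic_span n f" "harmonic_span n g"
  then obtain c d where "\<And>x. x \<in> S2 \<Longrightarrow> f x = (\<Sum>i<(n+1)\<^sup>2. c i * harmonic i x)"
    "\<And>x. x \<in> S2 \<Longrightarrow> g x = (\<Sum>i<(n+1)\<^sup>2. d i * harmonic i x)" by (auto simp: harmonic_span_def)
  thus ?thesis unfolding harmonic_span_def
    by (intro exI[of _ "\<lambda>i. c i + d i"]) (auto simp: sum.distrib distrib_right)
qed

lemma harmonic_span_mono:
  assumes "harmonic_span n f" "n \<le> m" shows "harmonic_span m f"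
proof -
  obtain c where c: "\<And>x. x \<in> S2 \<Longrightarrow> f x = (\<Sum>i<(n+1)\<^sup>2. c i * harmonic i x)"
    using assms by (auto simp: harmonic_span_def)
  have le: "(n+1)\<^sup>2 \<le> (m+1)\<^sup>2" using assms by (intro power_mono) auto
  have "(\<Sum>i<(m+1)\<^sup>2. (if i < (n+1)\<^sup>2 then c i else 0) * harmonic i x) = (\<Sum>i<(n+1)\<^sup>2. c i * harmonic i x)" for x
    by (rule sum.mono_neutral_cong_right) (use le in auto)
  thus ?thesis unfolding harmonic_span_def
    by (intro exI[of _ "\<lambda>i. if i < (n+1)\<^sup>2 then c i else 0"]) (use c in auto)
qed

lemma harmonic_span_cong: "harmonic_span n f \<Longrightarrow> (\<And>x. x \<in> S2 \<Longrightarrow> g x = f x) \<Longrightarrow> harmonic_span n g"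
  by (auto simp: harmonic_span_def)

lemma harmonic_span_basis_monomial: "harmonic_span (level i) (basis_monomial i)"
proof -
  have rest: "harmonic_rest i x = sqrt (ip (harmonic_rest i) (harmonic_rest i)) * harmonic i x" if x: "x \<in> S2" for x
  proof (cases "ip (harmonic_rest i) (harmonic_rest i) = 0")
    case True
    hence "harmonic_rest i x = 0"
      by (intro dS_null_continuous_imp_zero[OF polyfn_continuous_on[OF polyfn_harmonic_rest] _ x]) (simp add: ip_def power2_eq_square)
    thus ?thesis using True by simp
  next
    case False
    then show ?thesis by (simp add: harmonic_eq)
  qed
  define c where "c = (\<lambda>j. if j < i then ip (basis_monomial i) (harmonic j) else if j = i then sqrt (ip (harmonic_rest i) (harmonic_rest i)) else 0)"
  have "i < (level i + 1)\<^sup>2" using level_le_iff by blast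
  hence "(\<Sum>j<(level i+1)\<^sup>2. c j * harmonic j x) = (\<Sum>j<Suc i. c j * harmonic j x)" for x
    by (intro sum.mono_neutral_right) (auto simp: c_def)
  moreover have "(\<Sum>j<Suc i. c j * harmonic j x) = basis_monomial i x" if "x \<in> S2" for x
    using rest[OF that] by (simp add: c_def harmonic_rest_def)
  ultimately show ?thesis unfolding harmonic_span_def by (intro exI[of _ c]) simp
qed

text \<open>The induction is over the construction of \<open>f\<close>, generalised to products with a basis monomial: a new factor \<open>x\<close> or
  \<open>y\<close> is absorbed by the monomial, and so is a first factor \<open>z\<close>, while a second one is traded through
  \<open>z\<^sup>2 = 1 - x\<^sup>2 - y\<^sup>2\<close>.\<close>
lemma harmonic_span_poly_upto:
  assumes "poly_upto n f" shows "harmonic_span n f"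
proof -
  have "harmonic_span (n + (a + b + c)) (\<lambda>x. f x * monomial3 a b c x)" if "c \<le> 1" for a b c
    using assms that
  proof (induction arbitrary: a b c rule: poly_upto.induct)
    case (const n d)
    obtain i where "level i = a + b + c" "basis_monomial i = monomial3 a b c" using basis_monomial_surj const by blast
    then have "harmonic_span (a + b + c) (monomial3 a b c)" using harmonic_span_basis_monomial[of i] by simp
    then show ?case by (intro harmonic_span_cmult) (rule harmonic_span_mono, auto)
  next
    case (mult n f j)
    consider "j = 1" | "j = 2" | "j = 3" "c = 0" | "j = 3" "c = 1"
      using exhaust_3[of j] mult.prems by fastforce
    then show ?case
    proof cases
      case 1
      show ?thesis
        by (rule harmonic_span_cong) (use mult.IH[of c "Suc a" b] mult.prems in simp, simp add: 1 monomial3_def)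
    next
      case 2
      show ?thesis
        by (rule harmonic_span_cong) (use mult.IH[of c a "Suc b"] mult.prems in simp, simp add: 2 monomial3_def)
    next
      case 3
      show ?thesis
        by (rule harmonic_span_cong) (use mult.IH[of 1 a b] in \<open>simp add: 3\<close>, simp add: 3 monomial3_def)
    next
      case 4
      have 0: "harmonic_span (n + (a + b + 2)) (\<lambda>x. f x * monomial3 a b 0 x)"
        by (rule harmonic_span_mono[OF mult.IH]) auto
      have A: "harmonic_span (n + (a + b + 2)) (\<lambda>x. f x * monomial3 (a+2) b 0 x)"
        using mult.IH[of 0 "a+2" b] by (simp add: algebra_simps)
      have B: "harmonic_span (n + (a + b + 2)) (\<lambda>x. f x * monomial3 a (b+2) 0 x)"
        using mult.IH[of 0 a "b+2"] by (simp add: algebra_simps)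
      have "harmonic_span (n + (a + b + 2)) (\<lambda>x. f x * monomial3 a b 0 x +
         ((-1) * (f x * monomial3 (a+2) b 0 x) + (-1) * (f x * monomial3 a (b+2) 0 x)))"
        by (intro harmonic_span_add harmonic_span_cmult 0 A B)
      moreover have "x$j * f x * monomial3 a b c x = f x * monomial3 a b 0 x +
         ((-1) * (f x * monomial3 (a+2) b 0 x) + (-1) * (f x * monomial3 a (b+2) 0 x))" if "x \<in> S2" for x
      proof -
        have "x$j * f x * monomial3 a b c x = f x * x$1 ^ a * x$2^b * (x$3 * x$3)"
          by (simp add: 4 monomial3_def algebra_simps)
        also have "\<dots> = f x * x$1 ^ a * x$2^b * (1 - x$1 * x$1 - x$2 * x$2)"
          unfolding S2_sq[OF that] by simp
        finally show ?thesis by (simp add: monomial3_def algebra_simps power_add power2_eq_square)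
      qed
      ultimately show ?thesis
        using harmonic_span_cong[of "n + (a + b + 2)"] 4 by simp
    qed
  next
    case (add n f g)
    then show ?case using harmonic_span_add[OF add.IH] by (simp add: distrib_right)
  qed
  from this[of 0 0 0] show ?thesis by (simp add: monomial3_def)
qed

definition basis_upto :: "nat \<Rightarrow> nat set" where
  "basis_upto n = {i. level i \<le> n \<and> harmonic i \<noteq> (\<lambda>x. 0)}"

lemma basis_upto_subset: "basis_upto n \<subseteq> {..<(n+1)\<^sup>2}"
  using level_le_iff by (auto simp: basis_upto_def)

lemma finite_basis_upto [simp]: "finite (basis_upto n)"
  using basis_upto_subset finite_subset by blast

lemma card_basis_upto: "card (basis_upto n) \<le> (n+1)\<^sup>2"
  using card_mono[OF _ basis_upto_subset] by simp

lemma harmonic_orthonormal: "i \<in> basis_upto n \<Longrightarrow> ip (harmonic i) (harmonic j) = (if i = j then 1 else 0)"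
  using harmonic_norm[of i] harmonic_orthogonal by (auto simp: basis_upto_def)

lemma orthonormal_on_harmonic: "orthonormal_on harmonic (basis_upto n)"
  by (auto simp: orthonormal_on_def harmonic_orthonormal)

lemma harmonic_expansion:
  assumes "poly_upto n f" "x \<in> S2"
  shows "f x = (\<Sum>i\<in>basis_upto n. ip f (harmonic i) * harmonic i x)"
proof -
  obtain c where c: "\<And>x. x \<in> S2 \<Longrightarrow> f x = (\<Sum>i<(n+1)\<^sup>2. c i * harmonic i x)"
    using harmonic_span_poly_upto[OF assms(1)] by (auto simp: harmonic_span_def)
  have nonzero: "f x = (\<Sum>i\<in>basis_upto n. c i * harmonic i x)" if "x \<in> S2" for x
    unfolding c[OF that] by (rule sum.mono_neutral_right) (use basis_upto_subset level_le_iff in \<open>auto simp: basis_upto_def\<close>)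
  have "ip f (harmonic j) = c j" if j: "j \<in> basis_upto n" for j
  proof -
    have "ip f (harmonic j) = ip (\<lambda>x. \<Sum>i\<in>basis_upto n. c i * harmonic i x) (harmonic j)" by (rule ip_cong) (auto simp: nonzero)
    also have "\<dots> = (\<Sum>i\<in>basis_upto n. c i * ip (harmonic i) (harmonic j))"
      by (subst ip_sum_left) (auto simp: ip_cmult_left)
    also have "\<dots> = (\<Sum>i\<in>basis_upto n. if i = j then c i else 0)"
      by (rule sum.cong) (auto simp: harmonic_orthonormal)
    finally show ?thesis using j by simp
  qed
  thus ?thesis using nonzero[OF assms(2)] by simp
qed

lemma harmonic_orthogonal_poly_upto:
  assumes "poly_upto m p" "m < level i" shows "ip (harmonic i) p = 0"
proof -
  have "ip (harmonic i) p = ip (\<lambda>x. \<Sum>j\<in>basis_upto m. ip p (harmonic j) * harmonic j x) (harmonic i)"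
    by (subst ip_commute, rule ip_cong) (auto simp: harmonic_expansion[OF assms(1)])
  also have "\<dots> = (\<Sum>j\<in>basis_upto m. ip p (harmonic j) * ip (harmonic j) (harmonic i))"
    by (subst ip_sum_left) (auto simp: ip_cmult_left)
  also have "\<dots> = 0" using assms(2) by (intro sum.neutral) (auto simp: harmonic_orthonormal, auto simp: basis_upto_def split: if_splits)
  finally show ?thesis .
qed

definition eigval :: "nat \<Rightarrow> real" where "eigval n = real n * (real n + 1)"

text \<open>The defect \<open>q = \<Delta>f + n (n + 1) f\<close> has degree less than \<open>n\<close>, and it is orthogonal to all polynomials \<open>g\<close> of
  degree less than \<open>n\<close>: by symmetry of \<open>\<Delta>\<close> the inner product of \<open>q\<close> and \<open>g\<close> is that of \<open>f\<close> with
  \<open>\<Delta>g + n (n + 1) g\<close>, which is again of degree less than \<open>n\<close>. So \<open>q\<close> vanishes on the sphere.\<close>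
lemma Lap_harmonic:
  assumes "x \<in> S2" shows "Lap (harmonic i) x = - eigval (level i) * harmonic i x"
proof -
  obtain q where q: "poly_upto (level i - 1) q \<and> (level i = 0 \<longrightarrow> q = (\<lambda>x. 0)) \<and>
    (\<forall>x\<in>S2. Lap (harmonic i) x = - eigval (level i) * harmonic i x + q x)"
    using Lap_leading[OF poly_upto_harmonic_level[of i]] unfolding eigval_def by (rule exE)
  note q = q[THEN conjunct1] q[THEN conjunct2, THEN conjunct1] q[THEN conjunct2, THEN conjunct2]
  have [simp]: "polyfn q" using q(1) by (rule polyfnI)
  have "q x = 0"
  proof (cases "level i = 0")
    case True
    then show ?thesis using q by simp
  next
    case False
    have "ip q (harmonic j) = 0" if j: "j \<in> basis_upto (level i - 1)" for j
    proof -
      have "level j < level i" using j False by (auto simp: basis_upto_def)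
      have "ip q (harmonic j) = ip (\<lambda>x. Lap (harmonic i) x + eigval (level i) * harmonic i x) (harmonic j)"
        by (rule ip_cong) (auto simp: q(3))
      also have "\<dots> = ip (Lap (harmonic i)) (harmonic j) + eigval (level i) * ip (harmonic i) (harmonic j)"
        by (simp add: ip_add_left ip_cmult_left)
      also have "ip (harmonic i) (harmonic j) = 0" using \<open>level j < level i\<close> by (intro harmonic_orthogonal) auto
      also have "ip (Lap (harmonic i)) (harmonic j) = ip (harmonic i) (Lap (harmonic j))"
        by (simp add: ip_def integral_Lap_symmetric)
      also have "\<dots> = 0" by (rule harmonic_orthogonal_poly_upto[OF poly_upto_Lap[OF poly_upto_harmonic_level] \<open>level j < level i\<close>])
      finally show ?thesis by simp
    qed
    thus ?thesis using harmonic_expansion[OF q(1) assms] by simp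
  qed
  thus ?thesis using q(3) assms by simp
qed

section \<open>Eigenfields of the vector Laplacian\<close>

definition polyvec :: "(real^3 \<Rightarrow> real^3) \<Rightarrow> bool" where
  "polyvec w \<longleftrightarrow> (\<forall>i. polyfn (\<lambda>x. w x $ i))"

lemma polyvec_continuous_on: "polyvec w \<Longrightarrow> continuous_on A w"
  using continuous_on_vec_lambda[of A "\<lambda>i x. w x $ i"] polyfn_continuous_on by (simp add: polyvec_def)

lemma L2_polyvec [simp]: "polyvec w \<Longrightarrow> L2_on_S2 w"
  by (rule L2_continuous[OF polyvec_continuous_on])

lemma ip_polyvec:
  assumes "polyvec v" "polyvec w"
  shows "ip v w = (\<Sum>i\<in>UNIV. \<integral>x. v x $ i * w x $ i \<partial>dS)"
  using assms unfolding ip_def inner_vec_def polyvec_def by simp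

definition ang_vec :: "(real^3 \<Rightarrow> real) \<Rightarrow> real^3 \<Rightarrow> real^3" where
  "ang_vec f x = (\<chi> i. ang i f x)"

lemma ang_vec_nth [simp]: "ang_vec f x $ i = ang i f x"
  by (simp add: ang_vec_def)

text \<open>On the sphere \<open>x \<times> (x \<times> \<nabla>f)\<close> is minus the surface gradient of \<open>f\<close>. Thus \<open>True\<close> selects the divergence-free and
  \<open>False\<close> the rotation-free fields of the Hodge decomposition.\<close>
definition hodge_field :: "bool \<Rightarrow> (real^3 \<Rightarrow> real) \<Rightarrow> real^3 \<Rightarrow> real^3" where
  "hodge_field t f x = (if t then ang_vec f x else cross3 x (ang_vec f x))"

lemma cross3_nth:
  "cross3 x y $ 1 = x$2 * y$3 - x$3 * y$2" "cross3 x y $ 2 = x$3 * y$1 - x$1 * y$3"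
  "cross3 x y $ 3 = x$1 * y$2 - x$2 * y$1"
  by (simp_all add: cross3_def)

lemma polyvec_hodge_field [simp]:
  assumes [simp]: "polyfn f" shows "polyvec (hodge_field t f)"
  unfolding polyvec_def
proof
  fix i
  show "polyfn (\<lambda>x. hodge_field t f x $ i)" using exhaust_3[of i]
    by (cases t) (auto simp: hodge_field_def cross3_nth)
qed

lemma ang_vec_radial: "polyfn f \<Longrightarrow> x \<bullet> ang_vec f x = 0"
  using ang_radial unfolding polyfn_def by (auto simp: inner_vec_def sum_3)

lemma hodge_field_inner_same:
  assumes "polyfn f" "x \<in> S2"
  shows "hodge_field t f x \<bullet> hodge_field t g x = ang_vec f x \<bullet> ang_vec g x"
proof (cases t)
  case False
  have "cross3 x (ang_vec f x) \<bullet> cross3 x (ang_vec g x) = (x \<bullet> x) * (ang_vec f x \<bullet> ang_vec g x) - (x \<bullet> ang_vec g x) * (ang_vec f x \<bullet> x)"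
    by (simp add: dot_cross)
  also have "\<dots> = ang_vec f x \<bullet> ang_vec g x"
    using ang_vec_radial[OF assms(1), of x] assms(2) by (simp add: dot_square_norm inner_commute[of _ x])
  finally show ?thesis using False by (simp add: hodge_field_def)
qed (simp add: hodge_field_def)

lemma ip_hodge_field_same:
  assumes [simp]: "polyfn f" "polyfn g"
  shows "ip (hodge_field t f) (hodge_field t g) = - ip f (Lap g)"
proof -
  have p: "polyvec (ang_vec h)" if "polyfn h" for h
    using polyvec_hodge_field[OF that, of True] by (simp add: hodge_field_def[abs_def])
  have "ip (hodge_field t f) (hodge_field t g) = ip (ang_vec f) (ang_vec g)"
    unfolding ip_def by (rule Bochner_Integration.integral_cong) (auto simp: hodge_field_inner_same)
  also have "\<dots> = - ip (Lap g) f"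
    using integral_Lap[OF assms(2,1)] by (simp add: ip_polyvec p) (simp add: ip_def mult.commute)
  finally show ?thesis by (simp add: ip_commute)
qed

lemma ang_commute_polyfn:
  assumes "polyfn f"
  shows "ang 1 (ang 2 f) x = ang 2 (ang 1 f) x - ang 3 f x"
    and "ang 2 (ang 3 f) x = ang 3 (ang 2 f) x - ang 1 f x"
    and "ang 3 (ang 1 f) x = ang 1 (ang 3 f) x - ang 2 f x"
  using assms ang_commutator[of _ f x] unfolding polyfn_def by (auto simp: algebra_simps)

text \<open>Gradients are orthogonal to rotated gradients, because the latter have divergence zero; in terms of the \<open>L\<^sub>i\<close>
  this is \<open>\<Sum>\<^sub>i L\<^sub>i (x \<times> L g)\<^sub>i = 0\<close>, a consequence of the commutation relations.\<close>
lemma ip_hodge_field_distinct: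
  assumes [simp]: "polyfn f" "polyfn g"
  shows "ip (hodge_field True f) (hodge_field False g) = 0"
proof -
  let ?w = "hodge_field False g"
  have w: "polyfn (\<lambda>x. ?w x $ i)" for i using polyvec_hodge_field[of g False] by (simp add: polyvec_def)
  have "(\<Sum>i\<in>UNIV. ang i (\<lambda>x. ?w x $ i) x) = 0" for x
  proof -
    have "x$1 * ang 1 g x + x$2 * ang 2 g x + x$3 * ang 3 g x = 0"
      using ang_radial assms(2) unfolding polyfn_def by blast
    thus ?thesis
      by (simp add: hodge_field_def sum_3 cross3_nth ang_commute_polyfn[OF assms(2), of x] algebra_simps)
  qed
  hence z: "(\<Sum>i\<in>UNIV. f x * ang i (\<lambda>x. ?w x $ i) x) = 0" for x by (simp flip: sum_distrib_left)
  have "ip (hodge_field True f) ?w = (\<Sum>i\<in>UNIV. \<integral>x. ang i f x * ?w x $ i \<partial>dS)"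
    by (simp add: ip_polyvec) (simp add: hodge_field_def)
  also have "\<dots> = - (\<Sum>i\<in>UNIV. \<integral>x. f x * ang i (\<lambda>x. ?w x $ i) x \<partial>dS)"
    by (simp add: integral_ang_by_parts w sum_negf)
  also have "(\<Sum>i\<in>UNIV. \<integral>x. f x * ang i (\<lambda>x. ?w x $ i) x \<partial>dS) = (\<integral>x. (\<Sum>i\<in>UNIV. f x * ang i (\<lambda>x. ?w x $ i) x) \<partial>dS)"
    by (rule Bochner_Integration.integral_sum[symmetric]) (simp add: w)
  finally show ?thesis using z by simp
qed

lemma ip_hodge_field:
  assumes "polyfn f" "polyfn g"
  shows "ip (hodge_field t f) (hodge_field s g) = (if t = s then - ip f (Lap g) else 0)"
  using ip_hodge_field_same[OF assms, of t] ip_hodge_field_distinct[OF assms] ip_hodge_field_distinct[OF assms(2,1)]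
    ip_commute[of "hodge_field False f" "hodge_field True g"]
  by (cases t; cases s) simp_all

lemma eigval_nonneg [simp]: "0 \<le> eigval n" by (simp add: eigval_def)
lemma eigval_pos: "0 < n \<Longrightarrow> 0 < eigval n" by (simp add: eigval_def)
lemma eigval_0 [simp]: "eigval 0 = 0" by (simp add: eigval_def)
lemma eigval_mono: "n \<le> m \<Longrightarrow> eigval n \<le> eigval m" by (simp add: eigval_def mult_mono)

lemma ip_Lap_harmonic: "ip f (Lap (harmonic i)) = - eigval (level i) * ip f (harmonic i)"
proof -
  have "ip f (Lap (harmonic i)) = ip (Lap (harmonic i)) f" by (rule ip_commute)
  also have "\<dots> = ip (\<lambda>x. - eigval (level i) * harmonic i x) f" by (rule ip_cong) (auto simp: Lap_harmonic)
  also have "\<dots> = - eigval (level i) * ip f (harmonic i)"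
    unfolding ip_cmult_left ip_commute[of f] ..
  finally show ?thesis .
qed

text \<open>Constants have zero gradient and give no mode.\<close>
definition modes_upto :: "nat \<Rightarrow> nat set" where "modes_upto n = basis_upto n - basis_upto 0"

lemma finite_modes_upto [simp]: "finite (modes_upto n)" by (simp add: modes_upto_def)

lemma modes_upto_iff: "i \<in> modes_upto n \<longleftrightarrow> i \<in> basis_upto n \<and> 0 < level i" by (auto simp: modes_upto_def basis_upto_def)

text \<open>The fields belonging to a harmonic of eigenvalue \<open>\<lambda>\<close> have squared norm \<open>\<lambda>\<close>.\<close>
definition mode :: "bool \<times> nat \<Rightarrow> real^3 \<Rightarrow> real^3" where
  "mode = (\<lambda>(t, i) x. (1 / sqrt (eigval (level i))) *\<^sub>R hodge_field t (harmonic i) x)"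

lemma mode_eq: "mode (t, i) = (\<lambda>x. (1 / sqrt (eigval (level i))) *\<^sub>R hodge_field t (harmonic i) x)"
  by (simp add: mode_def)

lemma L2_mode [simp]: "L2_on_S2 (mode p)"
  by (cases p) (simp add: mode_eq)

lemma orthonormal_on_mode: "orthonormal_on mode (T \<times> modes_upto n)"
  unfolding orthonormal_on_def
proof (intro conjI ballI)
  show "finite (T \<times> modes_upto n)" by (simp add: finite_subset[of T UNIV])
  show "L2_on_S2 (mode p)" for p by simp
  fix p q assume p: "p \<in> T \<times> modes_upto n" and q: "q \<in> T \<times> modes_upto n"
  obtain t i s j where [simp]: "p = (t, i)" "q = (s, j)" by (cases p, cases q)
  have "ip (mode p) (mode q) = 1 / sqrt (eigval (level i)) * (1 / sqrt (eigval (level j)) * ip (hodge_field t (harmonic i)) (hodge_field s (harmonic j)))"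
    by (simp add: mode_eq ip_scale_left ip_commute[of "hodge_field _ _" "\<lambda>x. _ *\<^sub>R _ x"] ip_commute[of "hodge_field s _"])
  also have "\<dots> = (if p = q then 1 else 0)"
    using p q harmonic_orthonormal[of i n j] eigval_pos[of "level i"]
    by (auto simp: ip_hodge_field ip_Lap_harmonic modes_upto_iff)
  finally show "ip (mode p) (mode q) = (if p = q then 1 else 0)" .
qed

lemma ang_harmonic_expansion:
  assumes "poly_upto n f" "x \<in> S2"
  shows "ang a f x = (\<Sum>k\<in>basis_upto n. ip (ang a f) (harmonic k) * harmonic k x)"
  by (rule harmonic_expansion[OF poly_upto_ang[OF assms(1)] assms(2)])

lemma ip_ang: "polyfn f \<Longrightarrow> polyfn g \<Longrightarrow> ip (ang a f) g = - ip (ang a g) f"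
  using integral_ang_by_parts[of f g a] by (simp add: ip_def mult.commute)

lemma antisymmetric_sum_zero:
  fixes A :: "'i \<Rightarrow> 'i \<Rightarrow> real"
  assumes "\<And>i k. A i k = - A k i"
  shows "(\<Sum>i\<in>I. y i * (\<Sum>k\<in>I. A i k * y k)) = 0"
proof -
  have "(\<Sum>i\<in>I. y i * (\<Sum>k\<in>I. A i k * y k)) = (\<Sum>i\<in>I. \<Sum>k\<in>I. y i * (A i k * y k))"
    by (simp add: sum_distrib_left)
  also have "\<dots> = (\<Sum>k\<in>I. \<Sum>i\<in>I. y i * (A i k * y k))" by (rule sum.swap)
  also have "\<dots> = (\<Sum>k\<in>I. \<Sum>i\<in>I. - (y k * (A k i * y i)))"
    by (intro sum.cong refl, subst assms) simp
  also have "\<dots> = - (\<Sum>i\<in>I. y i * (\<Sum>k\<in>I. A i k * y k))"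
    by (simp add: sum_negf sum_distrib_left)
  finally show ?thesis by simp
qed

text \<open>The sum \<open>S\<close> is constant by rotation symmetry. In infinitesimal form: \<open>L\<^sub>a\<close> maps the span of the basis to itself
  by an antisymmetric matrix, so \<open>L\<^sub>a S = 0\<close> on the sphere. Hence \<open>S\<close> is orthogonal to all harmonics of positive
  degree, and its expansion reduces to a constant, whose value is found by integration.\<close>
lemma sum_harmonic_square:
  assumes x: "x \<in> S2"
  shows "(\<Sum>i\<in>basis_upto n. (harmonic i x)\<^sup>2) = real (card (basis_upto n)) / (4 * pi)"
proof -
  define S where "S = (\<lambda>x. \<Sum>i\<in>basis_upto n. harmonic i x * harmonic i x)"
  have gP: "poly_upto n (harmonic i)" if "i \<in> basis_upto n" for i using that by (auto simp: basis_upto_def intro: poly_upto_harmonic)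
  have PS: "poly_upto (n + n) S" unfolding S_def by (intro poly_upto_sum poly_upto_mult gP)
  have [simp]: "polyfn S" using PS by (rule polyfnI)
  have LS: "ang a S x = 0" if "x \<in> S2" for a x
  proof -
    have "ang a S x = 2 * (\<Sum>i\<in>basis_upto n. harmonic i x * ang a (harmonic i) x)"
      by (simp add: S_def sum_distrib_left mult.commute)
    also have "(\<Sum>i\<in>basis_upto n. harmonic i x * ang a (harmonic i) x) = (\<Sum>i\<in>basis_upto n. harmonic i x * (\<Sum>k\<in>basis_upto n. ip (ang a (harmonic i)) (harmonic k) * harmonic k x))"
      by (intro sum.cong refl) (simp add: ang_harmonic_expansion[OF gP that])
    also have "\<dots> = 0" by (rule antisymmetric_sum_zero, rule ip_ang) simp_all
    finally show ?thesis by simp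
  qed
  have "ip S (harmonic i) = 0" if "level i > 0" for i
  proof -
    have "eigval (level i) * ip S (harmonic i) = ip (hodge_field True S) (hodge_field True (harmonic i))"
      by (simp add: ip_hodge_field_same ip_Lap_harmonic)
    also have "\<dots> = ip (\<lambda>x. 0) (hodge_field True (harmonic i))"
      by (rule ip_cong) (auto simp: hodge_field_def vec_eq_iff LS)
    finally show ?thesis using eigval_pos[OF that] by simp
  qed
  hence S0: "S x = (\<Sum>i\<in>basis_upto 0. ip S (harmonic i) * harmonic i x)" if "x \<in> S2" for x
    unfolding harmonic_expansion[OF PS that] by (intro sum.mono_neutral_right finite_basis_upto) (auto simp: basis_upto_def)
  have "poly_upto 0 (\<lambda>x. \<Sum>i\<in>basis_upto 0. ip S (harmonic i) * harmonic i x)"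
    by (intro poly_upto_sum poly_upto_cmult) (auto simp: basis_upto_def intro: poly_upto_harmonic)
  then obtain s where "(\<lambda>x. \<Sum>i\<in>basis_upto 0. ip S (harmonic i) * harmonic i x) = (\<lambda>x. s)" by (rule poly_upto_0)
  hence s: "S x = s" if "x \<in> S2" for x using S0[OF that] by (metis (no_types, lifting))
  have "(\<integral>x. S x \<partial>dS) = (\<Sum>i\<in>basis_upto n. ip (harmonic i) (harmonic i))"
    by (simp add: S_def ip_def)
  also have "\<dots> = real (card (basis_upto n))" by (simp add: harmonic_orthonormal)
  finally have "real (card (basis_upto n)) = (\<integral>x. S x \<partial>dS)" ..
  also have "\<dots> = (\<integral>x. s \<partial>dS)" by (rule Bochner_Integration.integral_cong) (auto simp: s)
  also have "\<dots> = 4 * pi * s" using measure_dS_S2 by simp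
  finally show ?thesis using s[OF x] by (simp add: S_def power2_eq_square field_simps)
qed

lemma sum_swap_pairs:
  "(\<Sum>i\<in>A. \<Sum>a\<in>B. \<Sum>k\<in>C. \<Sum>l\<in>D. X i a k l) = (\<Sum>k\<in>C. \<Sum>l\<in>D. \<Sum>a\<in>B. \<Sum>i\<in>A. X i a k l)"
proof -
  have "(\<Sum>i\<in>A. \<Sum>a\<in>B. \<Sum>k\<in>C. \<Sum>l\<in>D. X i a k l) = (\<Sum>i\<in>A. \<Sum>k\<in>C. \<Sum>a\<in>B. \<Sum>l\<in>D. X i a k l)"
    by (intro sum.cong refl sum.swap)
  also have "\<dots> = (\<Sum>k\<in>C. \<Sum>i\<in>A. \<Sum>a\<in>B. \<Sum>l\<in>D. X i a k l)" by (rule sum.swap)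
  also have "\<dots> = (\<Sum>k\<in>C. \<Sum>i\<in>A. \<Sum>l\<in>D. \<Sum>a\<in>B. X i a k l)" by (intro sum.cong refl sum.swap)
  also have "\<dots> = (\<Sum>k\<in>C. \<Sum>l\<in>D. \<Sum>i\<in>A. \<Sum>a\<in>B. X i a k l)" by (intro sum.cong refl sum.swap)
  also have "\<dots> = (\<Sum>k\<in>C. \<Sum>l\<in>D. \<Sum>a\<in>B. \<Sum>i\<in>A. X i a k l)" by (intro sum.cong refl sum.swap)
  finally show ?thesis .
qed

text \<open>The operators \<open>L\<^sub>a\<close> act on the harmonics of degree \<open>m\<close> by antisymmetric matrices \<open>A\<^sub>a\<close>. The left-hand side is the
  quadratic form of \<open>\<Sum>\<^sub>a A\<^sub>a\<^sup>T A\<^sub>a\<close> in the vector of values at \<open>x\<close>, and by Parseval the entries of this matrix are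
  the inner products of the fields \<open>L f\<close>; so it is \<open>m (m + 1)\<close> times the identity.\<close>
lemma sum_ang_vec_harmonic_square:
  assumes x: "x \<in> S2"
  shows "(\<Sum>i\<in>{i\<in>basis_upto m. level i = m}. (norm (ang_vec (harmonic i) x))\<^sup>2) = eigval m * (\<Sum>i\<in>{i\<in>basis_upto m. level i = m}. (harmonic i x)\<^sup>2)"
proof -
  let ?I = "{i\<in>basis_upto m. level i = m}"
  define A where "A = (\<lambda>a i k. ip (ang a (harmonic i)) (harmonic k))"
  have anti: "A a i k = - A a k i" for a i k unfolding A_def by (rule ip_ang) simp_all
  have ex: "ang a (harmonic i) x = (\<Sum>k\<in>?I. A a i k * harmonic k x)" if "i \<in> ?I" "x \<in> S2" for a i x
  proof -
    have P: "poly_upto m (harmonic i)" using that by (auto intro: poly_upto_harmonic)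
    have "ip (ang a (harmonic i)) (harmonic k) = 0" if k: "k \<in> basis_upto m - ?I" for k
    proof -
      have "level k < level i" using k \<open>i \<in> ?I\<close> by (auto simp: basis_upto_def)
      thus ?thesis using harmonic_orthogonal_poly_upto[OF poly_upto_ang[OF poly_upto_harmonic_level], of k i a] ip_ang[of "harmonic i" "harmonic k" a]
        by (simp add: ip_commute)
    qed
    thus ?thesis unfolding ang_harmonic_expansion[OF P that(2)] A_def
      by (intro sum.mono_neutral_right) auto
  qed
  have on: "orthonormal_on harmonic ?I" by (auto simp: orthonormal_on_def harmonic_orthonormal)
  have LL: "(\<Sum>a\<in>UNIV. \<Sum>i\<in>?I. A a i k * A a i l) = (if k = l then eigval m else 0)" if k: "k \<in> ?I" and l: "l \<in> ?I" for k l
  proof -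
    have "(\<Sum>i\<in>?I. A a i k * A a i l) = ip (ang a (harmonic k)) (ang a (harmonic l))" for a
    proof -
      have "ip (ang a (harmonic k)) (ang a (harmonic l)) = ip (\<lambda>x. \<Sum>i\<in>?I. A a k i *\<^sub>R harmonic i x) (\<lambda>x. \<Sum>i\<in>?I. A a l i *\<^sub>R harmonic i x)"
        by (rule ip_cong) (simp_all only: ex[OF k] ex[OF l] real_scaleR_def)
      also have "\<dots> = (\<Sum>i\<in>?I. A a k i * A a l i)" by (rule ip_lincomb[OF on])
      also have "\<dots> = (\<Sum>i\<in>?I. A a i k * A a i l)"
        using anti[of a k] anti[of a l] by simp
      finally show ?thesis by simp
    qed
    hence "(\<Sum>a\<in>UNIV. \<Sum>i\<in>?I. A a i k * A a i l) = - ip (harmonic k) (Lap (harmonic l))"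
      using ip_hodge_field_same[of "harmonic k" "harmonic l" True] polyvec_hodge_field[of "harmonic k" True] polyvec_hodge_field[of "harmonic l" True]
      by (simp add: ip_polyvec) (simp add: hodge_field_def ip_def)
    thus ?thesis using k l harmonic_orthonormal[of k m l] by (auto simp: ip_Lap_harmonic)
  qed
  have "(\<Sum>i\<in>?I. (norm (ang_vec (harmonic i) x))\<^sup>2) = (\<Sum>i\<in>?I. \<Sum>a\<in>UNIV. (\<Sum>k\<in>?I. A a i k * harmonic k x) * (\<Sum>l\<in>?I. A a i l * harmonic l x))"
    unfolding power2_norm_eq_inner inner_vec_def
    by (intro sum.cong refl) (simp add: ex[OF _ x])
  also have "\<dots> = (\<Sum>i\<in>?I. \<Sum>a\<in>UNIV. \<Sum>k\<in>?I. \<Sum>l\<in>?I. (A a i k * A a i l) * (harmonic k x * harmonic l x))"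
    unfolding sum_product by (simp add: mult_ac)
  also have "\<dots> = (\<Sum>k\<in>?I. \<Sum>l\<in>?I. \<Sum>a\<in>UNIV. \<Sum>i\<in>?I. (A a i k * A a i l) * (harmonic k x * harmonic l x))"
    by (rule sum_swap_pairs)
  also have "\<dots> = (\<Sum>k\<in>?I. \<Sum>l\<in>?I. (\<Sum>a\<in>UNIV. \<Sum>i\<in>?I. A a i k * A a i l) * (harmonic k x * harmonic l x))"
    by (simp add: sum_distrib_right)
  also have "\<dots> = (\<Sum>k\<in>?I. \<Sum>l\<in>?I. if k = l then eigval m * (harmonic k x * harmonic l x) else 0)"
    by (intro sum.cong refl) (simp add: LL)
  also have "\<dots> = eigval m * (\<Sum>i\<in>?I. (harmonic i x)\<^sup>2)"
    by (simp add: sum_distrib_left power2_eq_square)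
  finally show ?thesis .
qed

lemma basis_upto_0_nonempty: "basis_upto 0 \<noteq> {}"
proof
  assume "basis_upto 0 = {}"
  moreover have "axis 1 1 \<in> S2" by simp
  ultimately show False using harmonic_expansion[OF poly_upto.const[of 0 1], of "axis 1 1"] by simp
qed

text \<open>The modes in \<open>T\<close> up to degree \<open>n\<close> come from at most \<open>(n + 1)\<^sup>2 - 1 = n (n + 2)\<close> harmonics. The constant
  comes from \<open>n (n + 2) \<le> 3/2 n (n + 1)\<close>, with equality for \<open>n = 1\<close>.\<close>
lemma sum_mode_square:
  assumes x: "x \<in> S2"
  shows "(\<Sum>p\<in>T \<times> modes_upto n. (norm (mode p x))\<^sup>2) \<le> real (card T) * (3 / (8 * pi)) * eigval n"
proof -
  let ?I = "\<lambda>m. {i\<in>basis_upto m. level i = m}"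
  have un: "modes_upto n = (\<Union>m\<in>{1..n}. ?I m)" by (auto simp: modes_upto_def basis_upto_def)
  have "(\<Sum>p\<in>T \<times> modes_upto n. (norm (mode p x))\<^sup>2) = (\<Sum>t\<in>T. \<Sum>i\<in>modes_upto n. (norm (mode (t, i) x))\<^sup>2)"
    by (simp add: sum.cartesian_product)
  also have "\<dots> = (\<Sum>t\<in>T. \<Sum>i\<in>modes_upto n. (norm (ang_vec (harmonic i) x))\<^sup>2 / eigval (level i))"
    by (intro sum.cong refl)
       (simp add: mode_eq power_mult_distrib power_divide power2_norm_eq_inner hodge_field_inner_same[OF polyfn_harmonic x])
  also have "\<dots> = real (card T) * (\<Sum>i\<in>modes_upto n. (norm (ang_vec (harmonic i) x))\<^sup>2 / eigval (level i))" by simp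
  also have "(\<Sum>i\<in>modes_upto n. (norm (ang_vec (harmonic i) x))\<^sup>2 / eigval (level i)) = (\<Sum>m\<in>{1..n}. \<Sum>i\<in>?I m. (norm (ang_vec (harmonic i) x))\<^sup>2 / eigval (level i))"
    unfolding un by (rule sum.UNION_disjoint) (simp, simp, blast)
  also have "\<dots> = (\<Sum>m\<in>{1..n}. (\<Sum>i\<in>?I m. (norm (ang_vec (harmonic i) x))\<^sup>2) / eigval m)"
    by (simp add: sum_divide_distrib)
  also have "\<dots> = (\<Sum>m\<in>{1..n}. \<Sum>i\<in>?I m. (harmonic i x)\<^sup>2)"
    unfolding sum_ang_vec_harmonic_square[OF x]
  proof (intro sum.cong refl)
    fix m assume "m \<in> {1..n}"
    hence "eigval m \<noteq> 0" using eigval_pos[of m] by simp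
    thus "eigval m * (\<Sum>i\<in>?I m. (harmonic i x)\<^sup>2) / eigval m = (\<Sum>i\<in>?I m. (harmonic i x)\<^sup>2)" by simp
  qed
  also have "\<dots> = (\<Sum>i\<in>modes_upto n. (harmonic i x)\<^sup>2)"
    unfolding un by (rule sum.UNION_disjoint[symmetric]) (simp, simp, blast)
  also have "\<dots> = (\<Sum>i\<in>basis_upto n. (harmonic i x)\<^sup>2) - (\<Sum>i\<in>basis_upto 0. (harmonic i x)\<^sup>2)"
    unfolding modes_upto_def by (rule sum_diff[OF finite_basis_upto]) (auto simp: basis_upto_def)
  also have "\<dots> = (real (card (basis_upto n)) - real (card (basis_upto 0))) / (4 * pi)"
    unfolding sum_harmonic_square[OF x] by (simp add: diff_divide_distrib)
  also have "\<dots> \<le> 3 / (8 * pi) * eigval n"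
  proof -
    have "card (basis_upto 0) \<ge> 1" using basis_upto_0_nonempty by (simp add: Suc_le_eq card_gt_0_iff)
    moreover have "real (card (basis_upto n)) \<le> (real n + 1)\<^sup>2" using of_nat_mono[OF card_basis_upto[of n], where 'a=real] by (simp add: add.commute)
    ultimately have "real (card (basis_upto n)) - real (card (basis_upto 0)) \<le> real n * (real n + 2)"
      by (simp add: power2_eq_square algebra_simps)
    also have "\<dots> \<le> real n * (3 / 2 * (real n + 1))"
      by (cases n) (auto simp: mult_left_mono)
    finally have "real (card (basis_upto n)) - real (card (basis_upto 0)) \<le> 3 / 2 * eigval n" by (simp add: eigval_def mult_ac)
    hence "(real (card (basis_upto n)) - real (card (basis_upto 0))) / (4 * pi) \<le> 3 / 2 * eigval n / (4 * pi)"
      by (rule divide_right_mono) simp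
    thus ?thesis by simp
  qed
  finally show ?thesis by (simp add: mult_left_mono mult.assoc)
qed

section \<open>Completeness of the eigenfields\<close>

text \<open>The squared distance of \<open>v\<close> from the modes of degree at most \<open>n\<close>.\<close>
definition mode_residual :: "nat \<Rightarrow> (real^3 \<Rightarrow> real^3) \<Rightarrow> real" where
  "mode_residual n v = ip v v - (\<Sum>p\<in>UNIV \<times> modes_upto n. (ip v (mode p))\<^sup>2)"

lemma mode_residual_eq:
  "L2_on_S2 v \<Longrightarrow> mode_residual n v = ip (\<lambda>x. v x - L2_proj mode (UNIV \<times> modes_upto n) v x) (\<lambda>x. v x - L2_proj mode (UNIV \<times> modes_upto n) v x)"
  by (simp add: ip_L2_proj(2)[OF orthonormal_on_mode] mode_residual_def)

lemma mode_residual_nonneg: "L2_on_S2 v \<Longrightarrow> 0 \<le> mode_residual n v"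
  by (simp add: mode_residual_eq ip_nonneg)

lemma mode_residual_le: "mode_residual n v \<le> ip v v"
  by (simp add: mode_residual_def sum_nonneg)

lemma ip_add_le:
  assumes "L2_on_S2 a" "L2_on_S2 b"
  shows "ip (\<lambda>x. a x + b x) (\<lambda>x. a x + b x) \<le> 2 * ip a a + 2 * ip b b"
proof -
  have "ip (\<lambda>x. a x + b x) (\<lambda>x. a x + b x) = ip a a + 2 * ip a b + ip b b"
    using assms by (simp add: ip_add_left ip_add_right ip_commute[of b a])
  moreover have "ip (\<lambda>x. a x - b x) (\<lambda>x. a x - b x) = ip a a - 2 * ip a b + ip b b"
    using assms by (simp add: ip_diff_left ip_diff_right ip_commute[of b a])
  ultimately show ?thesis using ip_nonneg[of "\<lambda>x. a x - b x"] by simp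
qed

lemma mode_residual_add_le:
  assumes "L2_on_S2 v" "L2_on_S2 w"
  shows "mode_residual n (\<lambda>x. v x + w x) \<le> 2 * mode_residual n v + 2 * mode_residual n w"
proof -
  let ?P = "L2_proj mode (UNIV \<times> modes_upto n)"
  have P: "L2_on_S2 (?P v)" "L2_on_S2 (?P w)" using ip_L2_proj(1)[OF orthonormal_on_mode] assms by blast+
  have "?P (\<lambda>x. v x + w x) x = ?P v x + ?P w x" for x
    using assms by (simp add: L2_proj_def ip_add_left scaleR_add_left sum.distrib)
  hence eq: "(\<lambda>x. v x + w x - ?P (\<lambda>x. v x + w x) x) = (\<lambda>x. (v x - ?P v x) + (w x - ?P w x))"
    by auto
  show ?thesis
    unfolding mode_residual_eq[OF L2_add[OF assms]] mode_residual_eq[OF assms(1)] mode_residual_eq[OF assms(2)] eq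
    by (rule ip_add_le) (simp_all add: assms P)
qed

text \<open>Membership in the closed linear span of the modes.\<close>
definition mode_approx :: "(real^3 \<Rightarrow> real^3) \<Rightarrow> bool" where
  "mode_approx v \<longleftrightarrow> L2_on_S2 v \<and> (\<lambda>n. mode_residual n v) \<longlonglongrightarrow> 0"

lemma mode_approx_add:
  assumes "mode_approx v" "mode_approx w" shows "mode_approx (\<lambda>x. v x + w x)"
proof -
  have L: "L2_on_S2 v" "L2_on_S2 w" using assms by (auto simp: mode_approx_def)
  have "(\<lambda>n. 2 * mode_residual n v + 2 * mode_residual n w) \<longlonglongrightarrow> 2 * 0 + 2 * 0"
    using assms unfolding mode_approx_def by (intro tendsto_intros) auto
  hence "(\<lambda>n. 2 * mode_residual n v + 2 * mode_residual n w) \<longlonglongrightarrow> 0" by simp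
  hence "(\<lambda>n. mode_residual n (\<lambda>x. v x + w x)) \<longlonglongrightarrow> 0"
    by (rule tendsto_sandwich[OF _ _ tendsto_const, rotated 2])
       (auto intro!: always_eventually mode_residual_nonneg mode_residual_add_le L2_add L)
  thus ?thesis using L by (simp add: mode_approx_def)
qed

lemma mode_approx_scale: "mode_approx v \<Longrightarrow> mode_approx (\<lambda>x. c *\<^sub>R v x)"
proof -
  assume v: "mode_approx v"
  have "mode_residual n (\<lambda>x. c *\<^sub>R v x) = c\<^sup>2 * mode_residual n v" for n
    unfolding mode_residual_def ip_scale_left ip_scale_right power_mult_distrib
      sum_distrib_left[symmetric] by (simp add: right_diff_distrib power2_eq_square)
  thus ?thesis using v tendsto_mult_right[of "\<lambda>n. mode_residual n v" 0 sequentially "c\<^sup>2"]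
    by (auto simp: mode_approx_def intro: tendsto_mult_right_zero)
qed

lemma mode_approx_zero: "mode_approx (\<lambda>x. 0)"
  by (simp add: mode_approx_def mode_residual_def)

lemma mode_approx_sum: "(\<And>i. i \<in> A \<Longrightarrow> mode_approx (f i)) \<Longrightarrow> mode_approx (\<lambda>x. \<Sum>i\<in>A. f i x)"
  by (induction A rule: infinite_finite_induct) (auto intro: mode_approx_zero mode_approx_add)

lemma mode_approx_cong:
  assumes "mode_approx v" "L2_on_S2 w" "\<And>x. x \<in> S2 \<Longrightarrow> w x = v x" shows "mode_approx w"
proof -
  have "mode_residual n w = mode_residual n v" for n
  proof -
    have "ip w w = ip v v" "ip w (mode p) = ip v (mode p)" for p
      by (rule ip_cong; simp add: assms(3))+
    thus ?thesis by (simp only: mode_residual_def)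
  qed
  thus ?thesis using assms by (simp add: mode_approx_def)
qed

lemma mode_approx_limit:
  assumes v: "L2_on_S2 v"
    and lim: "\<And>e. 0 < e \<Longrightarrow> \<exists>w. mode_approx w \<and> ip (\<lambda>x. v x - w x) (\<lambda>x. v x - w x) < e"
  shows "mode_approx v"
proof -
  have "(\<lambda>n. mode_residual n v) \<longlonglongrightarrow> 0"
  proof (rule LIMSEQ_I)
    fix r :: real assume "0 < r"
    \<comment> \<open>A quarter, because the residual of a sum is at most twice the sum of the residuals.\<close>
    then obtain w where w: "mode_approx w" and c: "ip (\<lambda>x. v x - w x) (\<lambda>x. v x - w x) < r / 4"
      using lim[of "r / 4"] by auto
    have L: "L2_on_S2 w" using w by (simp add: mode_approx_def)
    obtain N where N: "\<And>n. n \<ge> N \<Longrightarrow> norm (mode_residual n w - 0) < r / 4"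
      using w \<open>0 < r\<close> LIMSEQ_D[of "\<lambda>n. mode_residual n w" 0 "r / 4"] by (auto simp: mode_approx_def)
    have "norm (mode_residual n v - 0) < r" if "n \<ge> N" for n
    proof -
      have "mode_residual n v = mode_residual n (\<lambda>x. (v x - w x) + w x)" by simp
      also have "\<dots> \<le> 2 * mode_residual n (\<lambda>x. v x - w x) + 2 * mode_residual n w"
        by (rule mode_residual_add_le) (use v L in auto)
      also have "\<dots> < r" using N[OF that] c mode_residual_le[of n "\<lambda>x. v x - w x"] by simp
      finally show ?thesis using mode_residual_nonneg[OF v, of n] by simp
    qed
    thus "\<exists>N. \<forall>n\<ge>N. norm (mode_residual n v - 0) < r" by blast
  qed
  thus ?thesis using v by (simp add: mode_approx_def)
qed

text \<open>If \<open>f\<close> has degree at most \<open>n\<close>, then its field is a combination of modes of degree at most \<open>n\<close>. This is seen by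
  checking Parseval's identity: both sides equal \<open>\<Sum>\<^sub>i \<lambda>\<^sub>i (f, Y\<^sub>i)\<^sup>2\<close>, where the \<open>Y\<^sub>i\<close> are the harmonics.\<close>
lemma mode_approx_hodge_field:
  assumes f: "polyfn f" shows "mode_approx (hodge_field t f)"
proof -
  obtain N where N: "poly_upto N f" using f unfolding polyfn_def by blast
  have [simp]: "polyfn f" by fact
  have "mode_residual n (hodge_field t f) = 0" if n: "n \<ge> N" for n
  proof -
    have P: "poly_upto n f" using poly_upto_mono N n by blast
    have c: "(ip (hodge_field t f) (mode (s, i)))\<^sup>2 = (if s = t then eigval (level i) * (ip f (harmonic i))\<^sup>2 else 0)"
      if "i \<in> modes_upto n" for s i
    proof -
      have "ip (hodge_field t f) (mode (s, i)) = 1 / sqrt (eigval (level i)) * ip (hodge_field t f) (hodge_field s (harmonic i))"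
        unfolding mode_eq ip_scale_right ..
      thus ?thesis using that eigval_pos[of "level i"]
        by (simp add: ip_hodge_field ip_Lap_harmonic modes_upto_iff power_mult_distrib power_divide power2_eq_square[of "eigval _"])
    qed
    have "(\<Sum>p\<in>UNIV \<times> modes_upto n. (ip (hodge_field t f) (mode p))\<^sup>2)
       = (\<Sum>s\<in>UNIV. \<Sum>i\<in>modes_upto n. (ip (hodge_field t f) (mode (s, i)))\<^sup>2)"
      by (simp add: sum.cartesian_product)
    also have "\<dots> = (\<Sum>s\<in>UNIV. \<Sum>i\<in>modes_upto n. if s = t then eigval (level i) * (ip f (harmonic i))\<^sup>2 else 0)"
      by (intro sum.cong refl c)
    also have "\<dots> = (\<Sum>i\<in>modes_upto n. eigval (level i) * (ip f (harmonic i))\<^sup>2)"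
      by (cases t) (simp_all add: UNIV_bool)
    also have "\<dots> = (\<Sum>i\<in>basis_upto n. eigval (level i) * (ip f (harmonic i))\<^sup>2)"
      by (rule sum.mono_neutral_left[OF finite_basis_upto]) (auto simp: modes_upto_def basis_upto_def)
    also have "\<dots> = - (\<Sum>i\<in>basis_upto n. ip f (harmonic i) * ip (harmonic i) (Lap f))"
    proof -
      have "ip (harmonic i) (Lap f) = - eigval (level i) * ip f (harmonic i)" for i
      proof -
        have "ip (harmonic i) (Lap f) = ip (Lap (harmonic i)) f" by (simp add: ip_def integral_Lap_symmetric)
        thus ?thesis using ip_Lap_harmonic[of f i] by (simp add: ip_commute)
      qed
      thus ?thesis by (simp add: sum_negf[symmetric] power2_eq_square mult_ac)
    qed
    also have "\<dots> = - ip (\<lambda>x. \<Sum>i\<in>basis_upto n. ip f (harmonic i) * harmonic i x) (Lap f)"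
      by (subst ip_sum_left) (auto simp: ip_cmult_left)
    also have "\<dots> = - ip f (Lap f)"
      using ip_cong[of "\<lambda>x. \<Sum>i\<in>basis_upto n. ip f (harmonic i) * harmonic i x" f "Lap f" "Lap f"] harmonic_expansion[OF P] by simp
    also have "\<dots> = ip (hodge_field t f) (hodge_field t f)" by (simp add: ip_hodge_field)
    finally show ?thesis by (simp add: mode_residual_def)
  qed
  hence "(\<lambda>n. mode_residual n (hodge_field t f)) \<longlonglongrightarrow> 0"
    by (intro tendsto_eventually eventually_sequentiallyI[of N])
  thus ?thesis by (simp add: mode_approx_def)
qed

text \<open>An explicit Hodge decomposition. It holds for all polynomials and all points, and each component is a linear
  consequence of the commutation relations and of \<open>x \<bullet> L g = 0\<close> for \<open>g = L\<^sub>j f\<close>.\<close>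
lemma Lap_rotation_field:
  assumes [simp]: "polyfn f"
  shows "Lap f x *\<^sub>R cross3 x (axis k 1) = hodge_field False (ang k f) x - hodge_field True (\<lambda>y. hodge_field False f y $ k) x"
proof -
  have r: "x$1 * ang 1 (ang j f) x + x$2 * ang 2 (ang j f) x + x$3 * ang 3 (ang j f) x = 0" for j
    using ang_radial[of _ "ang j f" x] polyfn_ang[OF assms, of j] unfolding polyfn_def by blast
  note c = ang_commute_polyfn[OF assms, of x]
  have "(Lap f x *\<^sub>R cross3 x (axis k 1)) $ i = (hodge_field False (ang k f) x - hodge_field True (\<lambda>y. hodge_field False f y $ k) x) $ i" for i
    using exhaust_3[of k] exhaust_3[of i]
    by (elim disjE; insert r[of 1] r[of 2] r[of 3];
        simp add: hodge_field_def cross3_nth Lap_def sum_3 c algebra_simps)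
  thus ?thesis by (simp add: vec_eq_iff)
qed

text \<open>It suffices to take a harmonic for \<open>q\<close>. Those of positive degree are multiples of their own Laplacian, so the
  decomposition above applies; for a constant the field is a multiple of \<open>x \<times> \<nabla>x\<^sub>k\<close>.\<close>
lemma mode_approx_polynomial_rotation_field:
  assumes q: "polyfn q" shows "mode_approx (\<lambda>x. q x *\<^sub>R cross3 x (axis k 1))"
proof -
  have pv: "L2_on_S2 (\<lambda>x. g x *\<^sub>R cross3 x (axis k 1))" if "polyfn g" for g
    using that by (intro L2_continuous continuous_intros continuous_on_cross polyfn_continuous_on)
  have Y: "mode_approx (\<lambda>x. harmonic i x *\<^sub>R cross3 x (axis k 1))" for i
  proof (cases "level i = 0")
    case True
    then obtain c where c: "harmonic i = (\<lambda>x. c)" using poly_upto_0 poly_upto_harmonic_level[of i] by metis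
    have "cross3 x (axis k 1) = hodge_field True (\<lambda>y. y $ k) x" for x
      using exhaust_3[of k] by (auto simp: vec_eq_iff forall_3 hodge_field_def cross3_nth)
    thus ?thesis using mode_approx_scale[OF mode_approx_hodge_field[OF polyfn_coord[of k], of True], of c] by (simp add: c)
  next
    case False
    let ?e = "- 1 / eigval (level i)"
    have "mode_approx (\<lambda>x. ?e *\<^sub>R (hodge_field False (ang k (harmonic i)) x + (-1) *\<^sub>R hodge_field True (\<lambda>y. hodge_field False (harmonic i) y $ k) x))"
      using polyvec_hodge_field[of "harmonic i" False]
      by (intro mode_approx_scale mode_approx_add mode_approx_hodge_field) (auto simp: polyvec_def)
    note A = this
    have B: "harmonic i x *\<^sub>R cross3 x (axis k 1) = ?e *\<^sub>R (hodge_field False (ang k (harmonic i)) x + (-1) *\<^sub>R hodge_field True (\<lambda>y. hodge_field False (harmonic i) y $ k) x)"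
      if "x \<in> S2" for x
    proof -
      have "?e *\<^sub>R (hodge_field False (ang k (harmonic i)) x + (-1) *\<^sub>R hodge_field True (\<lambda>y. hodge_field False (harmonic i) y $ k) x)
        = ?e *\<^sub>R (Lap (harmonic i) x *\<^sub>R cross3 x (axis k 1))"
        using Lap_rotation_field[OF polyfn_harmonic, of i x k] by simp
      also have "\<dots> = harmonic i x *\<^sub>R cross3 x (axis k 1)"
        using False eigval_pos[of "level i"] by (simp add: Lap_harmonic[OF that])
      finally show ?thesis ..
    qed
    show ?thesis by (rule mode_approx_cong[OF A _ B]) (simp_all add: pv)
  qed
  obtain n where n: "poly_upto n q" using q unfolding polyfn_def by blast
  have "mode_approx (\<lambda>x. \<Sum>i\<in>basis_upto n. ip q (harmonic i) *\<^sub>R (harmonic i x *\<^sub>R cross3 x (axis k 1)))"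
    by (intro mode_approx_sum mode_approx_scale Y)
  thus ?thesis
    by (rule mode_approx_cong) (simp_all add: pv q harmonic_expansion[OF n] flip: scaleR_sum_left)
qed

lemma real_polynomial_function_imp_polyfn:
  fixes f :: "real^3 \<Rightarrow> real"
  shows "real_polynomial_function f \<Longrightarrow> polyfn f"
proof (induction rule: real_polynomial_function.induct)
  case (linear f)
  then interpret bounded_linear f .
  have "f = (\<lambda>x. f (axis 1 1) * x$1 + (f (axis 2 1) * x$2 + f (axis 3 1) * x$3))"
  proof
    fix x :: "real^3"
    have "x = x$1 *\<^sub>R axis 1 1 + (x$2 *\<^sub>R axis 2 1 + x$3 *\<^sub>R axis 3 1)"
      by (simp add: vec_eq_iff forall_3)
    hence "f x = f (x$1 *\<^sub>R axis 1 1 + (x$2 *\<^sub>R axis 2 1 + x$3 *\<^sub>R axis 3 1))" by simp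
    thus "f x = f (axis 1 1) * x$1 + (f (axis 2 1) * x$2 + f (axis 3 1) * x$3)"
      by (simp add: add scaleR mult.commute)
  qed
  moreover have "polyfn (\<lambda>x. f (axis 1 1) * x$1 + (f (axis 2 1) * x$2 + f (axis 3 1) * x$3))" by simp
  ultimately show ?case by simp
qed simp_all

text \<open>A tangent field satisfies \<open>w = x \<times> c\<close> with \<open>c = - x \<times> w\<close>. Approximating the components of \<open>c\<close> uniformly by polynomials
  gives polynomial multiples of the rotation fields \<open>x \<times> e\<^sub>k\<close> that approximate \<open>w\<close>.\<close>
lemma mode_approx_continuous:
  assumes w: "continuous_on S2 w" "tangent_field w"
  shows "mode_approx w"
proof (rule mode_approx_limit)
  show Lw: "L2_on_S2 w" using w by (intro L2_continuous)
  fix e :: real assume e: "0 < e"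
  \<comment> \<open>A pointwise error of \<open>3 d\<close> on a surface of area \<open>4 \<pi>\<close> amounts to \<open>36 \<pi> d\<^sup>2 = e / 2\<close> in the squared norm.\<close>
  define d where "d = sqrt (e / (72 * pi))"
  have d: "d > 0" using e by (simp add: d_def)
  define c where "c = (\<lambda>x. - cross3 x (w x))"
  have wc: "w x = (\<Sum>k\<in>UNIV. c x $ k *\<^sub>R cross3 x (axis k 1))" if "x \<in> S2" for x
  proof -
    have t: "w x \<bullet> x = 0" "x \<bullet> x = 1" using w(2) that by (auto simp: tangent_field_def dot_square_norm)
    have "(\<Sum>k\<in>UNIV. c x $ k *\<^sub>R cross3 x (axis k 1)) = cross3 x (c x)"
      by (simp add: sum_3 vec_eq_iff forall_3 cross3_nth)
    also have "\<dots> = w x"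
      using t Lagrange[of x x "w x"] by (simp add: c_def cross_minus_right inner_commute)
    finally show ?thesis ..
  qed
  have "\<exists>p. polyfn p \<and> (\<forall>x\<in>S2. \<bar>c x $ k - p x\<bar> < d)" for k
  proof -
    have "continuous_on S2 (\<lambda>x. c x $ k)" unfolding c_def
      by (intro continuous_intros continuous_on_cross w)
    from Stone_Weierstrass_real_polynomial_function[OF compact_sphere this d]
    obtain p where "real_polynomial_function p" "\<And>x. x \<in> S2 \<Longrightarrow> \<bar>c x $ k - p x\<bar> < d" by blast
    thus ?thesis using real_polynomial_function_imp_polyfn by blast
  qed
  then obtain p where p: "\<And>k. polyfn (p k)" "\<And>k x. x \<in> S2 \<Longrightarrow> \<bar>c x $ k - p k x\<bar> < d" by metis
  define v where "v = (\<lambda>x. \<Sum>k\<in>UNIV. p k x *\<^sub>R cross3 x (axis k 1))"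
  have v: "mode_approx v" unfolding v_def
    by (intro mode_approx_sum mode_approx_polynomial_rotation_field p)
  have cv: "continuous_on S2 (\<lambda>x. w x - v x)" unfolding v_def
    by (intro continuous_intros continuous_on_cross w polyfn_continuous_on p)
  have "norm (w x - v x) \<le> 3 * d" if x: "x \<in> S2" for x
  proof -
    have "w x - v x = (\<Sum>k\<in>UNIV. (c x $ k - p k x) *\<^sub>R cross3 x (axis k 1))"
      unfolding wc[OF x] v_def by (simp add: sum_subtractf scaleR_diff_left)
    also have "norm \<dots> \<le> (\<Sum>k\<in>(UNIV::3 set). d)"
    proof (rule sum_norm_le)
      fix k
      have "norm (cross3 x (axis k 1)) \<le> norm x * norm (axis k (1::real))"
      proof (rule power2_le_imp_le)
        show "(norm (cross3 x (axis k 1)))\<^sup>2 \<le> (norm x * norm (axis k (1::real)))\<^sup>2"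
          using norm_cross_dot[of x "axis k 1"] zero_le_power2[of "x \<bullet> axis k 1"] by linarith
      qed simp
      hence "norm (cross3 x (axis k 1)) \<le> 1" using x by simp
      thus "norm ((c x $ k - p k x) *\<^sub>R cross3 x (axis k 1)) \<le> d"
        using p(2)[OF x, of k] mult_mono[of "\<bar>c x $ k - p k x\<bar>" d "norm (cross3 x (axis k 1))" 1] d by simp
    qed
    finally show ?thesis by simp
  qed
  hence "(norm (w x - v x))\<^sup>2 \<le> (3 * d)\<^sup>2" if "x \<in> S2" for x
    using that by (intro power_mono) auto
  hence "ip (\<lambda>x. w x - v x) (\<lambda>x. w x - v x) \<le> (\<integral>x. (3 * d)\<^sup>2 \<partial>dS)"
    unfolding ip_def by (intro integral_mono integrable_dS_continuous continuous_intros cv)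
      (auto simp: dot_square_norm)
  also have "\<dots> = 36 * pi * d\<^sup>2" using measure_dS_S2 by (simp add: power_mult_distrib)
  also have "\<dots> = e / 2" using e by (simp add: d_def)
  also have "\<dots> < e" using e by simp
  finally show "\<exists>w'. mode_approx w' \<and> ip (\<lambda>x. w x - w' x) (\<lambda>x. w x - w' x) < e" using v by blast
qed

lemma mode_approx_H1T:
  assumes "u \<in> H1T" shows "mode_approx u"
proof -
  obtain G w where u: "u \<in> L2T" and w: "\<And>n. smooth_tangent_field (w n)"
    and lim: "(\<lambda>n. L2_norm (\<lambda>s. w n s - u s)) \<longlonglongrightarrow> 0"
    using assms by (auto simp: H1T_def has_cov_def)
  show ?thesis
  proof (rule mode_approx_limit)
    show "L2_on_S2 u" using u by (simp add: L2T_def)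
    fix e :: real assume "0 < e"
    hence "\<forall>\<^sub>F n in sequentially. L2_norm (\<lambda>s. w n s - u s) < sqrt e"
      using lim by (intro order_tendstoD) auto
    then obtain n where n: "L2_norm (\<lambda>s. w n s - u s) < sqrt e" by (auto simp: eventually_sequentially)
    have "continuous_on UNIV (w n)" using w[of n] C_k.simps(1) by (metis smooth_tangent_field_def)
    hence "mode_approx (w n)"
      using w[of n] continuous_on_subset by (intro mode_approx_continuous) (auto simp: smooth_tangent_field_def)
    moreover have "ip (\<lambda>x. u x - w n x) (\<lambda>x. u x - w n x) = (L2_norm (\<lambda>s. w n s - u s))\<^sup>2"
      unfolding ip_L2_norm L2_norm_def by (simp add: norm_minus_commute)
    moreover have "\<dots> < e"
      using n \<open>0 < e\<close> power_strict_mono[OF n, of 2] by (simp add: L2_norm_def)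
    ultimately show "\<exists>w. mode_approx w \<and> ip (\<lambda>x. u x - w x) (\<lambda>x. u x - w x) < e" by auto
  qed
qed

section \<open>Weak divergence and rotation of Sobolev fields\<close>

lemma C_k_Suc_imp: "C_k (Suc k) f \<Longrightarrow> C_k k f"
proof (induction k arbitrary: f)
  case 0
  then show ?case
    by (auto simp: differentiable_imp_continuous_within continuous_at_imp_continuous_on)
next
  case (Suc k)
  have "C_k k (\<lambda>x. frechet_derivative f (at x) v)" for v
    using Suc.prems Suc.IH C_k.simps(2) by blast
  then show ?case using Suc.prems by simp
qed

lemma has_derivative_cross3:
  assumes "(f has_derivative f') (at x)" "(g has_derivative g') (at x)"
  shows "((\<lambda>x. cross3 (f x) (g x)) has_derivative (\<lambda>v. cross3 (f x) (g' v) + cross3 (f' v) (g x))) (at x)"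
proof -
  interpret bounded_bilinear cross3 using bilinear_cross by (simp add: bilinear_conv_bounded_bilinear)
  show ?thesis by (rule FDERIV[OF assms])
qed

lemma C_k_add: "C_k k f \<Longrightarrow> C_k k g \<Longrightarrow> C_k k (\<lambda>x. f x + g x)"
proof (induction k arbitrary: f g)
  case 0
  then show ?case by (simp add: continuous_on_add)
next
  case (Suc k)
  have "frechet_derivative (\<lambda>x. f x + g x) (at x) = (\<lambda>v. frechet_derivative f (at x) v + frechet_derivative g (at x) v)" for x
    using Suc.prems by (intro frechet_derivative_at[symmetric] has_derivative_add)
      (auto simp: frechet_derivative_works[symmetric])
  then show ?case using Suc by auto
qed

lemma C_k_cross_const: "C_k k f \<Longrightarrow> C_k k (\<lambda>x. cross3 v (f x))"
proof (induction k arbitrary: f)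
  case 0
  then show ?case by (simp add: continuous_on_cross)
next
  case (Suc k)
  have d: "((\<lambda>x. cross3 v (f x)) has_derivative (\<lambda>h. cross3 v (frechet_derivative f (at x) h))) (at x)" for x
    using has_derivative_cross3[OF has_derivative_const[of v "at x"], of f "frechet_derivative f (at x)"] Suc.prems
    by (simp add: frechet_derivative_works[symmetric] cross_zero_left)
  have "frechet_derivative (\<lambda>x. cross3 v (f x)) (at x) = (\<lambda>h. cross3 v (frechet_derivative f (at x) h))" for x
    by (rule frechet_derivative_at[OF d, symmetric])
  then show ?case using Suc differentiableI[OF d] by auto
qed

text \<open>For the rotation of a field, which is defined through the divergence of the field turned by a right angle.\<close>
lemma C_k_cross_self: "C_k k f \<Longrightarrow> C_k k (\<lambda>x. cross3 x (f x))"
proof (induction k arbitrary: f)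
  case 0
  then show ?case by (simp add: continuous_on_cross)
next
  case (Suc k)
  have d: "((\<lambda>x. cross3 x (f x)) has_derivative (\<lambda>h. cross3 x (frechet_derivative f (at x) h) + cross3 h (f x))) (at x)" for x
    using has_derivative_cross3[OF has_derivative_ident, of f "frechet_derivative f (at x)"] Suc.prems
    by (simp add: frechet_derivative_works[symmetric])
  have "frechet_derivative (\<lambda>x. cross3 x (f x)) (at x) = (\<lambda>h. cross3 x (frechet_derivative f (at x) h) + cross3 h (f x))" for x
    by (rule frechet_derivative_at[OF d, symmetric])
  moreover have "C_k k (\<lambda>x. cross3 x (frechet_derivative f (at x) h) + cross3 h (f x))" for h
  proof -
    have "C_k k (\<lambda>x. frechet_derivative f (at x) h)" using Suc.prems by simp
    thus ?thesis by (intro C_k_add Suc.IH C_k_cross_const C_k_Suc_imp[OF Suc.prems])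
  qed
  ultimately show ?case using differentiableI[OF d] by simp
qed

lemma tan_proj_vector: "tan_proj x *v v = v - (x \<bullet> v) *\<^sub>R x"
  by (simp add: tan_proj_def matrix_vector_mult_def inner_vec_def vec_eq_iff forall_3 sum_3 mat_def algebra_simps)

lemma trace_tan_proj:
  assumes "x \<in> S2"
  shows "trace (tan_proj x ** J ** tan_proj x) = trace J - x \<bullet> (J *v x)"
proof -
  have xx: "x \<bullet> x = 1" using assms by (simp add: dot_square_norm)
  have "tan_proj x ** tan_proj x = tan_proj x"
    by (simp add: matrix_eq matrix_vector_mul_assoc[symmetric] tan_proj_vector inner_diff_right xx)
  hence "trace (tan_proj x ** J ** tan_proj x) = trace (tan_proj x ** J)"
    by (metis matrix_mul_assoc trace_mul_sym)
  also have "\<dots> = trace J - x \<bullet> (J *v x)"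
    by (simp add: trace_def tan_proj_def matrix_matrix_mult_def matrix_vector_mult_def inner_vec_def sum_3 mat_def algebra_simps)
  finally show ?thesis .
qed

lemma smooth_jacobian:
  assumes "C_k (Suc (Suc 0)) w"
  shows "(w has_derivative (\<lambda>v. jacobian w (at x) *v v)) (at x)"
    and "continuous_on A (\<lambda>x. jacobian w (at x))"
    and "continuous_on A w"
proof -
  show "(w has_derivative (\<lambda>v. jacobian w (at x) *v v)) (at x)"
    using assms by (simp add: jacobian_works[symmetric])
  have "C_k (Suc 0) (\<lambda>x. frechet_derivative w (at x) v)" for v
    using assms C_k.simps(2) by blast
  hence "continuous_on UNIV (\<lambda>x. frechet_derivative w (at x) v)" for v
    using C_k_Suc_imp C_k.simps(1) by blast
  hence "continuous_on A (\<lambda>x. frechet_derivative w (at x) v)" for v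
    using continuous_on_subset by blast
  thus "continuous_on A (\<lambda>x. jacobian w (at x))"
    unfolding jacobian_def matrix_def by (intro continuous_on_vec_lambda continuous_on_component)
  show "continuous_on A w"
    using continuous_on_subset[OF C_k_Suc_imp[OF C_k_Suc_imp[OF assms], unfolded C_k.simps] subset_UNIV] .
qed

text \<open>The divergence theorem on the sphere. With \<open>c = x \<times> w\<close>, the surface divergence of a tangent field \<open>w\<close> is
  \<open>\<Sum>\<^sub>a L\<^sub>a c\<^sub>a\<close>; the claim is the sum over \<open>a\<close> of the vanishing integrals of \<open>L\<^sub>a (\<phi> c\<^sub>a)\<close>.\<close>
lemma integral_divergence:
  assumes phi: "polyfn \<phi>"
    and w: "\<And>x. (w has_derivative (\<lambda>v. J x *v v)) (at x)"
    and J: "continuous_on UNIV J"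
    and tan: "tangent_field w"
  shows "(\<integral>x. (trace (J x) - x \<bullet> (J x *v x)) * \<phi> x \<partial>dS) = ip w (hodge_field False \<phi>)"
proof -
  obtain g where g: "\<And>x. (\<phi> has_derivative (\<lambda>v. g x \<bullet> v)) (at x)" "continuous_on UNIV g"
    using poly_upto_C1 phi unfolding polyfn_def by blast
  have cw: "continuous_on A w" for A
    by (intro continuous_at_imp_continuous_on ballI has_derivative_continuous[OF w])
  have cp: "continuous_on A \<phi>" for A using phi by (rule polyfn_continuous_on)
  have cg: "continuous_on A g" and cJ: "continuous_on A J" for A
    using g(2) J continuous_on_subset by blast+
  \<comment> \<open>\<open>F\<close> runs through the components of \<open>\<phi> (x \<times> w)\<close>, and \<open>G\<close> is its gradient.\<close>
  define F where "F = (\<lambda>p q x. \<phi> x * (x$p * w x $ q - x$q * w x $ p))"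
  define G where "G = (\<lambda>p q x. (x$p * w x $ q - x$q * w x $ p) *\<^sub>R g x
     + \<phi> x *\<^sub>R (w x $ q *\<^sub>R axis p 1 + x$p *\<^sub>R J x $ q - (w x $ p *\<^sub>R axis q 1 + x$q *\<^sub>R J x $ p)))"
  have Jv: "(J x *v v) $ i = J x $ i \<bullet> v" for x v i
    by (simp add: matrix_vector_mult_def inner_vec_def)
  have wi: "((\<lambda>x. w x $ i) has_derivative (\<lambda>v. J x $ i \<bullet> v)) (at x)" for i x
    using bounded_linear.has_derivative[OF bounded_linear_vec_nth w, of i] by (simp add: Jv)
  have ci: "((\<lambda>x. x $ i) has_derivative (\<lambda>v. v $ i)) (at x)" for i and x :: "real^3"
    by (rule bounded_linear_imp_has_derivative[OF bounded_linear_vec_nth])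
  have dF: "(F p q has_derivative (\<lambda>v. G p q x \<bullet> v)) (at x)" for p q x
    unfolding F_def
    by (rule has_derivative_eq_rhs[OF has_derivative_mult[OF g(1) has_derivative_diff[OF
          has_derivative_mult[OF ci wi] has_derivative_mult[OF ci wi]]]])
       (simp add: G_def inner_add_left inner_diff_left inner_axis' algebra_simps)
  have cG: "continuous_on A (G p q)" for p q A
    unfolding G_def by (intro continuous_intros cg cJ cp cw)
  note Z = integral_dS_rotation_derivative[OF _ dF cG]
  let ?h = "\<lambda>p q x. x$p * G p q x $ q - x$q * G p q x $ p"
  have hi: "integrable dS (?h p q)" for p q
    by (intro integrable_dS_continuous continuous_intros cG)
  have "0 = (\<integral>x. ?h 2 3 x \<partial>dS) + (\<integral>x. ?h 3 1 x \<partial>dS) + (\<integral>x. ?h 1 2 x \<partial>dS)"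
    using Z[of 2 3] Z[of 3 1] Z[of 1 2] by simp
  also have "\<dots> = (\<integral>x. ?h 2 3 x + ?h 3 1 x + ?h 1 2 x \<partial>dS)"
    by (simp add: hi)
  also have "\<dots> = (\<integral>x. (trace (J x) - x \<bullet> (J x *v x)) * \<phi> x - w x \<bullet> hodge_field False \<phi> x \<partial>dS)"
  proof (rule Bochner_Integration.integral_cong[OF refl])
    fix x assume "x \<in> space dS"
    hence s: "x$1 * x$1 + x$2 * x$2 + x$3 * x$3 = 1" and t: "w x $ 1 * x$1 + w x $ 2 * x$2 + w x $ 3 * x$3 = 0"
      using S2_sq[of x] tan by (auto simp: tangent_field_def inner_vec_def sum_3)
    show "?h 2 3 x + ?h 3 1 x + ?h 1 2 x = (trace (J x) - x \<bullet> (J x *v x)) * \<phi> x - w x \<bullet> hodge_field False \<phi> x"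
      unfolding hodge_field_def ang_vec_def ang_eq[OF g(1)] G_def
      by (simp add: trace_def matrix_vector_mult_def inner_vec_def sum_3 cross3_nth)
         (use s t in algebra)
  qed
  also have "\<dots> = (\<integral>x. (trace (J x) - x \<bullet> (J x *v x)) * \<phi> x \<partial>dS) - ip w (hodge_field False \<phi>)"
    unfolding ip_def
  proof (rule Bochner_Integration.integral_diff)
    show "integrable dS (\<lambda>x. (trace (J x) - x \<bullet> (J x *v x)) * \<phi> x)"
      unfolding trace_def matrix_vector_mult_def
      by (intro integrable_dS_continuous continuous_intros continuous_on_vec_lambda cJ cp)
    show "integrable dS (\<lambda>x. w x \<bullet> hodge_field False \<phi> x)"
      using phi by (intro integrable_inner_L2 L2_continuous cw polyvec_continuous_on polyvec_hodge_field)
  qed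
  finally show ?thesis by simp
qed

lemma trace_inner: "trace A = A \<bullet> mat 1" for A :: "real^3^3"
  by (simp add: trace_def inner_vec_def sum_3 mat_def)

lemma continuous_on_smooth_cov:
  assumes "C_k (Suc (Suc 0)) w" shows "continuous_on A (smooth_cov w)"
proof -
  note c = smooth_jacobian(2)[OF assms, of A]
  have p: "continuous_on A tan_proj"
    unfolding tan_proj_def by (intro continuous_intros continuous_on_vec_lambda)
  show ?thesis unfolding smooth_cov_def matrix_matrix_mult_def
    by (intro continuous_intros continuous_on_vec_lambda c p)
qed

lemma ip_tendsto:
  assumes "\<And>n. L2_on_S2 (f n)" "L2_on_S2 h" "L2_on_S2 g"
    and lim: "(\<lambda>n. L2_norm (\<lambda>s. f n s - h s)) \<longlonglongrightarrow> 0"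
  shows "(\<lambda>n. ip (f n) g) \<longlonglongrightarrow> ip h g"
proof -
  have "(\<lambda>n. L2_norm (\<lambda>s. f n s - h s) * L2_norm g) \<longlonglongrightarrow> 0"
    using tendsto_mult_left_zero[OF lim] .
  moreover have "\<bar>ip (f n) g - ip h g\<bar> \<le> L2_norm (\<lambda>s. f n s - h s) * L2_norm g" for n
    using ip_Cauchy_Schwarz[of "\<lambda>s. f n s - h s" g] assms by (simp add: ip_diff_left)
  ultimately have "(\<lambda>n. ip (f n) g - ip h g) \<longlonglongrightarrow> 0"
    by (intro Lim_null_comparison[of "\<lambda>n. ip (f n) g - ip h g" "\<lambda>n. L2_norm (\<lambda>s. f n s - h s) * L2_norm g"])
       (auto intro: always_eventually)
  thus ?thesis by (simp add: LIM_zero_iff)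
qed

text \<open>Both sides are continuous with respect to the approximation by smooth fields in the definition of the Sobolev
  derivative. The identity therefore holds for every \<open>G\<close> that this definition admits, in particular for the one
  selected by \<open>cov\<close>.\<close>
lemma has_cov_weak_divergence:
  assumes "has_cov u G" and phi: "polyfn \<phi>"
  shows "ip (\<lambda>s. trace (G s)) \<phi> = ip u (hodge_field False \<phi>)"
proof -
  obtain w where u: "u \<in> L2T" "L2_on_S2 G" and w: "\<And>n. smooth_tangent_field (w n)"
    and l1: "(\<lambda>n. L2_norm (\<lambda>s. w n s - u s)) \<longlonglongrightarrow> 0"
    and l2: "(\<lambda>n. L2_norm (\<lambda>s. smooth_cov (w n) s - G s)) \<longlonglongrightarrow> 0"
    using assms(1) by (auto simp: has_cov_def)
  have C2: "C_k (Suc (Suc 0)) (w n)" for n using w unfolding smooth_tangent_field_def by blast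
  have tr: "ip (\<lambda>s. trace (B s)) \<phi> = ip B (\<lambda>s. \<phi> s *\<^sub>R mat 1)" for B :: "real^3 \<Rightarrow> real^3^3"
    by (simp add: ip_def trace_inner mult.commute)
  have pm: "L2_on_S2 (\<lambda>s. \<phi> s *\<^sub>R (mat 1 :: real^3^3))"
    by (intro L2_continuous continuous_intros polyfn_continuous_on phi)
  have "ip (smooth_cov (w n)) (\<lambda>s. \<phi> s *\<^sub>R mat 1) = ip (w n) (hodge_field False \<phi>)" for n
  proof -
    have "ip (smooth_cov (w n)) (\<lambda>s. \<phi> s *\<^sub>R mat 1)
      = (\<integral>x. (trace (jacobian (w n) (at x)) - x \<bullet> (jacobian (w n) (at x) *v x)) * \<phi> x \<partial>dS)"
      unfolding tr[symmetric] ip_def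
      by (rule Bochner_Integration.integral_cong) (auto simp: smooth_cov_def trace_tan_proj)
    also have "\<dots> = ip (w n) (hodge_field False \<phi>)"
      using w by (intro integral_divergence phi smooth_jacobian C2) (auto simp: smooth_tangent_field_def)
    finally show ?thesis .
  qed
  moreover have "(\<lambda>n. ip (smooth_cov (w n)) (\<lambda>s. \<phi> s *\<^sub>R mat 1)) \<longlonglongrightarrow> ip G (\<lambda>s. \<phi> s *\<^sub>R mat 1)"
    by (rule ip_tendsto[OF _ u(2) pm l2]) (intro L2_continuous continuous_on_smooth_cov C2)
  moreover have "(\<lambda>n. ip (w n) (hodge_field False \<phi>)) \<longlonglongrightarrow> ip u (hodge_field False \<phi>)"
    using u phi by (intro ip_tendsto[OF L2_continuous[OF smooth_jacobian(3)[OF C2]] _ _ l1]) (auto simp: L2T_def)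
  ultimately show ?thesis using LIMSEQ_unique by (simp add: tr)
qed

definition cross_matrix :: "real^3 \<Rightarrow> real^3^3 \<Rightarrow> real^3^3" where
  "cross_matrix x A = (\<chi> i j. cross3 x (column j A) $ i)"

lemma cross_matrix_vector: "cross_matrix x A *v v = cross3 x (A *v v)"
  by (simp add: cross_matrix_def matrix_vector_mult_def column_def vec_eq_iff forall_3 sum_3 cross3_nth algebra_simps)

lemma cross_matrix_diff: "cross_matrix x (A - B) = cross_matrix x A - cross_matrix x B"
  by (simp add: cross_matrix_def column_def vec_eq_iff forall_3 cross3_nth algebra_simps)

lemma norm_cross_le: "x \<in> S2 \<Longrightarrow> norm (cross3 x c) \<le> norm c"
proof (rule power2_le_imp_le)
  assume "x \<in> S2"
  hence "(norm (cross3 x c))\<^sup>2 + (x \<bullet> c)\<^sup>2 = (norm c)\<^sup>2" using norm_cross_dot[of x c] by simp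
  thus "(norm (cross3 x c))\<^sup>2 \<le> (norm c)\<^sup>2" using zero_le_power2[of "x \<bullet> c"] by linarith
qed simp

lemma norm_cross_matrix_le:
  assumes "x \<in> S2" shows "norm (cross_matrix x A) \<le> norm A"
proof (rule power2_le_imp_le)
  have nrm: "(norm B)\<^sup>2 = (\<Sum>j\<in>UNIV. (norm (column j B))\<^sup>2)" for B :: "real^3^3"
    by (simp add: power2_norm_eq_inner inner_vec_def sum_3 column_def)
  have "column j (cross_matrix x A) = cross3 x (column j A)" for j
    by (simp add: column_def cross_matrix_def vec_eq_iff)
  moreover have "(norm (cross3 x c))\<^sup>2 \<le> (norm c)\<^sup>2" for c
    using norm_cross_le[OF assms] by (intro power_mono) auto
  ultimately show "(norm (cross_matrix x A))\<^sup>2 \<le> (norm A)\<^sup>2"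
    unfolding nrm by (auto intro: sum_mono)
qed simp

text \<open>The right-angle rotation of the tangent planes is parallel: differentiating the factor \<open>x\<close> in \<open>x \<times> w\<close> gives
  \<open>v \<times> w\<close>, which is normal to the sphere for tangent \<open>v\<close> and \<open>w\<close>.\<close>
lemma smooth_cov_cross:
  assumes "smooth_tangent_field w" "x \<in> S2"
  shows "smooth_cov (\<lambda>y. cross3 y (w y)) x = cross_matrix x (smooth_cov w x)"
proof -
  have C2: "C_k (Suc (Suc 0)) w" using assms unfolding smooth_tangent_field_def by blast
  have xx: "x \<bullet> x = 1" using assms(2) by (simp add: dot_square_norm)
  have xw: "x \<bullet> w x = 0" using assms by (simp add: smooth_tangent_field_def tangent_field_def inner_commute)
  let ?J = "jacobian w (at x)"
  have d: "((\<lambda>y. cross3 y (w y)) has_derivative (\<lambda>v. cross3 x (?J *v v) + cross3 v (w x))) (at x)"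
    by (rule has_derivative_cross3[OF has_derivative_ident smooth_jacobian(1)[OF C2]])
  have J: "jacobian (\<lambda>y. cross3 y (w y)) (at x) *v v = cross3 x (?J *v v) + cross3 v (w x)" for v
    using fun_cong[OF has_derivative_unique[OF jacobian_works[THEN iffD1, OF differentiableI[OF d]] d]] .
  have z: "cross3 a (w x) = (x \<bullet> cross3 a (w x)) *\<^sub>R x" if "x \<bullet> a = 0" for a
    using Lagrange[of x x "cross3 a (w x)"] Lagrange[of x a "w x"] that xx xw by simp
  have "smooth_cov (\<lambda>y. cross3 y (w y)) x *v v = cross_matrix x (smooth_cov w x) *v v" for v
  proof -
    let ?t = "v - (x \<bullet> v) *\<^sub>R x"
    have t0: "x \<bullet> ?t = 0" by (simp add: inner_diff_right xx)
    have "smooth_cov (\<lambda>y. cross3 y (w y)) x *v v = tan_proj x *v (cross3 x (?J *v ?t) + cross3 ?t (w x))"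
      by (simp add: smooth_cov_def matrix_vector_mul_assoc[symmetric] tan_proj_vector J)
    also have "\<dots> = cross3 x (?J *v ?t)"
      using z[OF t0] by (simp add: tan_proj_vector inner_add_right dot_cross_self algebra_simps)
    also have "\<dots> = cross3 x (tan_proj x *v (?J *v ?t))"
      by (simp add: tan_proj_vector cross_minus_right[symmetric] right_diff_distrib[symmetric] cross_basis)
        (simp add: vec_eq_iff forall_3 cross3_nth algebra_simps)
    also have "\<dots> = cross_matrix x (smooth_cov w x) *v v"
      by (simp add: cross_matrix_vector smooth_cov_def matrix_vector_mul_assoc[symmetric] tan_proj_vector)
    finally show ?thesis .
  qed
  thus ?thesis by (simp add: matrix_eq)
qed

lemma L2_dominated:
  fixes f :: "real^3 \<Rightarrow> 'a::euclidean_space" and g :: "real^3 \<Rightarrow> 'b::euclidean_space"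
  assumes "f \<in> borel_measurable dS" "L2_on_S2 g" "\<And>s. s \<in> S2 \<Longrightarrow> norm (f s) \<le> C * norm (g s)"
  shows "L2_on_S2 f"
proof -
  have "integrable dS (\<lambda>s. C\<^sup>2 * (norm (g s))\<^sup>2)" using assms(2) by (simp add: L2_on_S2_def)
  moreover have "(\<lambda>s. (norm (f s))\<^sup>2) \<in> borel_measurable dS" using assms(1) by measurable
  moreover have "AE s in dS. norm ((norm (f s))\<^sup>2) \<le> norm (C\<^sup>2 * (norm (g s))\<^sup>2)"
  proof (rule AE_I2)
    fix s assume "s \<in> space dS"
    hence "(norm (f s))\<^sup>2 \<le> (C * norm (g s))\<^sup>2" by (intro power_mono assms(3)) auto
    thus "norm ((norm (f s))\<^sup>2) \<le> norm (C\<^sup>2 * (norm (g s))\<^sup>2)" by (simp add: power_mult_distrib)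
  qed
  ultimately have "integrable dS (\<lambda>s. (norm (f s))\<^sup>2)" by (rule Bochner_Integration.integrable_bound)
  thus ?thesis using assms(1) by (simp add: L2_on_S2_def)
qed

lemma L2_norm_mono:
  fixes f :: "real^3 \<Rightarrow> 'a::euclidean_space" and g :: "real^3 \<Rightarrow> 'b::euclidean_space"
  assumes "L2_on_S2 f" "L2_on_S2 g" "\<And>s. s \<in> S2 \<Longrightarrow> norm (f s) \<le> norm (g s)"
  shows "L2_norm f \<le> L2_norm g"
  unfolding L2_norm_def using assms
  by (intro real_sqrt_le_mono integral_mono power_mono) (auto simp: L2_on_S2_def)

lemma measurable_cross:
  assumes "u \<in> borel_measurable dS" shows "(\<lambda>s. cross3 s (u s)) \<in> borel_measurable dS"
proof (rule borel_measurable_continuous_Pair[where f="\<lambda>x. x" and H=cross3, OF _ assms])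
  show "(\<lambda>x. x) \<in> borel_measurable dS" by (rule borel_measurable_dS_continuous) (rule continuous_on_id)
  show "continuous_on UNIV (\<lambda>x. cross3 (fst x) (snd x))" by (intro continuous_on_cross continuous_intros)
qed

lemma measurable_cross_matrix:
  assumes "G \<in> borel_measurable dS" shows "(\<lambda>s. cross_matrix s (G s)) \<in> borel_measurable dS"
proof (rule borel_measurable_continuous_Pair[where f="\<lambda>x. x" and H=cross_matrix, OF _ assms])
  show "(\<lambda>x. x) \<in> borel_measurable dS" by (rule borel_measurable_dS_continuous) (rule continuous_on_id)
  show "continuous_on UNIV (\<lambda>x. cross_matrix (fst x) (snd x))" unfolding cross_matrix_def column_def
    by (intro continuous_intros continuous_on_vec_lambda continuous_on_cross)
qed

lemma has_cov_cross:
  assumes "has_cov u G"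
  shows "has_cov (\<lambda>s. cross3 s (u s)) (\<lambda>s. cross_matrix s (G s))"
proof -
  obtain w where u: "u \<in> L2T" "L2_on_S2 G" and w: "\<And>n. smooth_tangent_field (w n)"
    and l1: "(\<lambda>n. L2_norm (\<lambda>s. w n s - u s)) \<longlonglongrightarrow> 0"
    and l2: "(\<lambda>n. L2_norm (\<lambda>s. smooth_cov (w n) s - G s)) \<longlonglongrightarrow> 0"
    using assms(1) by (auto simp: has_cov_def)
  have C2: "C_k (Suc (Suc 0)) (w n)" for n using w unfolding smooth_tangent_field_def by blast
  have Lcross: "L2_on_S2 (\<lambda>s. cross3 s (v s))" if "L2_on_S2 v" for v
    by (rule L2_dominated[OF measurable_cross that, where C=1]) (use that in \<open>simp_all add: L2_on_S2_def norm_cross_le del: mem_sphere_0\<close>)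
  have Lmat: "L2_on_S2 (\<lambda>s. cross_matrix s (H s))" if "L2_on_S2 H" for H
    by (rule L2_dominated[OF measurable_cross_matrix that, where C=1]) (use that in \<open>simp_all add: L2_on_S2_def norm_cross_matrix_le del: mem_sphere_0\<close>)
  have Lu: "L2_on_S2 u" using u by (simp add: L2T_def)
  have Lw: "L2_on_S2 (w n)" for n by (intro L2_continuous smooth_jacobian(3) C2)
  have Lc: "L2_on_S2 (smooth_cov (w n))" for n by (intro L2_continuous continuous_on_smooth_cov C2)
  have s: "smooth_tangent_field (\<lambda>s. cross3 s (w n s))" for n
    using w[of n] by (auto simp: smooth_tangent_field_def tangent_field_def dot_cross_self intro: C_k_cross_self)
  have 1: "L2_norm (\<lambda>s. cross3 s (w n s) - cross3 s (u s)) \<le> L2_norm (\<lambda>s. w n s - u s)" for n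
  proof (rule L2_norm_mono)
    fix s :: "real^3" assume "s \<in> S2"
    thus "norm (cross3 s (w n s) - cross3 s (u s)) \<le> norm (w n s - u s)"
      using norm_cross_le[of s "w n s - u s"] by (simp add: right_diff_distrib cross_minus_right cross_add_right diff_conv_add_uminus del: add_uminus_conv_diff)
  qed (simp_all add: Lcross Lu Lw)
  have eq: "smooth_cov (\<lambda>s. cross3 s (w n s)) s = cross_matrix s (smooth_cov (w n) s)" if "s \<in> S2" for n s
    by (rule smooth_cov_cross[OF w that])
  have 2: "L2_norm (\<lambda>s. smooth_cov (\<lambda>s. cross3 s (w n s)) s - cross_matrix s (G s)) \<le> L2_norm (\<lambda>s. smooth_cov (w n) s - G s)" for n
  proof (rule L2_norm_mono)
    show "L2_on_S2 (\<lambda>s. smooth_cov (\<lambda>s. cross3 s (w n s)) s - cross_matrix s (G s))"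
      using s[of n] by (intro L2_diff Lmat u L2_continuous continuous_on_smooth_cov) (auto simp: smooth_tangent_field_def simp del: C_k.simps)
    fix x :: "real^3" assume x: "x \<in> S2"
    thus "norm (smooth_cov (\<lambda>s. cross3 s (w n s)) x - cross_matrix x (G x)) \<le> norm (smooth_cov (w n) x - G x)"
      using norm_cross_matrix_le[OF x, of "smooth_cov (w n) x - G x"] by (simp add: eq cross_matrix_diff)
  qed (simp add: Lc u)
  have pos: "0 \<le> L2_norm f" for f :: "real^3 \<Rightarrow> 'b::euclidean_space" by (simp add: L2_norm_def)
  show ?thesis unfolding has_cov_def
  proof (intro conjI exI[of _ "\<lambda>n s. cross3 s (w n s)"] allI s)
    show "(\<lambda>s. cross3 s (u s)) \<in> L2T" by (simp add: L2T_def Lcross Lu tangent_field_def dot_cross_self)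
    show "L2_on_S2 (\<lambda>s. cross_matrix s (G s))" by (rule Lmat[OF u(2)])
    show "(\<lambda>n. L2_norm (\<lambda>s. cross3 s (w n s) - cross3 s (u s))) \<longlonglongrightarrow> 0"
      by (rule tendsto_sandwich[OF _ _ tendsto_const l1]) (auto intro!: always_eventually pos 1)
    show "(\<lambda>n. L2_norm (\<lambda>s. smooth_cov (\<lambda>s. cross3 s (w n s)) s - cross_matrix s (G s))) \<longlonglongrightarrow> 0"
      by (rule tendsto_sandwich[OF _ _ tendsto_const l2]) (auto intro!: always_eventually pos 2)
  qed
qed

lemma has_cov_cov: "u \<in> H1T \<Longrightarrow> has_cov u (cov u)"
  using someI_ex[of "has_cov u"] by (simp add: cov_def H1T_def)

lemma cross_in_H1T: "u \<in> H1T \<Longrightarrow> (\<lambda>s. cross3 s (u s)) \<in> H1T"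
  using has_cov_cross by (auto simp: H1T_def)

lemma L2_div:
  assumes "u \<in> H1T" shows "L2_on_S2 (div_S2 u)"
proof (rule L2_dominated[where g="cov u" and C="norm (mat 1 :: real^3^3)"])
  have L: "L2_on_S2 (cov u)" using has_cov_cov[OF assms] by (simp add: has_cov_def)
  thus "L2_on_S2 (cov u)" .
  show "div_S2 u \<in> borel_measurable dS"
    using L unfolding div_S2_def[abs_def] trace_inner
    by (intro borel_measurable_inner) (simp_all add: L2_on_S2_def)
  show "norm (div_S2 u s) \<le> norm (mat 1 :: real^3^3) * norm (cov u s)" for s
    unfolding div_S2_def trace_inner real_norm_def mult.commute[of "norm (mat 1)"] by (rule Cauchy_Schwarz_ineq2)
qed

lemma weak_divergence:
  assumes "u \<in> H1T" "polyfn \<phi>" shows "ip (div_S2 u) \<phi> = ip u (hodge_field False \<phi>)"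
  using has_cov_weak_divergence[OF has_cov_cov[OF assms(1)] assms(2)] by (simp add: div_S2_def[abs_def])

lemma L2_rot:
  assumes "u \<in> H1T" shows "L2_on_S2 (rot_S2 u)"
  using L2_scaleR[OF L2_div[OF cross_in_H1T[OF assms]], of "-1"] by (simp add: rot_S2_def[abs_def])

lemma weak_rotation:
  assumes u: "u \<in> H1T" and phi: "polyfn \<phi>" shows "ip (rot_S2 u) \<phi> = - ip u (hodge_field True \<phi>)"
proof -
  have "ip (rot_S2 u) \<phi> = - ip (div_S2 (\<lambda>s. cross3 s (u s))) \<phi>"
    by (simp add: ip_def rot_S2_def)
  also have "ip (div_S2 (\<lambda>s. cross3 s (u s))) \<phi> = ip (\<lambda>s. cross3 s (u s)) (hodge_field False \<phi>)"
    by (rule weak_divergence[OF cross_in_H1T[OF u] phi])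
  also have "\<dots> = ip u (hodge_field True \<phi>)"
    unfolding ip_def
  proof (rule Bochner_Integration.integral_cong[OF refl])
    fix x assume "x \<in> space dS"
    hence "x \<bullet> x = 1" by (simp add: dot_square_norm)
    thus "cross3 x (u x) \<bullet> hodge_field False \<phi> x = u x \<bullet> hodge_field True \<phi> x"
      using ang_vec_radial[OF phi, of x] by (simp add: hodge_field_def dot_cross)
  qed
  finally show ?thesis .
qed

section \<open>The Lieb-Thirring inequality\<close>

text \<open>The derivative of \<open>H\<close> is \<open>2 t (a - t)\<^sup>2\<close>, and \<open>(a - t)\<^sup>2\<close> is decreasing for \<open>t \<le> a\<close>.\<close>
lemma layer_cake_step:
  fixes a s s' :: real
  defines "H \<equiv> \<lambda>t. a\<^sup>2 * t\<^sup>2 - 4 / 3 * a * t ^ 3 + t ^ 4 / 2"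
  assumes "0 \<le> s" "s \<le> s'"
  shows "H (min s' a) - H (min s a) \<le> (s'\<^sup>2 - s\<^sup>2) * (max 0 (a - s))\<^sup>2"
proof (cases "s < a")
  case False
  then show ?thesis using assms by simp
next
  case True
  define d where "d = min s' a - s"
  define b where "b = a - s"
  have d: "0 \<le> d" "d \<le> b" "s + d \<le> s'" using True assms by (auto simp: d_def b_def)
  have m: "min s' a = s + d" "min s a = s" "a = s + b" using True by (auto simp: d_def b_def)
  have "((s + d)\<^sup>2 - s\<^sup>2) * b\<^sup>2 - (H (s + d) - H s) = 2 * s * d\<^sup>2 * (b - d / 3) + 2 * d ^ 3 * (2 / 3 * b - d / 4)"
    unfolding H_def m(3) by (simp add: power2_eq_square power3_eq_cube power4_eq_xxxx field_simps)
  moreover have "0 \<le> 2 * s * d\<^sup>2 * (b - d / 3) + 2 * d ^ 3 * (2 / 3 * b - d / 4)"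
    using d assms by (intro add_nonneg_nonneg mult_nonneg_nonneg) auto
  ultimately have "H (s + d) - H s \<le> ((s + d)\<^sup>2 - s\<^sup>2) * b\<^sup>2" by simp
  also have "\<dots> \<le> (s'\<^sup>2 - s\<^sup>2) * b\<^sup>2"
  proof (rule mult_right_mono)
    have "(s + d)\<^sup>2 \<le> s'\<^sup>2" by (rule power_mono) (use d assms(2) in auto)
    thus "(s + d)\<^sup>2 - s\<^sup>2 \<le> s'\<^sup>2 - s\<^sup>2" by simp
  qed simp
  moreover have "max 0 (a - s) = b" using True by (simp add: b_def)
  ultimately show ?thesis by (simp only: m(1,2))
qed

text \<open>A Riemann sum from above for the integral of \<open>(sqrt \<rho> - sqrt (c E))\<^sup>2\<close> over \<open>0 \<le> E \<le> \<rho> / c\<close>. In the variable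
  \<open>t = sqrt (c E)\<close> the antiderivative is \<open>H / c\<close>, and the increments of \<open>H\<close> telescope.\<close>
lemma layer_cake_bound:
  fixes c \<rho> :: real
  assumes c: "0 < c" and \<rho>: "0 \<le> \<rho>" and K: "\<rho> \<le> c * eigval K"
  shows "\<rho>\<^sup>2 / (6 * c) \<le> (\<Sum>n<K. (eigval (Suc n) - eigval n) * (max 0 (sqrt \<rho> - sqrt (c * eigval n)))\<^sup>2)"
proof -
  define a where "a = sqrt \<rho>"
  define s where "s = (\<lambda>n. sqrt (c * eigval n))"
  define H where "H = (\<lambda>t. a\<^sup>2 * t\<^sup>2 - 4 / 3 * a * t ^ 3 + t ^ 4 / 2)"
  have s2: "(s n)\<^sup>2 = c * eigval n" for n using c by (simp add: s_def)
  have "H (min (s (Suc n)) a) - H (min (s n) a) \<le> c * ((eigval (Suc n) - eigval n) * (max 0 (a - s n))\<^sup>2)" for n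
    using layer_cake_step[of "s n" "s (Suc n)" a] c eigval_mono[of n "Suc n"]
    by (simp add: s2 H_def) (simp add: s_def algebra_simps)
  hence "(\<Sum>n<K. H (min (s (Suc n)) a) - H (min (s n) a)) \<le> (\<Sum>n<K. c * ((eigval (Suc n) - eigval n) * (max 0 (a - s n))\<^sup>2))"
    by (rule sum_mono)
  also have "(\<Sum>n<K. H (min (s (Suc n)) a) - H (min (s n) a)) = H (min (s K) a) - H (min (s 0) a)"
    by (rule sum_lessThan_telescope)
  also have "min (s K) a = a" using K by (simp add: s_def a_def)
  also have "min (s 0) a = 0" using \<rho> by (simp add: s_def a_def)
  also have "H a - H 0 = \<rho>\<^sup>2 / 6"
  proof -
    have "a ^ 4 = \<rho>\<^sup>2" using \<rho> by (simp add: a_def power4_eq_xxxx power2_eq_square)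
    thus ?thesis by (simp add: H_def power2_eq_square power3_eq_cube power4_eq_xxxx)
  qed
  finally have "\<rho>\<^sup>2 / 6 \<le> c * (\<Sum>n<K. (eigval (Suc n) - eigval n) * (max 0 (a - s n))\<^sup>2)"
    by (simp add: sum_distrib_left)
  thus ?thesis using c by (simp add: a_def s_def field_simps)
qed

text \<open>Each component of the projection of \<open>u\<^sub>j\<close> at the point \<open>s\<close> is the inner product of \<open>u\<^sub>j\<close> with one fixed field \<open>F\<^sub>k\<close>.
  Bessel's inequality for the orthonormal family \<open>u\<close> bounds the sum over \<open>j\<close> by the squared norm of \<open>F\<^sub>k\<close>.\<close>
lemma sum_norm_L2_proj_le:
  fixes u :: "'j \<Rightarrow> real^3 \<Rightarrow> real^3"
  assumes u: "orthonormal_on u I" and e: "orthonormal_on e A"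
  shows "(\<Sum>j\<in>I. (norm (L2_proj e A (u j) s))\<^sup>2) \<le> (\<Sum>p\<in>A. (norm (e p s))\<^sup>2)"
proof -
  have Le: "\<And>p. p \<in> A \<Longrightarrow> L2_on_S2 (e p)" and Lu: "\<And>j. j \<in> I \<Longrightarrow> L2_on_S2 (u j)"
    using u e by (auto simp: orthonormal_on_def)
  \<comment> \<open>The \<open>k\<close>-th row of the kernel of the projection, as a function of its second argument.\<close>
  define F where "F = (\<lambda>k x. \<Sum>p\<in>A. (e p s $ k) *\<^sub>R e p x)"
  have LF: "L2_on_S2 (F k)" for k unfolding F_def by (simp add: Le)
  have pk: "L2_proj e A (u j) s $ k = ip (u j) (F k)" if "j \<in> I" for j k
  proof -
    have "ip (u j) (F k) = (\<Sum>p\<in>A. (e p s $ k) * ip (e p) (u j))"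
      unfolding F_def by (subst ip_commute, subst ip_sum_left) (auto simp: Le Lu that ip_scale_left)
    thus ?thesis by (simp add: L2_proj_def ip_commute[of "u j"] mult.commute)
  qed
  have n: "(norm v)\<^sup>2 = (\<Sum>k\<in>UNIV. (v $ k)\<^sup>2)" for v :: "real^3"
    unfolding power2_norm_eq_inner inner_vec_def by (simp add: power2_eq_square)
  have "(\<Sum>j\<in>I. (norm (L2_proj e A (u j) s))\<^sup>2) = (\<Sum>j\<in>I. \<Sum>k\<in>UNIV. (ip (F k) (u j))\<^sup>2)"
    by (intro sum.cong refl) (simp add: n pk ip_commute[of "u _"])
  also have "\<dots> = (\<Sum>k\<in>UNIV. \<Sum>j\<in>I. (ip (F k) (u j))\<^sup>2)" by (rule sum.swap)
  also have "\<dots> \<le> (\<Sum>k\<in>UNIV. ip (F k) (F k))"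
    by (intro sum_mono bessel[OF u] LF)
  also have "\<dots> = (\<Sum>k\<in>UNIV. \<Sum>p\<in>A. (e p s $ k)\<^sup>2)"
    unfolding F_def ip_lincomb[OF e] by (simp add: power2_eq_square)
  also have "\<dots> = (\<Sum>p\<in>A. (norm (e p s))\<^sup>2)"
    unfolding n by (rule sum.swap)
  finally show ?thesis .
qed

definition energy :: "(real^3 \<Rightarrow> real^3) \<Rightarrow> real" where
  "energy u = (L2_norm (rot_S2 u))\<^sup>2 + (L2_norm (div_S2 u))\<^sup>2"

text \<open>By the weak formulas, \<open>sqrt \<lambda>\<close> times a mode coefficient of \<open>u\<close> is, up to sign, the coefficient of the rotation or the
  divergence of \<open>u\<close> at the corresponding harmonic. Apply Bessel's inequality to both functions.\<close>
lemma sum_eigval_mode_le_energy: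
  assumes u: "u \<in> H1T"
  shows "(\<Sum>p\<in>UNIV \<times> modes_upto n. eigval (level (snd p)) * (ip u (mode p))\<^sup>2) \<le> energy u"
proof -
  have c: "eigval (level i) * (ip u (mode (t, i)))\<^sup>2 = (ip u (hodge_field t (harmonic i)))\<^sup>2" if "i \<in> modes_upto n" for t i
    using that eigval_pos[of "level i"] by (simp add: mode_eq ip_scale_right modes_upto_iff power_mult_distrib power_divide)
  have b: "(\<Sum>i\<in>modes_upto n. (ip f (harmonic i))\<^sup>2) \<le> (L2_norm f)\<^sup>2" if "L2_on_S2 f" for f
  proof -
    have "(\<Sum>i\<in>modes_upto n. (ip f (harmonic i))\<^sup>2) \<le> (\<Sum>i\<in>basis_upto n. (ip f (harmonic i))\<^sup>2)"
      by (rule sum_mono2[OF finite_basis_upto]) (auto simp: modes_upto_def)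
    also have "\<dots> \<le> ip f f" by (rule bessel[OF orthonormal_on_harmonic that])
    finally show ?thesis by (simp add: ip_L2_norm)
  qed
  have "(\<Sum>p\<in>UNIV \<times> modes_upto n. eigval (level (snd p)) * (ip u (mode p))\<^sup>2) = (\<Sum>t\<in>UNIV. \<Sum>i\<in>modes_upto n. eigval (level i) * (ip u (mode (t, i)))\<^sup>2)"
    by (simp add: sum.cartesian_product split_def)
  also have "\<dots> = (\<Sum>t\<in>UNIV. \<Sum>i\<in>modes_upto n. (ip u (hodge_field t (harmonic i)))\<^sup>2)"
    by (intro sum.cong refl c)
  also have "\<dots> = (\<Sum>i\<in>modes_upto n. (ip (rot_S2 u) (harmonic i))\<^sup>2) + (\<Sum>i\<in>modes_upto n. (ip (div_S2 u) (harmonic i))\<^sup>2)"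
    by (simp add: UNIV_bool weak_divergence[OF u] weak_rotation[OF u])
  also have "\<dots> \<le> energy u"
    unfolding energy_def by (intro add_mono b L2_rot L2_div u)
  finally show ?thesis .
qed

text \<open>Summation by parts: a mode of degree \<open>l\<close> contributes to the residuals with \<open>n < l\<close>, and the weights with \<open>n < l\<close>
  add up to at most \<open>\<lambda>\<^sub>l\<close>. For finite sums there remains a multiple of the residual at a large degree \<open>N\<close>, which tends to
  zero because the modes are complete.\<close>
lemma sum_mode_residual_le_energy:
  assumes u: "u \<in> H1T"
  shows "(\<Sum>n<K. (eigval (Suc n) - eigval n) * mode_residual n u) \<le> energy u"
proof -
  have lim: "(\<lambda>N. eigval K * mode_residual N u + energy u) \<longlonglongrightarrow> eigval K * 0 + energy u"
    using mode_approx_H1T[OF u] unfolding mode_approx_def by (intro tendsto_intros) auto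
  have "(\<Sum>n<K. (eigval (Suc n) - eigval n) * mode_residual n u) \<le> eigval K * mode_residual N u + energy u" if N: "N \<ge> K" for N
  proof -
    let ?c = "\<lambda>p. (ip u (mode p))\<^sup>2"
    let ?A = "(UNIV :: bool set) \<times> modes_upto N"
    have r: "mode_residual n u = mode_residual N u + (\<Sum>p\<in>?A. if n < level (snd p) then ?c p else 0)" if n: "n < K" for n
    proof -
      have modes: "modes_upto n = {i \<in> modes_upto N. \<not> n < level i}" using n N by (auto simp: modes_upto_def basis_upto_def)
      have f: "finite ?A" by (simp add: finite_cartesian_product)
      have "(\<Sum>p\<in>UNIV \<times> modes_upto n. ?c p) = (\<Sum>p\<in>?A. if n < level (snd p) then 0 else ?c p)"
        by (rule sum.mono_neutral_cong_left[OF f]) (auto simp: modes)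
      moreover have "(\<Sum>p\<in>?A. ?c p) = (\<Sum>p\<in>?A. if n < level (snd p) then 0 else ?c p) + (\<Sum>p\<in>?A. if n < level (snd p) then ?c p else 0)"
        by (simp add: sum.distrib[symmetric] cong: sum.cong if_cong) (intro sum.cong refl, auto)
      ultimately show ?thesis by (simp add: mode_residual_def)
    qed
    have tele: "(\<Sum>n<K. if n < l then eigval (Suc n) - eigval n else 0) \<le> eigval l" for l
    proof -
      have "(\<Sum>n<K. if n < l then eigval (Suc n) - eigval n else 0) = (\<Sum>n<min K l. eigval (Suc n) - eigval n)"
        by (rule sum.mono_neutral_cong_right) auto
      also have "\<dots> = eigval (min K l)" by (subst sum_lessThan_telescope) simp
      finally show ?thesis by (simp add: eigval_mono)
    qed
    have "(\<Sum>n<K. (eigval (Suc n) - eigval n) * mode_residual n u)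
      = (\<Sum>n<K. (eigval (Suc n) - eigval n) * mode_residual N u + (\<Sum>p\<in>?A. ?c p * (if n < level (snd p) then eigval (Suc n) - eigval n else 0)))"
      by (intro sum.cong refl) (simp add: r distrib_left sum_distrib_left if_distrib[of "\<lambda>z. _ * z"] mult.commute cong: if_cong)
    also have "\<dots> = (\<Sum>n<K. eigval (Suc n) - eigval n) * mode_residual N u + (\<Sum>n<K. \<Sum>p\<in>?A. ?c p * (if n < level (snd p) then eigval (Suc n) - eigval n else 0))"
      by (simp add: sum.distrib sum_distrib_right)
    also have "(\<Sum>n<K. eigval (Suc n) - eigval n) = eigval K" by (subst sum_lessThan_telescope) simp
    also have "(\<Sum>n<K. \<Sum>p\<in>?A. ?c p * (if n < level (snd p) then eigval (Suc n) - eigval n else 0))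
       = (\<Sum>p\<in>?A. ?c p * (\<Sum>n<K. if n < level (snd p) then eigval (Suc n) - eigval n else 0))"
      unfolding sum_distrib_left by (rule sum.swap)
    also have "\<dots> \<le> (\<Sum>p\<in>?A. ?c p * eigval (level (snd p)))"
      by (intro sum_mono mult_left_mono tele) auto
    also have "\<dots> \<le> energy u"
      using sum_eigval_mode_le_energy[OF u, of N] by (simp add: mult.commute)
    finally show ?thesis by simp
  qed
  hence "(\<Sum>n<K. (eigval (Suc n) - eigval n) * mode_residual n u) \<le> eigval K * 0 + energy u"
    by (intro LIMSEQ_le_const[OF lim]) blast
  thus ?thesis by simp
qed

text \<open>The argument of Rumin. The set \<open>T\<close> selects which of the two kinds of modes occur in the expansions of the \<open>u\<^sub>j\<close>, and
  the constant is proportional to the number of kinds.\<close>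
lemma Lieb_Thirring_modes:
  fixes u :: "'j \<Rightarrow> real^3 \<Rightarrow> real^3" and T :: "bool set"
  assumes H1: "\<And>j. j \<in> I \<Longrightarrow> u j \<in> H1T" and on: "orthonormal_on u I"
    and T: "T \<noteq> {}" and van: "\<And>j t \<phi>. j \<in> I \<Longrightarrow> t \<notin> T \<Longrightarrow> polyfn \<phi> \<Longrightarrow> ip (u j) (hodge_field t \<phi>) = 0"
    and \<rho>: "\<And>s. \<rho> s = (\<Sum>j\<in>I. (norm (u j s))\<^sup>2)"
  shows "integrable dS (\<lambda>s. (\<rho> s)\<^sup>2)"
    and "(\<integral>s. (\<rho> s)\<^sup>2 \<partial>dS) \<le> 9 * real (card T) / (4 * pi) * (\<Sum>j\<in>I. energy (u j))"
proof -
  define c where "c = real (card T) * (3 / (8 * pi))"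
  have "card T > 0" using T by (simp add: card_gt_0_iff finite_subset[of T UNIV])
  hence c: "c > 0" by (simp add: c_def)
  define E where "E = (\<Sum>j\<in>I. energy (u j))"
  have E: "0 \<le> E" unfolding E_def energy_def by (intro sum_nonneg) simp
  have Lu: "L2_on_S2 (u j)" if "j \<in> I" for j using on that by (simp add: orthonormal_on_def)
  let ?P = "\<lambda>n j. L2_proj mode (T \<times> modes_upto n) (u j)"
  define r where "r = (\<lambda>n s. \<Sum>j\<in>I. (norm (u j s - ?P n j s))\<^sup>2)"
  define w where "w = (\<lambda>n. eigval (Suc n) - eigval n)"
  have w: "0 \<le> w n" for n using eigval_mono[of n "Suc n"] by (simp add: w_def)
  have LP: "L2_on_S2 (\<lambda>s. u j s - ?P n j s)" if "j \<in> I" for j n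
    using ip_L2_proj(1)[OF orthonormal_on_mode Lu] Lu that by simp
  have ri: "integrable dS (r n)" for n
    unfolding r_def using LP by (intro Bochner_Integration.integrable_sum) (auto simp: L2_on_S2_def)
  have r0: "0 \<le> r n s" for n s unfolding r_def by (intro sum_nonneg) simp
  have rint: "(\<integral>s. r n s \<partial>dS) = (\<Sum>j\<in>I. mode_residual n (u j))" for n
  proof -
    have "(\<integral>s. r n s \<partial>dS) = (\<Sum>j\<in>I. \<integral>s. (norm (u j s - ?P n j s))\<^sup>2 \<partial>dS)"
      unfolding r_def using LP by (intro Bochner_Integration.integral_sum) (auto simp: L2_on_S2_def)
    also have "\<dots> = (\<Sum>j\<in>I. mode_residual n (u j))"
    proof (rule sum.cong[OF refl])
      fix j assume j: "j \<in> I"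
      have "(\<integral>s. (norm (u j s - ?P n j s))\<^sup>2 \<partial>dS) = ip (\<lambda>s. u j s - ?P n j s) (\<lambda>s. u j s - ?P n j s)"
        by (simp add: ip_def power2_norm_eq_inner)
      also have "\<dots> = ip (u j) (u j) - (\<Sum>p\<in>T \<times> modes_upto n. (ip (u j) (mode p))\<^sup>2)"
        by (rule ip_L2_proj(2)[OF orthonormal_on_mode Lu[OF j]])
      also have "(\<Sum>p\<in>T \<times> modes_upto n. (ip (u j) (mode p))\<^sup>2) = (\<Sum>p\<in>UNIV \<times> modes_upto n. (ip (u j) (mode p))\<^sup>2)"
      proof (rule sum.mono_neutral_left)
        show "\<forall>p\<in>UNIV \<times> modes_upto n - T \<times> modes_upto n. (ip (u j) (mode p))\<^sup>2 = 0"
        proof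
          fix p assume "p \<in> UNIV \<times> modes_upto n - T \<times> modes_upto n"
          then obtain t i where "p = (t, i)" "t \<notin> T" by (cases p) auto
          thus "(ip (u j) (mode p))\<^sup>2 = 0"
            using van[OF j \<open>t \<notin> T\<close> polyfn_harmonic, of i] by (simp add: mode_eq ip_scale_right)
        qed
      qed (auto simp: finite_cartesian_product)
      finally show "(\<integral>s. (norm (u j s - ?P n j s))\<^sup>2 \<partial>dS) = mode_residual n (u j)" by (simp add: mode_residual_def)
    qed
    finally show ?thesis .
  qed
  have low: "(max 0 (sqrt (\<rho> s) - sqrt (c * eigval n)))\<^sup>2 \<le> r n s" if s: "s \<in> S2" for n s
  proof -
    have "sqrt (\<rho> s) = L2_set (\<lambda>j. norm (u j s)) I" by (simp add: \<rho> L2_set_def)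
    also have "\<dots> \<le> L2_set (\<lambda>j. norm (?P n j s) + norm (u j s - ?P n j s)) I"
      by (rule L2_set_mono) (auto intro: norm_triangle_sub)
    also have "\<dots> \<le> L2_set (\<lambda>j. norm (?P n j s)) I + L2_set (\<lambda>j. norm (u j s - ?P n j s)) I"
      by (rule L2_set_triangle_ineq)
    also have "L2_set (\<lambda>j. norm (?P n j s)) I \<le> sqrt (c * eigval n)"
      unfolding L2_set_def c_def
      using sum_norm_L2_proj_le[OF on orthonormal_on_mode[of T n], of s] sum_mode_square[OF s, where T=T and n=n]
      by (intro real_sqrt_le_mono) linarith
    also have "L2_set (\<lambda>j. norm (u j s - ?P n j s)) I = sqrt (r n s)" by (simp add: r_def L2_set_def)
    finally have "max 0 (sqrt (\<rho> s) - sqrt (c * eigval n)) \<le> sqrt (r n s)" using r0 by simp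
    hence "(max 0 (sqrt (\<rho> s) - sqrt (c * eigval n)))\<^sup>2 \<le> (sqrt (r n s))\<^sup>2" by (intro power_mono) auto
    thus ?thesis using r0 by simp
  qed
  have \<rho>0: "0 \<le> \<rho> s" for s unfolding \<rho> by (intro sum_nonneg) simp
  have pw: "ennreal ((\<rho> s)\<^sup>2 / (6 * c)) \<le> (\<Sum>n. ennreal (w n * r n s))" if s: "s \<in> S2" for s
  proof -
    obtain K where K: "\<rho> s / c < real K" using reals_Archimedean2 by blast
    have "real K \<le> eigval K" by (simp add: eigval_def algebra_simps)
    hence "\<rho> s \<le> c * eigval K" using K c by (simp add: pos_divide_less_eq mult.commute) (smt (verit) mult_left_mono)
    from layer_cake_bound[OF c \<rho>0 this]
    have "(\<rho> s)\<^sup>2 / (6 * c) \<le> (\<Sum>n<K. w n * (max 0 (sqrt (\<rho> s) - sqrt (c * eigval n)))\<^sup>2)" by (simp add: w_def)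
    also have "\<dots> \<le> (\<Sum>n<K. w n * r n s)" by (intro sum_mono mult_left_mono low s w)
    finally have "ennreal ((\<rho> s)\<^sup>2 / (6 * c)) \<le> ennreal (\<Sum>n<K. w n * r n s)" by (rule ennreal_leI)
    also have "\<dots> = (\<Sum>n<K. ennreal (w n * r n s))" by (simp add: w r0)
    also have "\<dots> \<le> (\<Sum>n. ennreal (w n * r n s))" by (rule sum_le_suminf) auto
    finally show ?thesis .
  qed
  have "(\<integral>\<^sup>+s. ennreal ((\<rho> s)\<^sup>2 / (6 * c)) \<partial>dS) \<le> (\<integral>\<^sup>+s. (\<Sum>n. ennreal (w n * r n s)) \<partial>dS)"
    by (rule nn_integral_mono) (use pw in simp)
  also have "\<dots> = (\<Sum>n. \<integral>\<^sup>+s. ennreal (w n * r n s) \<partial>dS)"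
    by (rule nn_integral_suminf) (use ri in measurable)
  also have "\<dots> = (\<Sum>n. ennreal (w n * (\<Sum>j\<in>I. mode_residual n (u j))))"
    by (intro suminf_cong) (subst nn_integral_eq_integral; use ri w r0 rint in simp)
  also have "\<dots> \<le> ennreal E"
  proof (rule suminf_le_const)
    fix K
    have nn: "0 \<le> w n * (\<Sum>j\<in>I. mode_residual n (u j))" for n
      by (intro mult_nonneg_nonneg w sum_nonneg mode_residual_nonneg Lu)
    have "(\<Sum>n<K. ennreal (w n * (\<Sum>j\<in>I. mode_residual n (u j)))) = ennreal (\<Sum>n<K. w n * (\<Sum>j\<in>I. mode_residual n (u j)))"
      by (simp add: nn)
    also have "(\<Sum>n<K. w n * (\<Sum>j\<in>I. mode_residual n (u j))) = (\<Sum>j\<in>I. \<Sum>n<K. w n * mode_residual n (u j))"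
      unfolding sum_distrib_left by (rule sum.swap)
    also have "\<dots> \<le> E" unfolding E_def w_def by (intro sum_mono sum_mode_residual_le_energy H1)
    finally show "(\<Sum>n<K. ennreal (w n * (\<Sum>j\<in>I. mode_residual n (u j)))) \<le> ennreal E" by (simp add: ennreal_leI)
  qed simp
  finally have fin: "(\<integral>\<^sup>+s. ennreal ((\<rho> s)\<^sup>2 / (6 * c)) \<partial>dS) \<le> ennreal E" .
  have meas: "(\<lambda>s. (\<rho> s)\<^sup>2 / (6 * c)) \<in> borel_measurable dS"
  proof -
    have "(\<lambda>s. \<Sum>j\<in>I. (norm (u j s))\<^sup>2) \<in> borel_measurable dS"
      using Lu by (intro borel_measurable_sum) (auto simp: L2_on_S2_def)
    thus ?thesis unfolding \<rho> by measurable
  qed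
  have int: "integrable dS (\<lambda>s. (\<rho> s)\<^sup>2 / (6 * c))"
    using c by (intro integrableI_nonneg[OF meas]) (auto intro: le_less_trans[OF fin])
  hence "integrable dS (\<lambda>s. 6 * c * ((\<rho> s)\<^sup>2 / (6 * c)))" by (rule integrable_mult_right)
  thus "integrable dS (\<lambda>s. (\<rho> s)\<^sup>2)" using c by simp
  have "ennreal (\<integral>s. (\<rho> s)\<^sup>2 / (6 * c) \<partial>dS) \<le> ennreal E"
    using fin nn_integral_eq_integral[OF int] c by simp
  hence "(\<integral>s. (\<rho> s)\<^sup>2 / (6 * c) \<partial>dS) \<le> E" using E by simp
  hence "(\<integral>s. (\<rho> s)\<^sup>2 \<partial>dS) \<le> 6 * c * E" using c by (simp add: field_simps)
  thus "(\<integral>s. (\<rho> s)\<^sup>2 \<partial>dS) \<le> 9 * real (card T) / (4 * pi) * (\<Sum>j\<in>I. energy (u j))"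
    by (simp add: c_def E_def)
qed

lemma ip_AE_zero: "AE s in dS. f s = 0 \<Longrightarrow> ip f g = 0" for f g :: "real^3 \<Rightarrow> real"
  unfolding ip_def by (rule integral_eq_zero_AE) auto

lemma L2_norm_AE_zero: "AE s in dS. f s = 0 \<Longrightarrow> L2_norm f = 0"
  using integral_eq_zero_AE[of "\<lambda>s. (norm (f s))\<^sup>2" dS] by (auto simp: L2_norm_def)

theorem theorem2p2:
  fixes N :: nat
    and u :: "nat \<Rightarrow> real^3 \<Rightarrow> real^3"
    and \<rho> :: "real^3 \<Rightarrow> real"
  assumes "N \<ge> 1"
    and H1: "\<And>j. j \<in> {1..N} \<Longrightarrow> u j \<in> H1T"
    and orthonormal: "\<And>i j. i \<in> {1..N} \<Longrightarrow> j \<in> {1..N} \<Longrightarrow>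
          L2_inner (u i) (u j) = (if i = j then 1 else 0)"
    and \<rho>: "\<And>s. \<rho> s = (\<Sum>j=1..N. (norm (u j s))\<^sup>2)"
  shows "integrable dS (\<lambda>s. (\<rho> s)\<^sup>2) \<and>
      (\<integral>s. (\<rho> s)\<^sup>2 \<partial>dS) \<le>
        9 / (2 * pi) * (\<Sum>j=1..N. ((L2_norm (rot_S2 (u j)))\<^sup>2 + (L2_norm (div_S2 (u j)))\<^sup>2)) \<and>
      ((\<forall>j\<in>{1..N}. AE s in dS. div_S2 (u j) s = 0) \<longrightarrow>
        (\<integral>s. (\<rho> s)\<^sup>2 \<partial>dS) \<le>
          9 / (4 * pi) * (\<Sum>j=1..N. (L2_norm (rot_S2 (u j)))\<^sup>2)) \<and>
      ((\<forall>j\<in>{1..N}. AE s in dS. rot_S2 (u j) s = 0) \<longrightarrow>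
        (\<integral>s. (\<rho> s)\<^sup>2 \<partial>dS) \<le>
          9 / (4 * pi) * (\<Sum>j=1..N. (L2_norm (div_S2 (u j)))\<^sup>2))"
proof -
  have L2: "L2_on_S2 (u j)" if "j \<in> {1..N}" for j
    using H1[OF that] by (auto simp: H1T_def has_cov_def L2T_def)
  have on: "orthonormal_on u {1..N}"
    unfolding orthonormal_on_def
  proof (intro conjI ballI)
    fix i j assume "i \<in> {1..N}" "j \<in> {1..N}"
    thus "ip (u i) (u j) = (if i = j then 1 else 0)" using orthonormal by (simp add: ip_def L2_inner_def)
  qed (simp_all add: L2)
  note LT = Lieb_Thirring_modes[OF H1 on _ _ \<rho>]
  have 1: "integrable dS (\<lambda>s. (\<rho> s)\<^sup>2)"
    and 2: "(\<integral>s. (\<rho> s)\<^sup>2 \<partial>dS) \<le> 9 / (2 * pi) * (\<Sum>j=1..N. energy (u j))"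
    using LT[of UNIV] by (simp_all add: UNIV_bool)
  have 3: "(\<integral>s. (\<rho> s)\<^sup>2 \<partial>dS) \<le> 9 / (4 * pi) * (\<Sum>j=1..N. (L2_norm (rot_S2 (u j)))\<^sup>2)"
    if z: "\<forall>j\<in>{1..N}. AE s in dS. div_S2 (u j) s = 0"
  proof -
    have "ip (u j) (hodge_field t \<phi>) = 0" if "j \<in> {1..N}" "t \<notin> {True}" "polyfn \<phi>" for j t \<phi>
      using weak_divergence[OF H1[OF that(1)] that(3)] ip_AE_zero[of "div_S2 (u j)" \<phi>] z that by (cases t) auto
    from LT(2)[of "{True}", OF _ _ this] have "(\<integral>s. (\<rho> s)\<^sup>2 \<partial>dS) \<le> 9 / (4 * pi) * (\<Sum>j=1..N. energy (u j))"
      by simp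
    also have "(\<Sum>j=1..N. energy (u j)) = (\<Sum>j=1..N. (L2_norm (rot_S2 (u j)))\<^sup>2)"
      using z by (intro sum.cong refl) (simp add: energy_def L2_norm_AE_zero del: One_nat_def)
    finally show ?thesis .
  qed
  have 4: "(\<integral>s. (\<rho> s)\<^sup>2 \<partial>dS) \<le> 9 / (4 * pi) * (\<Sum>j=1..N. (L2_norm (div_S2 (u j)))\<^sup>2)"
    if z: "\<forall>j\<in>{1..N}. AE s in dS. rot_S2 (u j) s = 0"
  proof -
    have "ip (u j) (hodge_field t \<phi>) = 0" if "j \<in> {1..N}" "t \<notin> {False}" "polyfn \<phi>" for j t \<phi>
      using weak_rotation[OF H1[OF that(1)] that(3)] ip_AE_zero[of "rot_S2 (u j)" \<phi>] z that by (cases t) auto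
    from LT(2)[of "{False}", OF _ _ this] have "(\<integral>s. (\<rho> s)\<^sup>2 \<partial>dS) \<le> 9 / (4 * pi) * (\<Sum>j=1..N. energy (u j))"
      by simp
    also have "(\<Sum>j=1..N. energy (u j)) = (\<Sum>j=1..N. (L2_norm (div_S2 (u j)))\<^sup>2)"
      using z by (intro sum.cong refl) (simp add: energy_def L2_norm_AE_zero del: One_nat_def)
    finally show ?thesis .
  qed
  show ?thesis using 1 2 3 4 unfolding energy_def by blast
qed

end
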